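(* Let $F$ be a field of characteristic $\ne 2,3$, let $K$ be a quadratic étale $F$-algebra, let $E_7$ be the split simply connected group of type $E_7$ over $F$, and let $E_6^K$ be the simply connected quasi-split group of type $E_6$ over $F$ associated with $K$. Then the map $H^1(F,E_6^K)\to H^1(F,E_7)$ induced by the embedding $E_6^K\hookrightarrow E_7$ described in the context has trivial kernel.
   Context: $H^1(F,\cdot)$ is Galois cohomology; $F_s$ is a separable closure of $F$. $E_6^K$ is the simply connected quasi-split group of type $E_6$ which is split by an extension $L/F$ if and only if $L\otimes_F K\cong L\times L$. Let $J$ be the split Albert $F$-algebra with cubic norm $N$ (normalized by $N(1)=1$), trace form $T(x,y)=\operatorname{tr}(x\cdot y)$, and quadratic map $\#$ determined by $T(x^\#,y)=3N(x,x,y)$, where $N(\cdot,\cdot,\cdot)$ is the symmetric trilinear form with $N(x,x,x)=N(x)$. The split group $E_6$ is $\mathrm{Inv}(J)$, the group of linear maps of $J$ preserving $N$; for $\varphi\in\mathrm{Inv}(J)$, $\varphi^\dagger$ is defined by $T(\varphi(j),\varphi^\dagger(j'))=T(j,j')$. Let $V=\begin{pmatrix} F & J \\ J & F \end{pmatrix}$. $E_7$ is the group of linear automorphisms of $V$ preserving the quartic form $q\begin{pmatrix} \alpha & j \\ j' & \beta \end{pmatrix}=(\alpha\beta-T(j,j'))^2+4\alpha N(j)+4\beta N(j')-4T(j^\#,j'^\#)$ and the alternating form $\left\langle\begin{pmatrix} \alpha & j \\ j' & \beta \end{pmatrix},\begin{pmatrix} \gamma & k \\ k' & \delta \end{pmatrix}\right\rangle=\alpha\delta-\beta\gamma+T(j,k')-T(j',k)$.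 The group $E_6$ embeds in $E_7$ by $\varphi\cdot\begin{pmatrix} \alpha & j \\ j' & \beta \end{pmatrix}=\begin{pmatrix} \alpha & \varphi(j) \\ \varphi^\dagger(j') & \beta \end{pmatrix}$. Fix $i\in F_s$ with $i^2=-1$ and let $\omega\begin{pmatrix} \alpha & j \\ j' & \beta \end{pmatrix}=\begin{pmatrix} i\beta & i j' \\ i j & i\alpha \end{pmatrix}$; then $i\mapsto\omega$ identifies $\mu_4$ with a subgroup of $E_7$ (defined over $F$) normalizing $E_6$, giving a subgroup $E_6\rtimes\mu_4\subset E_7$. Description of the embedding $E_6^K\hookrightarrow E_7$: let $b\in Z^1(F,\mu_4)$ be a 1-cocycle whose image in $H^1(F,\mu_2)=F^*/F^{*2}$ (under squaring $\mu_4\to\mu_2$) is the class of $K$, regarded via $\mu_4\subset E_7$ as a cocycle with values in $E_7$. For a group $X$ normalized by $\mu_4$, $X_b$ denotes $X$ with twisted Galois action $\sigma * x=b_\sigma\,{}^\sigma x\,b_\sigma^{-1}$. Then $(E_6)_b\cong E_6^K$, and $b$ is trivial in $H^1(F,E_7)$, so $b_\sigma=g^{-1}\,{}^\sigma g$ for some $g\in E_7(F_s)$ and $x\mapsto gxg^{-1}$ is an $F$-isomorphism $(E_7)_b\cong E_7$. The embedding is the composite $E_6^K\cong(E_6)_b\subset(E_7)_b\cong E_7$. *)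

theory Defs
  imports
    "HOL-Analysis.Function_Topology"
    "HOL-Library.Product_Plus"
    "HOL-Computational_Algebra.Polynomial"
    "HOL-Algebra.Group"
begin

section \<open>Fields, separable closures, quadratic etale algebras\<close>

definition is_ring_hom :: "('a::comm_ring_1 \<Rightarrow> 'b::comm_ring_1) \<Rightarrow> bool" where
  "is_ring_hom f \<longleftrightarrow>
     f 1 = 1 \<and> (\<forall>x y. f (x + y) = f x + f y) \<and> (\<forall>x y. f (x * y) = f x * f y)"

definition separable_poly :: "'a::field poly \<Rightarrow> bool" where
  "separable_poly p \<longleftrightarrow> coprime p (pderiv p)"

text \<open>An element of a commutative algebra (with structure map \<open>h\<close>) that has a separable minimal
  polynomial.\<close>

definition separable_element :: "('f::field \<Rightarrow> 'a::comm_ring_1) \<Rightarrow> 'a \<Rightarrow> bool" where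
  "separable_element h x \<longleftrightarrow>
     (\<exists>p. irreducible p \<and> separable_poly p \<and> poly (map_poly h p) x = 0)"

definition separably_closed :: "'k::field itself \<Rightarrow> bool" where
  "separably_closed _ \<longleftrightarrow>
     (\<forall>p :: 'k poly. degree p > 0 \<and> separable_poly p \<longrightarrow> (\<exists>x. poly p x = 0))"

definition separable_closure :: "('f::field \<Rightarrow> 'k::field) \<Rightarrow> bool" where
  "separable_closure \<iota> \<longleftrightarrow>
     is_ring_hom \<iota> \<and> (\<forall>x. separable_element \<iota> x) \<and> separably_closed TYPE('k)"

text \<open>A quadratic etale \<open>F\<close>-algebra is a two-dimensional algebra that is either \<open>F \<times> F\<close>
  (the two homomorphisms below are the projections) or a separable field extension of \<open>F\<close>.\<close>

definition quadratic_etale :: "('f::field \<Rightarrow> 'c::comm_ring_1) \<Rightarrow> bool" where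
  "quadratic_etale \<kappa> \<longleftrightarrow>
     is_ring_hom \<kappa> \<and> vector_space.dim (\<lambda>a x. \<kappa> a * x) (UNIV :: 'c set) = 2 \<and>
     ((\<exists>p1 p2 :: 'c \<Rightarrow> 'f. is_ring_hom p1 \<and> is_ring_hom p2 \<and>
          (\<forall>a. p1 (\<kappa> a) = a \<and> p2 (\<kappa> a) = a) \<and> bij (\<lambda>x. (p1 x, p2 x))) \<or>
      ((\<forall>x :: 'c. x \<noteq> 0 \<longrightarrow> (\<exists>y. x * y = 1)) \<and> (\<forall>x :: 'c. separable_element \<kappa> x)))"

text \<open>The class of \<open>K\<close> in \<open>F\<^sup>* / F\<^sup>*\<^sup>2\<close>, as a coset: the \<open>d\<close> with \<open>K \<cong> F[x]/(x\<^sup>2 - d)\<close>.\<close>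

definition quadratic_class :: "('f::field \<Rightarrow> 'c::comm_ring_1) \<Rightarrow> 'f set" where
  "quadratic_class \<kappa> =
     {d. d \<noteq> 0 \<and> (\<exists>z. z ^ 2 = \<kappa> d \<and> bij (\<lambda>(a, b). \<kappa> a + \<kappa> b * z))}"


section \<open>Galois cohomology\<close>

definition Gal :: "('f::field \<Rightarrow> 'k::field) \<Rightarrow> ('k \<Rightarrow> 'k) set" where
  "Gal \<iota> = {\<sigma>. bij \<sigma> \<and> is_ring_hom \<sigma> \<and> (\<forall>a. \<sigma> (\<iota> a) = \<iota> a)}"

text \<open>The Krull topology is the topology of pointwise convergence for the discrete topology on
  the separable closure.\<close>

definition krull_topology :: "('f::field \<Rightarrow> 'k::field) \<Rightarrow> ('k \<Rightarrow> 'k) topology" where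
  "krull_topology \<iota> =
     subtopology (product_topology (\<lambda>_. discrete_topology UNIV) UNIV) (Gal \<iota>)"

text \<open>A group of points over the separable closure, with its Galois action \<open>gact\<close>.\<close>

record ('g, 'k) gal_group = "'g monoid" +
  gact :: "('k \<Rightarrow> 'k) \<Rightarrow> 'g \<Rightarrow> 'g"

definition Z1 :: "('f::field \<Rightarrow> 'k::field) \<Rightarrow> ('g, 'k) gal_group \<Rightarrow> (('k \<Rightarrow> 'k) \<Rightarrow> 'g) set" where
  "Z1 \<iota> G = {a \<in> Gal \<iota> \<rightarrow>\<^sub>E carrier G.
     continuous_map (krull_topology \<iota>) (discrete_topology (carrier G)) a \<and>
     (\<forall>\<sigma>\<in>Gal \<iota>. \<forall>\<tau>\<in>Gal \<iota>. a (\<sigma> \<circ> \<tau>) = a \<sigma> \<otimes>\<^bsub>G\<^esub> gact G \<sigma> (a \<tau>))}"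

definition H1_class ::
  "('f::field \<Rightarrow> 'k::field) \<Rightarrow> ('g, 'k) gal_group \<Rightarrow> (('k \<Rightarrow> 'k) \<Rightarrow> 'g) \<Rightarrow> (('k \<Rightarrow> 'k) \<Rightarrow> 'g) set"
where
  "H1_class \<iota> G a = {a' \<in> Z1 \<iota> G.
     \<exists>x\<in>carrier G. \<forall>\<sigma>\<in>Gal \<iota>. a' \<sigma> = inv\<^bsub>G\<^esub> x \<otimes>\<^bsub>G\<^esub> a \<sigma> \<otimes>\<^bsub>G\<^esub> gact G \<sigma> x}"

definition H1 ::
  "('f::field \<Rightarrow> 'k::field) \<Rightarrow> ('g, 'k) gal_group \<Rightarrow> (('k \<Rightarrow> 'k) \<Rightarrow> 'g) set set" where
  "H1 \<iota> G = H1_class \<iota> G ` Z1 \<iota> G"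

definition H1_trivial ::
  "('f::field \<Rightarrow> 'k::field) \<Rightarrow> ('g, 'k) gal_group \<Rightarrow> (('k \<Rightarrow> 'k) \<Rightarrow> 'g) set" where
  "H1_trivial \<iota> G = H1_class \<iota> G (\<lambda>\<sigma>\<in>Gal \<iota>. \<one>\<^bsub>G\<^esub>)"

text \<open>The map induced on cohomology by a Galois-equivariant homomorphism \<open>f\<close> into \<open>H\<close>; the sets
  in the union all coincide.\<close>

definition H1_map ::
  "('f::field \<Rightarrow> 'k::field) \<Rightarrow> ('h, 'k) gal_group \<Rightarrow> ('g \<Rightarrow> 'h) \<Rightarrow>
     (('k \<Rightarrow> 'k) \<Rightarrow> 'g) set \<Rightarrow> (('k \<Rightarrow> 'k) \<Rightarrow> 'h) set" where
  "H1_map \<iota> H f c = (\<Union>a\<in>c. H1_class \<iota> H (\<lambda>\<sigma>\<in>Gal \<iota>. f (a \<sigma>)))"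

definition H1_kernel ::
  "('f::field \<Rightarrow> 'k::field) \<Rightarrow> ('g, 'k) gal_group \<Rightarrow> ('h, 'k) gal_group \<Rightarrow> ('g \<Rightarrow> 'h) \<Rightarrow>
     (('k \<Rightarrow> 'k) \<Rightarrow> 'g) set set" where
  "H1_kernel \<iota> G H f = {c \<in> H1 \<iota> G. H1_map \<iota> H f c = H1_trivial \<iota> H}"

definition mu :: "nat \<Rightarrow> ('k::field, 'k) gal_group" where
  "mu n = \<lparr>carrier = {z. z ^ n = 1}, mult = (*), one = 1, gact = (\<lambda>\<sigma>. \<sigma>)\<rparr>"

text \<open>The isomorphism \<open>F\<^sup>* / F\<^sup>*\<^sup>2 \<rightarrow> H\<^sup>1(F, \<mu>\<^sub>2)\<close> of Kummer theory, evaluated on the class of \<open>d\<close>.\<close>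

definition kummer_class :: "('f::field \<Rightarrow> 'k::field) \<Rightarrow> 'f \<Rightarrow> (('k \<Rightarrow> 'k) \<Rightarrow> 'k) set" where
  "kummer_class \<iota> d = (\<Union>s\<in>{s. s ^ 2 = \<iota> d}. H1_class \<iota> (mu 2) (\<lambda>\<sigma>\<in>Gal \<iota>. \<sigma> s / s))"


section \<open>Split octonions\<close>

text \<open>Zorn vector matrices: \<open>(a, u, v, b)\<close> is the matrix with rows \<open>(a, u)\<close> and \<open>(v, b)\<close>.\<close>

type_synonym 'k vec3 = "'k \<times> 'k \<times> 'k"
type_synonym 'k oct = "'k \<times> 'k vec3 \<times> 'k vec3 \<times> 'k"

fun map_vec3 :: "('k \<Rightarrow> 'k) \<Rightarrow> 'k vec3 \<Rightarrow> 'k vec3" where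
  "map_vec3 f (x, y, z) = (f x, f y, f z)"

fun dot3 :: "'k::field vec3 \<Rightarrow> 'k vec3 \<Rightarrow> 'k" where
  "dot3 (x1, x2, x3) (y1, y2, y3) = x1 * y1 + x2 * y2 + x3 * y3"

fun crossp :: "'k::field vec3 \<Rightarrow> 'k vec3 \<Rightarrow> 'k vec3" where
  "crossp (x1, x2, x3) (y1, y2, y3) =
     (x2 * y3 - x3 * y2, x3 * y1 - x1 * y3, x1 * y2 - x2 * y1)"

fun map_oct :: "('k \<Rightarrow> 'k) \<Rightarrow> 'k oct \<Rightarrow> 'k oct" where
  "map_oct f (a, u, v, b) = (f a, map_vec3 f u, map_vec3 f v, f b)"

definition oct_scalar :: "'k::field \<Rightarrow> 'k oct" where
  "oct_scalar c = (c, 0, 0, c)"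

fun oct_mult :: "'k::field oct \<Rightarrow> 'k oct \<Rightarrow> 'k oct" where
  "oct_mult (a, u, v, b) (a', u', v', b') =
     (a * a' + dot3 u v',
      map_vec3 ((*) a) u' + map_vec3 ((*) b') u - crossp v v',
      map_vec3 ((*) a') v + map_vec3 ((*) b) v' + crossp u u',
      dot3 v u' + b * b')"

fun oct_conj :: "'k::field oct \<Rightarrow> 'k oct" where
  "oct_conj (a, u, v, b) = (b, - u, - v, a)"

fun oct_trace :: "'k::field oct \<Rightarrow> 'k" where
  "oct_trace (a, u, v, b) = a + b"

fun oct_norm :: "'k::field oct \<Rightarrow> 'k" where
  "oct_norm (a, u, v, b) = a * b - dot3 u v"


section \<open>The split Albert algebra\<close>

text \<open>Hermitian 3 by 3 matrices over the split octonions: \<open>(x1, x2, x3, c1, c2, c3)\<close> is the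
  matrix with rows \<open>(x1, c3, c2\<^sup>*)\<close>, \<open>(c3\<^sup>*, x2, c1)\<close>, \<open>(c2, c1\<^sup>*, x3)\<close>, where \<open>\<^sup>*\<close> is conjugation.\<close>

type_synonym 'k albert = "'k \<times> 'k \<times> 'k \<times> 'k oct \<times> 'k oct \<times> 'k oct"

fun map_albert :: "('k \<Rightarrow> 'k) \<Rightarrow> 'k albert \<Rightarrow> 'k albert" where
  "map_albert f (x1, x2, x3, c1, c2, c3) =
     (f x1, f x2, f x3, map_oct f c1, map_oct f c2, map_oct f c3)"

abbreviation scale_albert :: "'k::field \<Rightarrow> 'k albert \<Rightarrow> 'k albert" where
  "scale_albert c \<equiv> map_albert ((*) c)"

definition one_albert :: "'k::field albert" where
  "one_albert = (1, 1, 1, 0, 0, 0)"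

fun albert_matrix :: "'k::field albert \<Rightarrow> nat \<Rightarrow> nat \<Rightarrow> 'k oct" where
  "albert_matrix (x1, x2, x3, c1, c2, c3) r s =
     [[oct_scalar x1, c3, oct_conj c2],
      [oct_conj c3, oct_scalar x2, c1],
      [c2, oct_conj c1, oct_scalar x3]] ! r ! s"

definition matrix_mult :: "(nat \<Rightarrow> nat \<Rightarrow> 'k::field oct) \<Rightarrow> (nat \<Rightarrow> nat \<Rightarrow> 'k oct) \<Rightarrow> nat \<Rightarrow> nat \<Rightarrow> 'k oct"
where
  "matrix_mult A B r s = (\<Sum>t<3. oct_mult (A r t) (B t s))"

text \<open>The product \<open>x \<cdot> y\<close> is half the sum of the two matrix products \<open>x y\<close> and \<open>y x\<close>, which is again
  hermitian; the entries are read off in the positions fixed above.\<close>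

definition jordan_mult :: "'k::field albert \<Rightarrow> 'k albert \<Rightarrow> 'k albert" where
  "jordan_mult x y =
     (let X = albert_matrix x; Y = albert_matrix y;
          P = (\<lambda>r s. map_oct ((*) (1 / 2)) (matrix_mult X Y r s + matrix_mult Y X r s))
      in (fst (P 0 0), fst (P 1 1), fst (P 2 2), P 1 2, P 2 0, P 0 1))"

fun albert_trace :: "'k::field albert \<Rightarrow> 'k" where
  "albert_trace (x1, x2, x3, c1, c2, c3) = x1 + x2 + x3"

definition trace_form :: "'k::field albert \<Rightarrow> 'k albert \<Rightarrow> 'k" where
  "trace_form x y = albert_trace (jordan_mult x y)"

fun cubic_norm :: "'k::field albert \<Rightarrow> 'k" where
  "cubic_norm (x1, x2, x3, c1, c2, c3) =
     x1 * x2 * x3 - x1 * oct_norm c1 - x2 * oct_norm c2 - x3 * oct_norm c3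
       + oct_trace (oct_mult (oct_mult c1 c2) c3)"

definition norm_trilinear :: "'k::field albert \<Rightarrow> 'k albert \<Rightarrow> 'k albert \<Rightarrow> 'k" where
  "norm_trilinear x y z =
     (cubic_norm (x + y + z) - cubic_norm (x + y) - cubic_norm (y + z) - cubic_norm (x + z)
        + cubic_norm x + cubic_norm y + cubic_norm z) / 6"

text \<open>In characteristic other than 2 the trace form is nondegenerate, so that the definite
  descriptions in \<open>sharp\<close> and (for \<open>\<phi>\<close> in \<open>InvJ\<close>) in \<open>dagger\<close> are well-defined.\<close>

definition sharp :: "'k::field albert \<Rightarrow> 'k albert" where
  "sharp x = (THE z. \<forall>y. trace_form z y = 3 * norm_trilinear x x y)"

definition InvJ :: "('k::field albert \<Rightarrow> 'k albert) set" where
  "InvJ = {\<phi>. Vector_Spaces.linear scale_albert scale_albert \<phi> \<and> bij \<phi> \<and>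
              (\<forall>x. cubic_norm (\<phi> x) = cubic_norm x)}"

definition dagger :: "('k::field albert \<Rightarrow> 'k albert) \<Rightarrow> 'k albert \<Rightarrow> 'k albert" where
  "dagger \<phi> = (THE \<psi>. \<forall>x y. trace_form (\<phi> x) (\<psi> y) = trace_form x y)"


section \<open>The groups of type E6 and E7\<close>

text \<open>\<open>(\<alpha>, j, j', \<beta>)\<close> is the matrix with rows \<open>(\<alpha>, j)\<close> and \<open>(j', \<beta>)\<close>.\<close>

type_synonym 'k freud = "'k \<times> 'k albert \<times> 'k albert \<times> 'k"

fun map_freud :: "('k \<Rightarrow> 'k) \<Rightarrow> 'k freud \<Rightarrow> 'k freud" where
  "map_freud f (\<alpha>, j, j', \<beta>) = (f \<alpha>, map_albert f j, map_albert f j', f \<beta>)"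

abbreviation scale_freud :: "'k::field \<Rightarrow> 'k freud \<Rightarrow> 'k freud" where
  "scale_freud c \<equiv> map_freud ((*) c)"

fun quartic_form :: "'k::field freud \<Rightarrow> 'k" where
  "quartic_form (\<alpha>, j, j', \<beta>) =
     (\<alpha> * \<beta> - trace_form j j') ^ 2 + 4 * \<alpha> * cubic_norm j + 4 * \<beta> * cubic_norm j'
       - 4 * trace_form (sharp j) (sharp j')"

fun alt_form :: "'k::field freud \<Rightarrow> 'k freud \<Rightarrow> 'k" where
  "alt_form (\<alpha>, j, j', \<beta>) (\<gamma>, k, k', \<delta>) =
     \<alpha> * \<delta> - \<beta> * \<gamma> + trace_form j k' - trace_form j' k"

text \<open>The Galois action on linear maps of \<open>V\<close>; all forms above have coefficients in the prime
  field, so that \<open>\<sigma>\<close> acts on \<open>V\<close> through the coordinates.\<close>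

definition galois_conj :: "('k::field \<Rightarrow> 'k) \<Rightarrow> ('k freud \<Rightarrow> 'k freud) \<Rightarrow> 'k freud \<Rightarrow> 'k freud" where
  "galois_conj \<sigma> \<Phi> = map_freud \<sigma> \<circ> \<Phi> \<circ> map_freud (inv_into UNIV \<sigma>)"

definition E7 :: "('k::field freud \<Rightarrow> 'k freud, 'k) gal_group" where
  "E7 = \<lparr>carrier = {\<Phi>. Vector_Spaces.linear scale_freud scale_freud \<Phi> \<and> bij \<Phi> \<and>
                      (\<forall>v. quartic_form (\<Phi> v) = quartic_form v) \<and>
                      (\<forall>v w. alt_form (\<Phi> v) (\<Phi> w) = alt_form v w)},
         mult = (\<circ>), one = id, gact = galois_conj\<rparr>"

definition E6_embed :: "('k::field albert \<Rightarrow> 'k albert) \<Rightarrow> 'k freud \<Rightarrow> 'k freud" where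
  "E6_embed \<phi> = (\<lambda>(\<alpha>, j, j', \<beta>). (\<alpha>, \<phi> j, dagger \<phi> j', \<beta>))"

definition omega :: "'k::field \<Rightarrow> 'k freud \<Rightarrow> 'k freud" where
  "omega i = (\<lambda>(\<alpha>, j, j', \<beta>). (i * \<beta>, scale_albert i j', scale_albert i j, i * \<alpha>))"

text \<open>The embedding of \<open>\<mu>\<^sub>4\<close> into \<open>E7\<close> that sends \<open>i\<close> to \<open>omega i\<close>.\<close>

definition mu4_embed :: "'k::field \<Rightarrow> 'k \<Rightarrow> 'k freud \<Rightarrow> 'k freud" where
  "mu4_embed i z = (THE \<Phi>. \<exists>n. z = i ^ n \<and> \<Phi> = omega i ^^ n)"

text \<open>The twisted group \<open>(E6)\<^sub>b\<close>, where \<open>E6\<close> is regarded as a subgroup of \<open>E7\<close>.\<close>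

definition E6K ::
  "'k::field \<Rightarrow> (('k \<Rightarrow> 'k) \<Rightarrow> 'k) \<Rightarrow> ('k freud \<Rightarrow> 'k freud, 'k) gal_group" where
  "E6K i b =
     \<lparr>carrier = E6_embed ` InvJ, mult = (\<circ>), one = id,
      gact = (\<lambda>\<sigma> x. mu4_embed i (b \<sigma>) \<otimes>\<^bsub>E7\<^esub> gact E7 \<sigma> x \<otimes>\<^bsub>E7\<^esub> inv\<^bsub>E7\<^esub> (mu4_embed i (b \<sigma>)))\<rparr>"

end

theory Submission
  imports Defs
begin

text \<open>
  The stabilizer of \<open>(1, 0, 0, 1)\<close> in \<open>E7\<close> is \<open>E6\<close>, because polarizing the quartic form at this vector
  recovers the grading of \<open>V\<close> and the cubic norm on both copies of \<open>J\<close>. As \<open>\<mu>\<^sub>4\<close> acts on this vector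
  by scalars, the line through its image under \<open>g\<close> is Galois-stable and contains a Galois-fixed vector
  \<open>w\<close> (divide by a nonzero coordinate); so the twisted group is the stabilizer of \<open>w\<close>. If a cocycle of
  the stabilizer becomes the coboundary of \<open>h\<close> in \<open>E7\<close>, then \<open>h w\<close> is again Galois-fixed, with the
  same quartic invariant, and the cocycle is trivial as soon as \<open>h w = r w\<close> for some Galois-fixed \<open>r\<close>
  in \<open>E7\<close>. Such an \<open>r\<close> always exists: using translations by elements of \<open>J\<close> and the diagonalization
  of elements of \<open>J\<close> under \<open>E6\<close>, every Galois-fixed vector with \<open>q \<noteq> 0\<close> is moved to
  \<open>(1, diag(q / 4, 1, 1), 0, 0)\<close>.
\<close>

section \<open>The Freudenthal adjoint of the split Albert algebra\<close>

text \<open>The orbit problems are solvable over F because there are elements \<open>c\<close> with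
  \<open>adj c = 0\<close> whose coordinates are only 0 and 1: these are Galois-fixed, and some such
  \<open>c\<close> pairs nontrivially with any given nonzero element. A translation by a multiple of
  such a \<open>c\<close>, or an elementary matrix with an isotropic octonion, changes the
  coordinate to be normalized by an amount linear in the multiple. A prescribed value is thus
  reached by one division and never by extracting a root. This is where splitness enters.

  The computational obstacle is that \<open>sharp\<close> and \<open>dagger\<close> are definite
  descriptions and that V has 56 coordinates. Everything on J is reduced to the explicit polynomials
  \<open>adj\<close>, \<open>tform\<close> and \<open>cubic_norm\<close>. Coordinates are expanded
  for a few base identities; the linearized ones follow by polarizing \<open>adj_adj\<close>, at the
  price of dividing by 2 and 3.\<close>

fun adj :: "'k::field albert \<Rightarrow> 'k albert" where
  "adj (x1, x2, x3, c1, c2, c3) =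
     (x2 * x3 - oct_norm c1, x3 * x1 - oct_norm c2, x1 * x2 - oct_norm c3,
      oct_conj (oct_mult c2 c3) - map_oct ((*) x1) c1,
      oct_conj (oct_mult c3 c1) - map_oct ((*) x2) c2,
      oct_conj (oct_mult c1 c2) - map_oct ((*) x3) c3)"

text \<open>The polar form of \<open>oct_norm\<close>.\<close>

fun oct_inner :: "'k::field oct \<Rightarrow> 'k oct \<Rightarrow> 'k" where
  "oct_inner (a, u, v, b) (a', u', v', b') = a * b' + b * a' - dot3 u v' - dot3 v u'"

text \<open>A division-free version of \<open>trace_form\<close> that avoids the Jordan product;
  they are identified in \<open>trace_form_eq\<close>.\<close>

fun tform :: "'k::field albert \<Rightarrow> 'k albert \<Rightarrow> 'k" where
  "tform (x1, x2, x3, c1, c2, c3) (y1, y2, y3, d1, d2, d3) =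
     x1 * y1 + x2 * y2 + x3 * y3 + oct_inner c1 d1 + oct_inner c2 d2 + oct_inner c3 d3"

text \<open>The Freudenthal product, i.e. the linearization of \<open>adj\<close>, normalized so
  that \<open>cross x x\<close> is twice \<open>adj x\<close>.\<close>

definition cross :: "'k::field albert \<Rightarrow> 'k albert \<Rightarrow> 'k albert" where
  "cross x y = adj (x + y) - adj x - adj y"

lemma oct_exhaust:
  obtains a u1 u2 u3 v1 v2 v3 b where "(x::'k oct) = (a, (u1, u2, u3), (v1, v2, v3), b)"
  by (metis prod.exhaust)

lemma albert_exhaust:
  obtains x1 x2 x3 a1 p1 p2 p3 q1 q2 q3 b1 a2 r1 r2 r3 s1 s2 s3 b2 a3 t1 t2 t3 w1 w2 w3 b3
  where "(x::'k albert) = (x1, x2, x3, (a1, (p1, p2, p3), (q1, q2, q3), b1),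
     (a2, (r1, r2, r3), (s1, s2, s3), b2), (a3, (t1, t2, t3), (w1, w2, w3), b3))"
  by (cases x) (metis oct_exhaust)

lemma scale_albert_simps [simp]:
  "scale_albert c (x + y) = scale_albert c x + scale_albert c y"
  "scale_albert c (x - y) = scale_albert c x - scale_albert c y"
  "scale_albert c (- x) = - scale_albert c x"
  "scale_albert c (0 :: 'k::field albert) = 0"
  "scale_albert (- c) x = - scale_albert c x"
  "scale_albert 0 x = 0"
  "scale_albert 1 x = x"
  "scale_albert c (scale_albert d x) = scale_albert (c * d) x"
  by (cases x rule: albert_exhaust; cases y rule: albert_exhaust;
      simp add: zero_prod_def algebra_simps)+

lemma scale_albert_add_left: "scale_albert (c + d) x = scale_albert c x + scale_albert d x"
  by (cases x rule: albert_exhaust; simp add: algebra_simps)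

text \<open>Expanded once in all 27 coordinates; its linearizations are extracted without
  coordinates in \<open>cross_adj_expansion\<close>.\<close>

lemma adj_adj: "adj (adj x) = scale_albert (cubic_norm x) x"
  by (cases x rule: albert_exhaust; simp add: algebra_simps)

lemma cubic_norm_add:
  "cubic_norm (x + y) = cubic_norm x + tform (adj x) y + tform x (adj y) + cubic_norm y"
  by (cases x rule: albert_exhaust; cases y rule: albert_exhaust; simp add: algebra_simps)

lemma cubic_norm_scale [simp]: "cubic_norm (scale_albert c x) = c ^ 3 * cubic_norm x"
  by (cases x rule: albert_exhaust; simp add: power3_eq_cube algebra_simps)

lemma adj_scale [simp]: "adj (scale_albert c x) = scale_albert (c * c) (adj x)"
  by (cases x rule: albert_exhaust; simp add: algebra_simps)

lemma tform_adj_self: "tform (adj x) x = 3 * cubic_norm x"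
  by (cases x rule: albert_exhaust; simp add: algebra_simps)

lemma tform_commute: "tform x y = tform y x"
  by (cases x rule: albert_exhaust; cases y rule: albert_exhaust; simp add: algebra_simps)

lemma tform_simps [simp]:
  "tform (x + y) z = tform x z + tform y z"
  "tform (x - y) z = tform x z - tform y z"
  "tform (- x) z = - tform x z"
  "tform 0 z = 0"
  "tform (scale_albert c x) z = c * tform x z"
  by (cases x rule: albert_exhaust; cases y rule: albert_exhaust; cases z rule: albert_exhaust;
      simp add: zero_prod_def algebra_simps)+

lemma tform_simps_right [simp]:
  "tform z (x + y) = tform z x + tform z y"
  "tform z (x - y) = tform z x - tform z y"
  "tform z (- x) = - tform z x"
  "tform z 0 = 0"
  "tform z (scale_albert c x) = c * tform z x"
  by (simp_all add: tform_commute [of z])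

lemma adj_add: "adj (x + y) = adj x + cross x y + adj y"
  by (simp add: cross_def)

lemma cross_commute: "cross x y = cross y x"
  by (simp add: cross_def add.commute)

text \<open>Both sides are the full polarization of the cubic norm, which is symmetric in its three
  arguments. This is the rule for moving \<open>cross\<close> across the form.\<close>

lemma tform_cross: "tform (cross x y) z = tform x (cross y z)"
  by (cases x rule: albert_exhaust; cases y rule: albert_exhaust; cases z rule: albert_exhaust;
      simp add: cross_def algebra_simps)

lemma cross_simps [simp]:
  "cross (x + y) z = cross x z + cross y z"
  "cross (scale_albert c x) z = scale_albert c (cross x z)"
  by (cases x rule: albert_exhaust; cases y rule: albert_exhaust; cases z rule: albert_exhaust;
      simp add: cross_def algebra_simps)+

lemma scale_minus_one: "- x = scale_albert (- 1) x"
  by simp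

lemma cross_minus [simp]: "cross (- x) z = - cross x z"
  by (subst scale_minus_one, subst cross_simps) simp

lemma cross_simps_right [simp]:
  "cross z (x + y) = cross z x + cross z y"
  "cross z (- x) = - cross z x"
  "cross z (scale_albert c x) = scale_albert c (cross z x)"
  by (simp_all add: cross_commute [of z])

lemma adj_minus [simp]: "adj (- x) = adj x"
  by (subst scale_minus_one, subst adj_scale) simp

lemma cubic_norm_minus [simp]: "cubic_norm (- x) = - cubic_norm x"
  by (subst scale_minus_one, subst cubic_norm_scale) simp

lemma adj_0 [simp]: "adj (0 :: 'k::field albert) = 0"
  using adj_scale [of 0 "0 :: 'k albert"] by (simp del: adj_scale)

lemma cubic_norm_0 [simp]: "cubic_norm (0 :: 'k::field albert) = 0"
  using cubic_norm_scale [of 0 "0 :: 'k albert"] by (simp del: cubic_norm_scale)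

lemma cross_0 [simp]: "cross 0 x = 0" "cross x 0 = 0"
  by (simp_all add: cross_def)

lemma cross_self: "cross x x = adj x + adj x"
proof -
  have "x + x = scale_albert 2 x"
    using scale_albert_add_left [of 1 1 x] by simp
  moreover have "scale_albert (2 * 2) (adj x) = adj x + adj x + adj x + adj x"
    using scale_albert_add_left [of 2 2 "adj x"] scale_albert_add_left [of 1 1 "adj x"] 
    by (simp add: add.assoc)
  ultimately show ?thesis
    unfolding cross_def by (simp only: adj_scale) (simp add: algebra_simps)
qed

section \<open>Representation of linear functionals, and elements of zero adjoint with entries 0 and
  1\<close>

lemma oct_functional:
  fixes f :: "'k::field oct \<Rightarrow> 'k"
  assumes add: "\<And>x y. f (x + y) = f x + f y"
    and scale: "\<And>c x. f (map_oct ((*) c) x) = c * f x"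
  shows "\<exists>d. \<forall>c. f c = oct_inner c d"
proof -
  let ?d = "(f (0,(0,0,0),(0,0,0),1),
     (- f (0,(0,0,0),(1,0,0),0), - f (0,(0,0,0),(0,1,0),0), - f (0,(0,0,0),(0,0,1),0)),
     (- f (0,(1,0,0),(0,0,0),0), - f (0,(0,1,0),(0,0,0),0), - f (0,(0,0,1),(0,0,0),0)),
     f (1,(0,0,0),(0,0,0),0))"
  have "f c = oct_inner c ?d" for c
  proof -
    obtain a u1 u2 u3 v1 v2 v3 b where c: "c = (a, (u1, u2, u3), (v1, v2, v3), b)"
      by (rule oct_exhaust)
    have "c = map_oct ((*) a) (1,(0,0,0),(0,0,0),0) + map_oct ((*) u1) (0,(1,0,0),(0,0,0),0)
      + map_oct ((*) u2) (0,(0,1,0),(0,0,0),0) + map_oct ((*) u3) (0,(0,0,1),(0,0,0),0)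
      + map_oct ((*) v1) (0,(0,0,0),(1,0,0),0) + map_oct ((*) v2) (0,(0,0,0),(0,1,0),0)
      + map_oct ((*) v3) (0,(0,0,0),(0,0,1),0) + map_oct ((*) b) (0,(0,0,0),(0,0,0),1)"
      by (simp add: c)
    then have "f c = a * f (1,(0,0,0),(0,0,0),0) + u1 * f (0,(1,0,0),(0,0,0),0)
      + u2 * f (0,(0,1,0),(0,0,0),0) + u3 * f (0,(0,0,1),(0,0,0),0)
      + v1 * f (0,(0,0,0),(1,0,0),0) + v2 * f (0,(0,0,0),(0,1,0),0)
      + v3 * f (0,(0,0,0),(0,0,1),0) + b * f (0,(0,0,0),(0,0,0),1)"
      by (simp only: add scale)
    then show ?thesis by (simp add: c algebra_simps)
  qed
  then show ?thesis by blast
qed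

lemma albert_functional:
  fixes f :: "'k::field albert \<Rightarrow> 'k"
  assumes add: "\<And>x y. f (x + y) = f x + f y"
    and scale: "\<And>c x. f (scale_albert c x) = c * f x"
  shows "\<exists>y. \<forall>x. f x = tform x y"
proof -
  have z: "map_oct ((*) c) 0 = 0" for c :: 'k
    by (simp add: zero_prod_def)
  obtain d1 where d1: "\<And>c. f (0,0,0,c,0,0) = oct_inner c d1"
    using oct_functional [of "\<lambda>c. f (0,0,0,c,0,0)"] add [of "(0,0,0,_,0,0)" "(0,0,0,_,0,0)"]
      scale [of _ "(0,0,0,_,0,0)"] by (auto simp: z)
  obtain d2 where d2: "\<And>c. f (0,0,0,0,c,0) = oct_inner c d2"
    using oct_functional [of "\<lambda>c. f (0,0,0,0,c,0)"] add [of "(0,0,0,0,_,0)" "(0,0,0,0,_,0)"]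
      scale [of _ "(0,0,0,0,_,0)"] by (auto simp: z)
  obtain d3 where d3: "\<And>c. f (0,0,0,0,0,c) = oct_inner c d3"
    using oct_functional [of "\<lambda>c. f (0,0,0,0,0,c)"] add [of "(0,0,0,0,0,_)" "(0,0,0,0,0,_)"]
      scale [of _ "(0,0,0,0,0,_)"] by (auto simp: z)
  let ?y = "(f (1,0,0,0,0,0), f (0,1,0,0,0,0), f (0,0,1,0,0,0), d1, d2, d3)"
  have "f x = tform x ?y" for x
  proof -
    obtain x1 x2 x3 c1 c2 c3 where x: "x = (x1,x2,x3,c1,c2,c3)"
      by (cases x) auto
    have "x = scale_albert x1 (1,0,0,0,0,0) + scale_albert x2 (0,1,0,0,0,0)
      + scale_albert x3 (0,0,1,0,0,0) + (0,0,0,c1,0,0) + (0,0,0,0,c2,0) + (0,0,0,0,0,c3)"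
      by (simp add: x z)
    then have "f x = x1 * f (1,0,0,0,0,0) + x2 * f (0,1,0,0,0,0) + x3 * f (0,0,1,0,0,0)
      + f (0,0,0,c1,0,0) + f (0,0,0,0,c2,0) + f (0,0,0,0,0,c3)"
      by (simp only: add scale)
    then show ?thesis by (simp add: x d1 d2 d3)
  qed
  then show ?thesis by blast
qed

text \<open>The eight coordinate vectors are isotropic, and pairing with them reads off every
  coordinate of \<open>d\<close> up to sign. Their entries are 0 and 1, which makes \<open>e\<close>
  invariant under every field automorphism, whatever \<open>d\<close> is.\<close>

lemma oct_dual_exists:
  fixes d :: "'k::field oct"
  assumes "d \<noteq> 0"
  shows "\<exists>e. oct_norm e = 0 \<and> oct_inner e d \<noteq> 0 \<and> (\<forall>\<sigma>. \<sigma> 0 = 0 \<and> \<sigma> 1 = 1 \<longrightarrow> map_oct \<sigma> e = e)"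
proof (rule ccontr)
  assume neg: "\<nexists>e. oct_norm e = 0 \<and> oct_inner e d \<noteq> 0 \<and> (\<forall>\<sigma>. \<sigma> 0 = 0 \<and> \<sigma> 1 = 1 \<longrightarrow> map_oct \<sigma> e = e)"
  have "oct_inner e d = 0" if "oct_norm e = 0" "\<forall>\<sigma>. \<sigma> 0 = 0 \<and> \<sigma> 1 = 1 \<longrightarrow> map_oct \<sigma> e = e" for e
    using neg that by blast
  from this [of "(1,(0,0,0),(0,0,0),0)"] this [of "(0,(1,0,0),(0,0,0),0)"]
    this [of "(0,(0,1,0),(0,0,0),0)"] this [of "(0,(0,0,1),(0,0,0),0)"]
    this [of "(0,(0,0,0),(1,0,0),0)"] this [of "(0,(0,0,0),(0,1,0),0)"]
    this [of "(0,(0,0,0),(0,0,1),0)"] this [of "(0,(0,0,0),(0,0,0),1)"]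
  show False using assms by (cases d rule: oct_exhaust) (simp add: zero_prod_def)
qed

text \<open>Diagonal units, and isotropic octonions placed in a single off-diagonal slot, have zero
  adjoint; one of them detects a nonzero coordinate of \<open>y\<close>.\<close>

lemma rank_one_dual_exists:
  fixes y :: "'k::field albert"
  assumes "y \<noteq> 0"
  shows "\<exists>e. adj e = 0 \<and> tform e y \<noteq> 0 \<and> (\<forall>\<sigma>. \<sigma> 0 = 0 \<and> \<sigma> 1 = 1 \<longrightarrow> map_albert \<sigma> e = e)"
proof -
  obtain x1 x2 x3 c1 c2 c3 where y: "y = (x1,x2,x3,c1,c2,c3)"
    by (cases y) auto
  have oz: "map_oct \<sigma> 0 = 0" if "\<sigma> 0 = 0" for \<sigma> :: "'k \<Rightarrow> 'k"
    using that by (simp add: zero_prod_def)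
  have iz: "oct_inner 0 d = 0" for d :: "'k oct"
    by (cases d rule: oct_exhaust) (simp add: zero_prod_def)
  have nz: "oct_norm (0::'k oct) = 0" "oct_conj (0::'k oct) = 0"
      "oct_mult 0 e = 0" "oct_mult e 0 = 0" for e :: "'k oct"
    by (cases e rule: oct_exhaust; simp add: zero_prod_def)+
  have zp: "(0, 0, 0, 0, 0, 0) = (0 :: 'k albert)" by (simp add: zero_prod_def)
  have sz: "map_oct ((*) 0) e = 0" for e :: "'k oct"
    by (cases e rule: oct_exhaust) (simp add: zero_prod_def)
  consider "x1 \<noteq> 0" | "x2 \<noteq> 0" | "x3 \<noteq> 0" | "c1 \<noteq> 0" | "c2 \<noteq> 0" | "c3 \<noteq> 0"
    using assms y by (force simp: zero_prod_def)
  then show ?thesis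
  proof cases
    case 1 show ?thesis by (rule exI [of _ "(1,0,0,0,0,0)"]) (simp add: 1 y oz iz nz sz zp)
  next
    case 2 show ?thesis by (rule exI [of _ "(0,1,0,0,0,0)"]) (simp add: 2 y oz iz nz sz zp)
  next
    case 3 show ?thesis by (rule exI [of _ "(0,0,1,0,0,0)"]) (simp add: 3 y oz iz nz sz zp)
  next
    case 4
    then obtain e where "oct_norm e = 0" "oct_inner e c1 \<noteq> 0" "\<forall>\<sigma>. \<sigma> 0 = 0 \<and> \<sigma> 1 = 1 \<longrightarrow> map_oct \<sigma> e = e"
      using oct_dual_exists by blast
    then show ?thesis by (intro exI [of _ "(0,0,0,e,0,0)"]) (simp add: y oz iz nz sz zp)
  next
    case 5
    then obtain e where "oct_norm e = 0" "oct_inner e c2 \<noteq> 0" "\<forall>\<sigma>. \<sigma> 0 = 0 \<and> \<sigma> 1 = 1 \<longrightarrow> map_oct \<sigma> e = e"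
      using oct_dual_exists by blast
    then show ?thesis by (intro exI [of _ "(0,0,0,0,e,0)"]) (simp add: y oz iz nz sz zp)
  next
    case 6
    then obtain e where "oct_norm e = 0" "oct_inner e c3 \<noteq> 0" "\<forall>\<sigma>. \<sigma> 0 = 0 \<and> \<sigma> 1 = 1 \<longrightarrow> map_oct \<sigma> e = e"
      using oct_dual_exists by blast
    then show ?thesis by (intro exI [of _ "(0,0,0,0,0,e)"]) (simp add: y oz iz nz sz zp)
  qed
qed

lemma tform_nondegenerate: "(\<And>x. tform x y = 0) \<Longrightarrow> y = 0"
  using rank_one_dual_exists by blast

lemma tform_eqI: "(\<And>x. tform x y = tform x z) \<Longrightarrow> y = z"
  using tform_nondegenerate [of "y - z"] by simp

section \<open>Identification of the forms given by description, and the polarized adjoint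
  identities\<close>

locale char_not_2_3 =
  fixes ty :: "'k::field itself"
  assumes two_neq_0 [simp]: "(2::'k) \<noteq> 0" and three_neq_0 [simp]: "(3::'k) \<noteq> 0"
begin

lemma four_neq_0 [simp]: "(4::'k) \<noteq> 0"
  using no_zero_divisors [OF two_neq_0 two_neq_0] by simp

lemma six_neq_0 [simp]: "(6::'k) \<noteq> 0"
  using no_zero_divisors [OF two_neq_0 three_neq_0] by simp

lemma trace_form_eq: "trace_form x (y::'k albert) = tform x y"
proof -
  have three: "{..<3::nat} = {0,1,2}" by auto
  \<comment> \<open>With 1/2 named, the claim is a polynomial identity in \<open>h\<close> and the
    coordinates, and the simplifier meets no fractions.\<close>
  obtain h :: 'k where h: "1 / 2 = h" by blast
  have "2 * h = 1" by (simp add: h [symmetric])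
  have "trace_form x y = (2 * h) * tform x y"
    by (cases x rule: albert_exhaust; cases y rule: albert_exhaust;
      simp add: trace_form_def jordan_mult_def matrix_mult_def oct_scalar_def Let_def three h
        zero_prod_def numeral_2_eq_2 del: One_nat_def; simp add: algebra_simps)
  with \<open>2 * h = 1\<close> show ?thesis by simp
qed

lemma norm_trilinear_eq: "3 * norm_trilinear x x (y::'k albert) = tform (adj x) y"
proof -
  have "tform x (cross x y) = 2 * tform (adj x) y"
    by (simp add: tform_cross [symmetric] cross_self)
  then have "6 * norm_trilinear x x y = 2 * tform (adj x) y"
    by (simp add: norm_trilinear_def cubic_norm_add adj_add tform_adj_self cross_self
        tform_commute [of x "adj x"] algebra_simps)
  then have "2 * (3 * norm_trilinear x x y) = 2 * tform (adj x) y" by simp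
  then show ?thesis by (simp only: mult_cancel_left two_neq_0) simp
qed

lemma sharp_eq: "sharp (x::'k albert) = adj x"
  unfolding sharp_def trace_form_eq norm_trilinear_eq
  by (rule the_equality) (auto intro: tform_eqI simp: tform_commute)

text \<open>These are the components of degree two and one in \<open>y\<close> of
  \<open>adj_adj\<close> at \<open>x + y\<close>. Comparing with \<open>- y\<close> and with
  \<open>scale_albert 2 y\<close> separates the degrees.\<close>

lemma cross_adj_expansion:
  fixes x y :: "'k albert"
  shows adj_cross: "adj (cross x y) + cross (adj x) (adj y) =
      scale_albert (tform x (adj y)) x + scale_albert (tform (adj x) y) y" (is ?A)
    and cross_adj_cross: "cross (adj x) (cross x y) =
      scale_albert (cubic_norm x) y + scale_albert (tform (adj x) y) x" (is ?B)
proof -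
  have e: "tform z (cross (adj x) (cross x y)) + tform z (adj (cross x y))
      + tform z (cross (adj x) (adj y)) + tform z (cross (cross x y) (adj y))
    = tform (adj x) y * tform z x + tform x (adj y) * tform z x + cubic_norm y * tform z x
      + cubic_norm x * tform z y + tform (adj x) y * tform z y + tform x (adj y) * tform z y"
    for x y z :: "'k albert"
    using arg_cong [OF adj_adj [of "x + y"], of "tform z"]
    by (simp add: adj_add adj_adj cubic_norm_add cross_commute [of "cross x y" "adj y"]
        algebra_simps)
  have eA: "2 * (tform z (adj (cross x y)) + tform z (cross (adj x) (adj y)))
      = 2 * (tform x (adj y) * tform z x + tform (adj x) y * tform z y)" for z
    using e [of z x y] e [of z x "- y", simplified] by algebra
  have eA': "tform z (adj (cross x y)) + tform z (cross (adj x) (adj y))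
      = tform x (adj y) * tform z x + tform (adj x) y * tform z y" for z
    using eA [of z] by (simp only: mult_cancel_left two_neq_0) simp
  then show ?A
    by (intro tform_eqI) simp
  define odd where "odd z = tform z (cross (adj x) (cross x y)) - cubic_norm x * tform z y
     - tform (adj x) y * tform z x" for z
  define cub where "cub z = tform z (cross (cross x y) (adj y)) - cubic_norm y * tform z x
     - tform x (adj y) * tform z y" for z
  have o1: "odd z + cub z = 0" for z
    using e [of z x y] eA' [of z] unfolding odd_def cub_def by algebra
  \<comment> \<open>Doubling \<open>y\<close> multiplies the part of degree one by 2 and that of
    degree three by 8, so together with \<open>o1\<close> only 6 times \<open>odd\<close>
    remains.\<close>
  have o2: "2 * odd z + 8 * cub z = 0" for z
    using e [of z x "scale_albert 2 y", simplified] eA' [of z] unfolding odd_def cub_def by algebra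
  have "6 * odd z = 0" for z
    using o1 [of z] o2 [of z] by algebra
  then have "odd z = 0" for z by simp
  then show ?B
    unfolding odd_def by (intro tform_eqI) (simp add: algebra_simps)
qed
end

section \<open>The norm-preserving group and its contragredient action\<close>

declare split_paired_All [simp del] split_paired_Ex [simp del]

lemma vector_space_scale_albert: "vector_space (scale_albert :: 'k::field \<Rightarrow> _)"
  by unfold_locales (simp_all add: scale_albert_add_left)

lemma freud_exhaust:
  obtains \<alpha> j j' \<beta> where "(v::'k freud) = (\<alpha>, j, j', \<beta>)"
  by (cases v) auto

lemma scale_freud_simps [simp]:
  "scale_freud c (v + w) = scale_freud c v + scale_freud c w"
  "scale_freud c (v - w) = scale_freud c v - scale_freud c w"
  "scale_freud 1 v = v"
  "scale_freud c (scale_freud d v) = scale_freud (c * d) v"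
  by (cases v rule: freud_exhaust; cases w rule: freud_exhaust; simp add: algebra_simps)+

lemma vector_space_scale_freud: "vector_space (scale_freud :: 'k::field \<Rightarrow> _)"
proof
  show "scale_freud (a + b) x = scale_freud a x + scale_freud b x" for a b :: 'k and x
    by (cases x rule: freud_exhaust) (simp add: scale_albert_add_left algebra_simps)
qed simp_all

lemma linear_albert_iff:
  "Vector_Spaces.linear scale_albert scale_albert \<phi> \<longleftrightarrow>
    (\<forall>x y. \<phi> (x + y) = \<phi> x + \<phi> y) \<and> (\<forall>c x. \<phi> (scale_albert c x) = scale_albert (c::'k::field) (\<phi> x))"
  by (simp add: Vector_Spaces.linear_iff vector_space_scale_albert)

lemma linear_freud_iff:
  "Vector_Spaces.linear scale_freud scale_freud \<Phi> \<longleftrightarrow>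
    (\<forall>x y. \<Phi> (x + y) = \<Phi> x + \<Phi> y) \<and> (\<forall>c x. \<Phi> (scale_freud c x) = scale_freud (c::'k::field) (\<Phi> x))"
  by (simp add: Vector_Spaces.linear_iff vector_space_scale_freud)

lemma InvJ_iff:
  "\<phi> \<in> InvJ \<longleftrightarrow> (\<forall>x y. \<phi> (x + y) = \<phi> x + \<phi> y) \<and>
     (\<forall>c x. \<phi> (scale_albert c x) = scale_albert (c::'k::field) (\<phi> x)) \<and> bij \<phi> \<and>
     (\<forall>x. cubic_norm (\<phi> x) = cubic_norm x)"
  by (auto simp: InvJ_def linear_albert_iff)

lemma InvJD:
  assumes "\<phi> \<in> InvJ"
  shows "\<phi> (x + y) = \<phi> x + \<phi> y" "\<phi> (scale_albert c x) = scale_albert (c::'k::field) (\<phi> x)"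
    "\<phi> (x - y) = \<phi> x - \<phi> y" "bij \<phi>" "cubic_norm (\<phi> x) = cubic_norm x"
proof -
  show add: "\<phi> (x + y) = \<phi> x + \<phi> y" for x y using assms by (simp add: InvJ_iff)
  show "\<phi> (scale_albert c x) = scale_albert c (\<phi> x)" "bij \<phi>" "cubic_norm (\<phi> x) = cubic_norm x"
    using assms by (auto simp: InvJ_iff)
  show "\<phi> (x - y) = \<phi> x - \<phi> y" using add [of "x - y" y] by (simp add: algebra_simps)
qed

lemma InvJ_inv:
  assumes "\<phi> \<in> InvJ" shows "inv_into UNIV \<phi> \<in> (InvJ :: ('k::field albert \<Rightarrow> _) set)"
proof -
  note [simp] = InvJD [OF assms]
  have s [simp]: "\<phi> (inv_into UNIV \<phi> x) = x" for x by (simp add: bij_is_surj surj_f_inv_f)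
  have t [simp]: "inv_into UNIV \<phi> (\<phi> x) = x" for x by (simp add: bij_is_inj)
  have "inv_into UNIV \<phi> (x + y) = inv_into UNIV \<phi> x + inv_into UNIV \<phi> y" for x y
    using t [of "inv_into UNIV \<phi> x + inv_into UNIV \<phi> y"] by (simp del: t)
  moreover have "inv_into UNIV \<phi> (scale_albert c x) = scale_albert c (inv_into UNIV \<phi> x)" for c x
    using t [of "scale_albert c (inv_into UNIV \<phi> x)"] by (simp del: t)
  moreover have "cubic_norm (inv_into UNIV \<phi> x) = cubic_norm x" for x
    using InvJD(5) [OF assms, of "inv_into UNIV \<phi> x"] by (simp del: InvJD)
  ultimately show ?thesis by (simp add: InvJ_iff bij_imp_bij_inv)
qed

lemma additive_adjoint_exists:
  fixes \<chi> :: "'k::field albert \<Rightarrow> 'k albert"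
  assumes "\<And>x y. \<chi> (x + y) = \<chi> x + \<chi> y" "\<And>c x. \<chi> (scale_albert c x) = scale_albert c (\<chi> x)"
  shows "\<exists>\<psi>. \<forall>x y. tform (\<chi> x) y = tform x (\<psi> y)"
proof -
  have "\<exists>w. \<forall>x. tform (\<chi> x) y = tform x w" for y
    using assms by (intro albert_functional) simp_all
  then show ?thesis by metis
qed

context char_not_2_3
begin

lemma dagger_eqI:
  assumes "surj \<phi>" and "\<And>x y. tform (\<phi> x) (\<psi> y) = tform x (y::'k albert)"
  shows "dagger \<phi> = \<psi>"
  unfolding dagger_def trace_form_eq
proof (rule the_equality)
  show "\<forall>x y. tform (\<phi> x) (\<psi> y) = tform x y" using assms by simp
next
  fix \<psi>' assume *: "\<forall>x y. tform (\<phi> x) (\<psi>' y) = tform x y"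
  have "tform z (\<psi>' y) = tform z (\<psi> y)" for y z
    using * assms(2) surjD [OF assms(1), of z] by metis
  then show "\<psi>' = \<psi>" by (intro ext tform_eqI)
qed

text \<open>The adjoint of the inverse of \<phi> with respect to \<open>tform\<close> satisfies the
  description of \<open>dagger\<close>; it exists because linear functionals on J are represented by
  \<open>tform\<close>.\<close>

lemma tform_dagger:
  assumes "\<phi> \<in> InvJ" shows "tform (\<phi> x) (dagger \<phi> y) = tform x (y::'k albert)"
proof -
  note i = InvJ_inv [OF assms]
  obtain \<psi> where \<psi>: "\<And>x y. tform (inv_into UNIV \<phi> x) y = tform x (\<psi> y)"
    using additive_adjoint_exists [of "inv_into UNIV \<phi>"] InvJD(1,2) [OF i] by metis
  have "tform (\<phi> x) (\<psi> y) = tform x y" for x y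
    using \<psi> [of "\<phi> x" y] InvJD(4) [OF assms] by (simp add: bij_is_inj)
  then show ?thesis
    using dagger_eqI [of \<phi> \<psi>] InvJD(4) [OF assms] by (simp add: bij_is_surj)
qed

text \<open>Expresses the derivative of the cubic norm through values of the norm, so that it is
  respected by every linear map preserving the norm.\<close>

lemma tform_adj_eq:
  "2 * tform (adj x) y = cubic_norm (x + y) - cubic_norm (x - y) - 2 * cubic_norm (y::'k albert)"
  using cubic_norm_add [of x y] cubic_norm_add [of x "- y"] by simp

lemma tform_adj_InvJ:
  assumes "\<phi> \<in> InvJ" shows "tform (adj (\<phi> x)) (\<phi> y) = tform (adj x) (y::'k albert)"
proof -
  have "2 * tform (adj (\<phi> x)) (\<phi> y) = 2 * tform (adj x) y"
    unfolding tform_adj_eq InvJD(1,3) [OF assms, symmetric] InvJD(5) [OF assms] by simp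
  then show ?thesis by (simp only: mult_cancel_left two_neq_0) simp
qed

text \<open>Against \<open>\<phi> y\<close>, both sides pair like \<open>adj x\<close> against
  \<open>y\<close>: the left one by definition of \<open>dagger\<close>, the right one because
  \<phi> preserves the derivative of the norm.\<close>

lemma dagger_adj:
  assumes "\<phi> \<in> InvJ" shows "dagger \<phi> (adj x) = adj (\<phi> (x::'k albert))"
proof (rule tform_eqI)
  fix z
  obtain y where "z = \<phi> y" using InvJD(4) [OF assms] by (metis bij_is_surj surjD)
  then show "tform z (dagger \<phi> (adj x)) = tform z (adj (\<phi> x))"
    by (simp add: tform_dagger [OF assms])
      (simp add: tform_commute [of _ "adj _"] tform_adj_InvJ [OF assms])
qed

lemma cubic_norm_adj: "cubic_norm (adj x) = (cubic_norm (x::'k albert))\<^sup>2"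
proof -
  have "3 * cubic_norm (adj x) = 3 * (cubic_norm x)\<^sup>2"
    using tform_adj_self [of "adj x"]
    by (simp add: adj_adj tform_adj_self tform_commute [of x "adj x"] power2_eq_square algebra_simps)
  then show ?thesis by (simp only: mult_cancel_left three_neq_0) simp
qed

lemma dagger_in_InvJ:
  assumes "\<phi> \<in> InvJ" shows "dagger \<phi> \<in> (InvJ :: ('k albert \<Rightarrow> _) set)"
proof -
  have eqI: "a = b" if "\<And>x. tform (\<phi> x) a = tform (\<phi> x) b" and \<phi>_in: "\<phi> \<in> InvJ"
    for a b and \<phi> :: "'k albert \<Rightarrow> 'k albert"
    using that InvJD(4) [OF \<phi>_in] by (intro tform_eqI) (metis bij_is_surj surjD)
  have add: "dagger \<phi> (x + y) = dagger \<phi> x + dagger \<phi> y" for x y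
    by (rule eqI [OF _ assms]) (simp add: tform_dagger [OF assms])
  have scale: "dagger \<phi> (scale_albert c x) = scale_albert c (dagger \<phi> x)" for c x
    by (rule eqI [OF _ assms]) (simp add: tform_dagger [OF assms])
  have inverse: "dagger \<phi> (dagger (inv_into UNIV \<phi>) y) = y" if \<phi>: "\<phi> \<in> InvJ" for y and \<phi> :: "'k albert \<Rightarrow> 'k albert"
  proof (rule eqI [OF _ \<phi>])
    fix x
    have "tform x (dagger (inv_into UNIV \<phi>) y) = tform (inv_into UNIV \<phi> (\<phi> x)) (dagger (inv_into UNIV \<phi>) y)"
      using InvJD(4) [OF \<phi>] by (simp add: bij_is_inj)
    then show "tform (\<phi> x) (dagger \<phi> (dagger (inv_into UNIV \<phi>) y)) = tform (\<phi> x) y"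
      by (simp add: tform_dagger [OF \<phi>] tform_dagger [OF InvJ_inv [OF \<phi>]])
  qed
  have "inv_into UNIV (inv_into UNIV \<phi>) = \<phi>" using InvJD(4) [OF assms] by (rule inv_inv_eq)
  then have inverse': "dagger (inv_into UNIV \<phi>) (dagger \<phi> y) = y" for y
    using inverse [OF InvJ_inv [OF assms]] by simp
  have "bij (dagger \<phi>)"
    by (rule o_bij [of "dagger (inv_into UNIV \<phi>)"]) (auto simp: inverse [OF assms] inverse')
  \<comment> \<open>An element of nonzero norm is a multiple of the adjoint of its adjoint.\<close>
  have nz: "cubic_norm (dagger \<psi> y) = cubic_norm y" if "cubic_norm y \<noteq> 0" and \<psi>: "\<psi> \<in> InvJ"
    for y and \<psi> :: "'k albert \<Rightarrow> 'k albert"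
  proof -
    have "dagger \<psi> (adj (adj y)) = adj (\<psi> (adj y))" by (rule dagger_adj [OF \<psi>])
    then have "cubic_norm (dagger \<psi> (scale_albert (cubic_norm y) y)) = cubic_norm y ^ 4"
      by (simp add: adj_adj cubic_norm_adj InvJD(5) [OF \<psi>] flip: power_mult)
    moreover have "dagger \<psi> (scale_albert c y) = scale_albert c (dagger \<psi> y)" for c
      by (rule eqI [OF _ \<psi>]) (simp add: tform_dagger [OF \<psi>])
    ultimately have "cubic_norm y ^ 3 * cubic_norm (dagger \<psi> y) = cubic_norm y ^ 3 * cubic_norm y"
      by (simp add: power4_eq_xxxx power3_eq_cube)
    with that show ?thesis by simp
  qed
  \<comment> \<open>If \<open>y\<close> has norm 0 but its image does not, then \<open>nz\<close>
    for the inverse of \<phi>, applied to the image, gives a contradiction.\<close>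
  have "cubic_norm (dagger \<phi> y) = cubic_norm y" for y
    using nz [OF _ assms, of y] nz [OF _ InvJ_inv [OF assms], of "dagger \<phi> y"] inverse' by fastforce
  then show ?thesis using add scale \<open>bij (dagger \<phi>)\<close> by (simp add: InvJ_iff)
qed

text \<open>This is \<open>dagger_adj\<close> for \<open>dagger \<phi>\<close>, since
  \<open>dagger\<close> is involutive on \<open>InvJ\<close>.\<close>

lemma adj_dagger:
  assumes "\<phi> \<in> InvJ" shows "adj (dagger \<phi> y) = \<phi> (adj (y::'k albert))"
proof -
  note d = dagger_in_InvJ [OF assms]
  have "dagger (dagger \<phi>) = \<phi>"
    using InvJD(4) [OF d]
    by (intro dagger_eqI) (simp_all add: bij_is_surj tform_dagger [OF assms] tform_commute [of "dagger \<phi> _"] tform_commute)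
  then show ?thesis using dagger_adj [OF d] by simp
qed

end

section \<open>The stabilizer of the base vector\<close>

lemma E7_iff:
  "\<Phi> \<in> carrier E7 \<longleftrightarrow> (\<forall>v w. \<Phi> (v + w) = \<Phi> v + \<Phi> w) \<and>
     (\<forall>c v. \<Phi> (scale_freud c v) = scale_freud (c::'k::field) (\<Phi> v)) \<and> bij \<Phi> \<and>
     (\<forall>v. quartic_form (\<Phi> v) = quartic_form v) \<and> (\<forall>v w. alt_form (\<Phi> v) (\<Phi> w) = alt_form v w)"
  unfolding E7_def linear_freud_iff by simp

lemma E7D:
  assumes "\<Phi> \<in> carrier E7"
  shows "\<Phi> (v + w) = \<Phi> v + \<Phi> w" "\<Phi> (scale_freud c v) = scale_freud (c::'k::field) (\<Phi> v)"
    "bij \<Phi>" "quartic_form (\<Phi> v) = quartic_form v" "alt_form (\<Phi> v) (\<Phi> w) = alt_form v w"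
  using assms unfolding E7_iff by blast+

lemma E7_simps [simp]: "mult E7 = (\<circ>)" "one E7 = id" "gact E7 = galois_conj"
  by (simp_all add: E7_def)

lemma E7_inv_into:
  assumes "\<Phi> \<in> carrier E7" shows "inv_into UNIV \<Phi> \<in> (carrier E7 :: ('k::field freud \<Rightarrow> _) set)"
proof -
  note d = E7D [OF assms]
  have s [simp]: "\<Phi> (inv_into UNIV \<Phi> x) = x" for x using d(3) by (simp add: bij_is_surj surj_f_inv_f)
  have t [simp]: "inv_into UNIV \<Phi> (\<Phi> x) = x" for x using d(3) by (simp add: bij_is_inj)
  have "inv_into UNIV \<Phi> (x + y) = inv_into UNIV \<Phi> x + inv_into UNIV \<Phi> y" for x y
    using t [of "inv_into UNIV \<Phi> x + inv_into UNIV \<Phi> y"] by (simp add: d(1) del: t)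
  moreover have "inv_into UNIV \<Phi> (scale_freud c x) = scale_freud c (inv_into UNIV \<Phi> x)" for c x
    using t [of "scale_freud c (inv_into UNIV \<Phi> x)"] by (simp add: d(2) del: t)
  moreover have "quartic_form (inv_into UNIV \<Phi> x) = quartic_form x" for x
    using d(4) [of "inv_into UNIV \<Phi> x"] by simp
  moreover have "alt_form (inv_into UNIV \<Phi> x) (inv_into UNIV \<Phi> y) = alt_form x y" for x y
    using d(5) [of "inv_into UNIV \<Phi> x" "inv_into UNIV \<Phi> y"] by simp
  ultimately show ?thesis using d(3) by (simp add: E7_iff bij_imp_bij_inv)
qed

lemma group_E7: "group E7"
proof (rule groupI)
  fix x :: "'a::field freud \<Rightarrow> 'a freud" assume x: "x \<in> carrier E7"
  have "inv_into UNIV x \<otimes>\<^bsub>E7\<^esub> x = \<one>\<^bsub>E7\<^esub>"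
    using E7D(3) [OF x] by (simp add: bij_is_inj)
  then show "\<exists>y\<in>carrier E7. y \<otimes>\<^bsub>E7\<^esub> x = \<one>\<^bsub>E7\<^esub>"
    using E7_inv_into [OF x] by blast
qed (auto simp: E7_iff bij_comp o_assoc)

lemma inv_E7:
  assumes "x \<in> carrier E7" shows "inv\<^bsub>E7\<^esub> x = inv_into UNIV x"
  using E7D(3) [OF assms] assms E7_inv_into [OF assms]
  by (intro group.inv_equality [OF group_E7]) (simp_all add: bij_is_inj)

definition base_vec :: "'k::field freud" where "base_vec = (1, 0, 0, 1)"

context char_not_2_3
begin

lemma quartic_form_eq:
  "quartic_form (\<alpha>, j, j', \<beta>) = (\<alpha> * \<beta> - tform j j')\<^sup>2 + 4 * \<alpha> * cubic_norm j + 4 * \<beta> * cubic_norm j'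
     - 4 * tform (adj j) (adj (j' :: 'k albert))"
  by (simp add: trace_form_eq sharp_eq)

lemma alt_form_eq:
  "alt_form (\<alpha>, j, j', \<beta>) (\<gamma>, k, k', \<delta>) = \<alpha> * \<delta> - \<beta> * \<gamma> + tform j k' - tform (j' :: 'k albert) k"
  by (simp add: trace_form_eq)

declare quartic_form.simps [simp del] alt_form.simps [simp del]
declare quartic_form_eq [simp] alt_form_eq [simp]

lemma E6_embed_in_E7:
  assumes \<phi>: "\<phi> \<in> (InvJ :: ('k albert \<Rightarrow> _) set)" shows "E6_embed \<phi> \<in> carrier E7"
proof -
  note p = InvJD [OF \<phi>] and d = InvJD [OF dagger_in_InvJ [OF \<phi>]]
  let ?\<psi> = "\<lambda>(\<alpha>, j, j', \<beta>). (\<alpha>, inv_into UNIV \<phi> j, inv_into UNIV (dagger \<phi>) j', \<beta>)"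
  have "bij (E6_embed \<phi>)"
    by (rule o_bij [of ?\<psi>])
      (simp_all add: fun_eq_iff E6_embed_def case_prod_beta bij_is_inj bij_is_surj surj_f_inv_f p(4) d(4))
  moreover have "quartic_form (E6_embed \<phi> v) = quartic_form v" for v
  proof (cases v rule: freud_exhaust)
    case (1 \<alpha> j j' \<beta>)
    have "tform (adj (\<phi> j)) (adj (dagger \<phi> j')) = tform (dagger \<phi> (adj j)) (\<phi> (adj j'))"
      by (simp add: adj_dagger [OF \<phi>] dagger_adj [OF \<phi>])
    also have "\<dots> = tform (adj j) (adj j')"
      by (metis tform_commute tform_dagger [OF \<phi>])
    finally show ?thesis
      by (simp add: 1 E6_embed_def tform_dagger [OF \<phi>] p(5) d(5))
  qed
  moreover have "alt_form (E6_embed \<phi> v) (E6_embed \<phi> w) = alt_form v w" for v w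
    by (cases v rule: freud_exhaust; cases w rule: freud_exhaust;
        simp add: E6_embed_def tform_dagger [OF \<phi>] tform_commute [of "dagger \<phi> _"];
        simp add: tform_commute)
  moreover have "E6_embed \<phi> (v + w) = E6_embed \<phi> v + E6_embed \<phi> w" for v w
    by (cases v rule: freud_exhaust; cases w rule: freud_exhaust; simp add: E6_embed_def p(1) d(1))
  moreover have "E6_embed \<phi> (scale_freud c v) = scale_freud c (E6_embed \<phi> v)" for v c
    by (cases v rule: freud_exhaust; simp add: E6_embed_def p(2) d(2))
  ultimately show ?thesis unfolding E7_iff by blast
qed

lemma E6_embed_base_vec:
  assumes \<phi>: "\<phi> \<in> (InvJ :: ('k albert \<Rightarrow> _) set)" shows "E6_embed \<phi> base_vec = base_vec"
proof -
  have "\<psi> 0 = 0" if "\<psi> \<in> (InvJ :: ('k albert \<Rightarrow> _) set)" for \<psi>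
    using InvJD(1) [OF that, of 0 0] by simp
  then show ?thesis using \<phi> dagger_in_InvJ [OF \<phi>] by (simp add: E6_embed_def base_vec_def)
qed

text \<open>\<open>cross one_albert a\<close> equals tr(a) 1 - a, and a = tr(a) 1 would give 2 tr(a)
  = 0.\<close>

lemma cross_one_eq_0:
  assumes "cross one_albert a = (0 :: 'k albert)" shows "a = 0"
proof -
  have zp: "(0 :: 'k albert) = (0, 0, 0, 0, 0, 0)" by (simp add: zero_prod_def)
  obtain a1 a2 a3 c1 c2 c3 where a: "a = (a1, a2, a3, c1, c2, c3)"
    by (cases a) metis
  have c: "cross one_albert (a1, a2, a3, c1, c2, c3) = (a2 + a3, a3 + a1, a1 + a2, - c1, - c2, - c3)"
    by (cases c1 rule: oct_exhaust; cases c2 rule: oct_exhaust; cases c3 rule: oct_exhaust;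
        simp add: cross_def one_albert_def zero_prod_def algebra_simps)
  with assms a have "(a2 + a3, a3 + a1, a1 + a2, - c1, - c2, - c3) = (0, 0, 0, 0, 0, 0)"
    using c zp by (simp only:)
  then have z: "a2 + a3 = 0" "a3 + a1 = 0" "a1 + a2 = 0" "c1 = 0" "c2 = 0" "c3 = 0"
    unfolding prod.inject neg_equal_0_iff_equal by blast+
  have "2 * a1 = (a3 + a1) + (a1 + a2) - (a2 + a3)" by algebra
  with z have "a1 = 0" by simp
  with z zp show ?thesis unfolding a by simp
qed

text \<open>Polarizing the assumption shows that \<open>cross k one_albert\<close> is orthogonal to
  \<open>a\<close> for all \<open>k\<close>; moving \<open>cross\<close> to the other side leads to
  \<open>cross_one_eq_0\<close>.\<close>

lemma adj_span:
  assumes "\<And>k. tform (adj k) a = 0" shows "a = (0 :: 'k albert)"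
proof -
  have "tform k (cross one_albert a) = 0" for k
  proof -
    have "tform (cross k one_albert) a = 0" by (simp add: cross_def assms)
    then show ?thesis by (simp only: tform_cross)
  qed
  then show ?thesis by (rule cross_one_eq_0 [OF tform_nondegenerate])
qed

text \<open>Since \<open>(x, y) \<mapsto> f x + g y\<close> is onto, each \<open>g y\<close> is a direction along which the cubic norm is
  constant everywhere, hence zero.\<close>

lemma norm_projection:
  fixes f g :: "'k albert \<Rightarrow> 'k albert"
  assumes f: "\<And>x y. f (x + y) = f x + f y" and g: "\<And>x y. g (x + y) = g x + g y"
    and norm: "\<And>x y. cubic_norm (f x + g y) = cubic_norm x"
    and surj: "\<And>k. \<exists>x y. f x + g y = k"
  shows "bij f" and "g y = 0"
proof -
  have f0 [simp]: "f 0 = 0" using f [of 0 0] by simp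
  have g0 [simp]: "g 0 = 0" using g [of 0 0] by simp
  have fm: "f (x - y) = f x - f y" for x y using f [of "x - y" y] by (simp add: algebra_simps)
  have gm: "g (x - y) = g x - g y" for x y using g [of "x - y" y] by (simp add: algebra_simps)
  show g_0: "g y = 0" for y
  proof (rule adj_span)
    fix k
    obtain u v where k: "k = f u + g v" using surj by metis
    \<comment> \<open>Written in this form, \<open>k + g y\<close> and \<open>k - g y\<close> both
      have the norm of \<open>u\<close>, and \<open>g y\<close> has the norm of 0.\<close>
    have "k + g y = f u + g (v + y)" "k - g y = f u + g (v - y)" "g y = f 0 + g y"
      by (simp_all add: k g gm)
    then have "2 * tform (adj k) (g y) = 0"
      unfolding tform_adj_eq by (metis norm cubic_norm_0 diff_self mult_zero_right)
    then show "tform (adj k) (g y) = 0" by simp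
  qed
  \<comment> \<open>As \<open>f\<close> preserves norms, a vector in its kernel is likewise a
    direction in which the norm is constant.\<close>
  have "x = 0" if "f x = 0" for x
  proof (rule adj_span)
    fix k
    have n: "cubic_norm (f x) = cubic_norm x" for x using norm [of x 0] by simp
    have "2 * tform (adj k) x = 0"
      unfolding tform_adj_eq using n [of "k + x"] n [of "k - x"] n [of x] that n [of k] by (simp add: f fm)
    then show "tform (adj k) x = 0" by simp
  qed
  then have "x = y" if "f x = f y" for x y using that fm [of x y] by (metis eq_iff_diff_eq_0)
  then have "inj f" by (rule injI)
  moreover have "\<exists>x. k = f x" for k
    using surj [of k] g_0 by (metis add.right_neutral)
  then have "surj f" unfolding surj_def by blast
  ultimately show "bij f" by (simp add: bij_def)
qed

lemma stabilizer_base_vec: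
  assumes \<Phi>: "\<Phi> \<in> (carrier E7 :: ('k freud \<Rightarrow> _) set)" and stab: "\<Phi> base_vec = base_vec"
  shows "\<Phi> \<in> E6_embed ` InvJ"
proof -
  note d = E7D [OF \<Phi>]
  have "\<exists>p p'. \<Phi> (\<alpha>, j, j', \<beta>) = (\<alpha>, p, p', \<beta>)" for \<alpha> j j' \<beta>
  proof -
    obtain \<gamma> p p' \<delta> where e: "\<Phi> (\<alpha>, j, j', \<beta>) = (\<gamma>, p, p', \<delta>)" by (cases "\<Phi> (\<alpha>, j, j', \<beta>)") auto
    \<comment> \<open>Pairing with \<open>base_vec\<close> gives the difference of the two scalar
      coordinates; the linear term of the quartic form at \<open>base_vec\<close> will give their
      sum.\<close>
    have "\<delta> - \<gamma> = \<beta> - \<alpha>"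
      using d(5) [of base_vec "(\<alpha>, j, j', \<beta>)"] by (simp add: stab e) (simp add: base_vec_def)
    moreover have q: "quartic_form (base_vec + scale_freud t (\<gamma>, p, p', \<delta>))
        = quartic_form (base_vec + scale_freud t (\<alpha>, j, j', \<beta>))" for t
    proof -
      have "\<Phi> (base_vec + scale_freud t (\<alpha>, j, j', \<beta>)) = base_vec + scale_freud t (\<gamma>, p, p', \<delta>)"
        unfolding d(1,2) stab e ..
      then show ?thesis by (metis d(4))
    qed
    \<comment> \<open>Along the line through \<open>base_vec\<close> the quartic form is a
      polynomial of degree 4 in \<open>t\<close>. Odd differences at 1 and 2 remove the even terms,
      the weights 8 and 1 remove the cubic one, and 12 times the linear coefficient
      \<open>2 * (\<alpha> + \<beta>)\<close> is left.\<close>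
    have lin: "8 * (quartic_form (base_vec + scale_freud 1 (\<alpha>, j, j', \<beta>))
          - quartic_form (base_vec + scale_freud (- 1) (\<alpha>, j, j', \<beta>)))
        - (quartic_form (base_vec + scale_freud 2 (\<alpha>, j, j', \<beta>))
          - quartic_form (base_vec + scale_freud (- 2) (\<alpha>, j, j', \<beta>)))
        = 2 * 2 * 6 * (\<alpha> + \<beta>)" for \<alpha> \<beta> :: 'k and j j'
    proof -
      have "quartic_form (base_vec + scale_freud t (\<alpha>, j, j', \<beta>)) =
          ((1 + t * \<alpha>) * (1 + t * \<beta>) - t * (t * tform j j'))\<^sup>2 + 4 * (1 + t * \<alpha>) * (t * t * t * cubic_norm j)
          + 4 * (1 + t * \<beta>) * (t * t * t * cubic_norm j') - 4 * (t * t * t * t) * tform (adj j) (adj j')" for t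
        by (simp add: base_vec_def power3_eq_cube mult.assoc)
      note * = this
      show ?thesis unfolding * mult_1_left by algebra
    qed
    have "2 * 2 * 6 * (\<gamma> + \<delta>) = 2 * 2 * 6 * (\<alpha> + \<beta>)"
      using lin [of \<gamma> p p' \<delta>] unfolding q lin by (rule sym)
    then have "\<gamma> + \<delta> = \<alpha> + \<beta>" by (simp only: mult_cancel_left mult_eq_0_iff two_neq_0 six_neq_0) simp
    ultimately have "2 * \<gamma> = 2 * \<alpha>" "2 * \<delta> = 2 * \<beta>" by algebra+
    then have "\<gamma> = \<alpha>" "\<delta> = \<beta>" by (simp_all only: mult_cancel_left two_neq_0) simp_all
    with e show ?thesis by blast
  qed
  then obtain p p' where P: "\<Phi> (\<alpha>, j, j', \<beta>) = (\<alpha>, p \<alpha> j j' \<beta>, p' \<alpha> j j' \<beta>, \<beta>)" for \<alpha> j j' \<beta>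
    by metis
  have surj: "\<exists>j j'. \<Phi> (0, j, j', 0) = (0, k, k', 0)" for k k'
  proof -
    obtain v where v: "\<Phi> v = (0, k, k', 0)" using bij_is_surj [OF d(3)] by (metis surjD)
    then show ?thesis by (cases v rule: freud_exhaust) (auto simp: P)
  qed
  have e1: "\<Phi> (1, 0, 0, 0) = (1, 0, 0, 0)"
  proof -
    \<comment> \<open>\<Phi> maps the middle part \<open>(0, J, J, 0)\<close> onto itself, and
      \<open>(1, 0, 0, 0)\<close> is orthogonal to that part; so the middle components of its image
      pair to zero with everything.\<close>
    have *: "tform (p 1 0 0 0) k' - tform (p' 1 0 0 0) k = 0" for k k'
    proof -
      obtain j j' where "\<Phi> (0, j, j', 0) = (0, k, k', 0)" using surj by metis
      then show ?thesis using d(5) [of "(1, 0, 0, 0)" "(0, j, j', 0)"] by (simp add: P [of 1])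
    qed
    have "p 1 0 0 0 = 0"
      using * [of _ 0] by (intro tform_nondegenerate) (simp add: tform_commute)
    moreover have "p' 1 0 0 0 = 0"
      using * [of 0] by (intro tform_nondegenerate) (simp add: tform_commute)
    ultimately show ?thesis by (simp add: P)
  qed
  have e4: "\<Phi> (0, 0, 0, 1) = (0, 0, 0, 1)"
    using d(1) [of "(1, 0, 0, 0)" "(0, 0, 0, 1)"] stab e1 by (simp add: base_vec_def P)
  \<comment> \<open>With \<alpha> = 1 and \<beta> = 0 the quartic form exceeds its value at
    \<open>(0, j, j', 0)\<close> by exactly \<open>4 * cubic_norm j\<close>; the vector
    \<open>(0, 0, 0, 1)\<close> isolates the norm of \<open>j'\<close> in the same way.\<close>
  have norm: "cubic_norm (p 0 j j' 0) = cubic_norm j" "cubic_norm (p' 0 j j' 0) = cubic_norm j'" for j j'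
  proof -
    have "4 * cubic_norm (p 0 j j' 0) = 4 * cubic_norm j"
      using d(4) [of "(1, 0, 0, 0) + (0, j, j', 0)", unfolded d(1) e1 P [of 0], simplified]
        d(4) [of "(0, j, j', 0)", unfolded P, simplified] by algebra
    moreover have "4 * cubic_norm (p' 0 j j' 0) = 4 * cubic_norm j'"
      using d(4) [of "(0, 0, 0, 1) + (0, j, j', 0)", unfolded d(1) e4 P [of 0 _ _ 0], simplified]
        d(4) [of "(0, j, j', 0)", unfolded P, simplified] by algebra
    ultimately show "cubic_norm (p 0 j j' 0) = cubic_norm j" "cubic_norm (p' 0 j j' 0) = cubic_norm j'"
      by (simp_all only: mult_cancel_left four_neq_0) simp_all
  qed
  have add: "p 0 (j + k) (j' + k') 0 = p 0 j j' 0 + p 0 k k' 0"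
     "p' 0 (j + k) (j' + k') 0 = p' 0 j j' 0 + p' 0 k k' 0" for j k j' k'
    using d(1) [of "(0, j, j', 0)" "(0, k, k', 0)"] by (simp_all add: P)
  have scale: "p 0 (scale_albert c j) (scale_albert c j') 0 = scale_albert c (p 0 j j' 0)"
     "p' 0 (scale_albert c j) (scale_albert c j') 0 = scale_albert c (p' 0 j j' 0)" for c j j'
    using d(2) [of c "(0, j, j', 0)"] by (simp_all add: P)
  have split: "p 0 j j' 0 = p 0 j 0 0 + p 0 0 j' 0" "p' 0 j j' 0 = p' 0 j 0 0 + p' 0 0 j' 0" for j j'
    using add [of j 0 0 j'] by simp_all
  define \<phi> where "\<phi> j = p 0 j 0 0" for j
  define \<psi> where "\<psi> j = p' 0 0 j 0" for j
  have surj': "\<exists>j j'. p 0 j j' 0 = k" "\<exists>j j'. p' 0 j j' 0 = k" for k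
    using surj [of k 0] surj [of 0 k] unfolding P prod.inject by blast+
  \<comment> \<open>The norm of \<open>p 0 j j' 0\<close> does not depend on \<open>j'\<close>, so
    \<open>norm_projection\<close> shows that the second copy of J contributes nothing to the
    first.\<close>
  have 1: "bij \<phi>" "p 0 0 y 0 = 0" for y
  proof -
    have a: "\<phi> (x + y) = \<phi> x + \<phi> y" "p 0 0 (x + y) 0 = p 0 0 x 0 + p 0 0 y 0"
      "cubic_norm (\<phi> x + p 0 0 y 0) = cubic_norm x" "\<exists>x y. \<phi> x + p 0 0 y 0 = z" for x y z
      unfolding \<phi>_def split(1) [symmetric] using add(1) [of x y 0 0] add(1) [of 0 0 x y] norm(1) [of x y] surj' [of z]
      by simp_all
    show "bij \<phi>" by (rule norm_projection(1) [of \<phi> "\<lambda>y. p 0 0 y 0", OF a])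
    show "p 0 0 y 0 = 0" by (rule norm_projection(2) [of \<phi> "\<lambda>y. p 0 0 y 0", OF a])
  qed
  have 2: "p' 0 y 0 0 = 0" for y
  proof -
    have sum: "\<psi> x + p' 0 y 0 0 = p' 0 y x 0" for x y
      unfolding \<psi>_def split(2) [of y x] by (rule add.commute)
    have a: "\<psi> (x + y) = \<psi> x + \<psi> y" "p' 0 (x + y) 0 0 = p' 0 x 0 0 + p' 0 y 0 0"
      "cubic_norm (\<psi> x + p' 0 y 0 0) = cubic_norm x" "\<exists>x y. \<psi> x + p' 0 y 0 0 = z" for x y z
    proof -
      show "\<psi> (x + y) = \<psi> x + \<psi> y" using add(2) [of 0 0 x y] by (simp add: \<psi>_def)
      show "p' 0 (x + y) 0 0 = p' 0 x 0 0 + p' 0 y 0 0" using add(2) [of x y 0 0] by simp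
      show "cubic_norm (\<psi> x + p' 0 y 0 0) = cubic_norm x" unfolding sum by (rule norm)
      show "\<exists>x y. \<psi> x + p' 0 y 0 0 = z" unfolding sum using surj'(2) by blast
    qed
    show ?thesis by (rule norm_projection(2) [of \<psi> "\<lambda>y. p' 0 y 0 0", OF a])
  qed
  have "\<phi> \<in> InvJ"
    unfolding InvJ_iff using add [of _ _ 0 0] scale [of _ _ 0] norm 1 by (simp add: \<phi>_def)
  have "dagger \<phi> = \<psi>"
  proof (rule dagger_eqI)
    show "surj \<phi>" using 1 by (simp add: bij_is_surj)
    show "tform (\<phi> x) (\<psi> y) = tform x y" for x y
      using d(5) [of "(0, x, 0, 0)" "(0, 0, y, 0)"] by (simp add: P 1 2 \<phi>_def \<psi>_def)
  qed
  have "\<Phi> v = E6_embed \<phi> v" for v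
  proof (cases v rule: freud_exhaust)
    case (1 \<alpha> j j' \<beta>)
    have "v = scale_freud \<alpha> (1, 0, 0, 0) + (0, j, j', 0) + scale_freud \<beta> (0, 0, 0, 1)"
      by (simp add: 1)
    then have "\<Phi> v = scale_freud \<alpha> (1, 0, 0, 0) + (0, p 0 j j' 0, p' 0 j j' 0, 0)
        + scale_freud \<beta> (0, 0, 0, 1)"
      by (simp only: d(1,2) e1 e4 P [of 0 j j' 0])
    then show ?thesis
      using \<open>\<And>y. p 0 0 y 0 = 0\<close> 2 split [of j j'] by (simp add: E6_embed_def 1 \<open>dagger \<phi> = \<psi>\<close> \<phi>_def \<psi>_def)
  qed
  then show ?thesis using \<open>\<phi> \<in> InvJ\<close> by blast
qed

end

section \<open>Translations in \<open>E7\<close>\<close>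

text \<open>The exponential of a nilpotent operator of degree three; it takes
  \<open>(1, 0, 0, 0)\<close> to \<open>(1, adj c, c, cubic_norm c)\<close>.\<close>

definition up :: "'k::field albert \<Rightarrow> 'k freud \<Rightarrow> 'k freud" where
  "up c = (\<lambda>(\<alpha>, j, j', \<beta>). (\<alpha>, j + cross c j' + scale_albert \<alpha> (adj c), j' + scale_albert \<alpha> c,
     \<beta> + tform c j + tform (adj c) j' + \<alpha> * cubic_norm c))"

text \<open>This is \<open>omega\<close> without the factor i. It is therefore defined over F, but
  it negates the alternating form, so it is used only for conjugation.\<close>

definition flip :: "'k freud \<Rightarrow> 'k freud" where
  "flip = (\<lambda>(\<alpha>, j, j', \<beta>). (\<beta>, j', j, \<alpha>))"

definition down :: "'k::field albert \<Rightarrow> 'k freud \<Rightarrow> 'k freud" where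
  "down c = flip \<circ> up c \<circ> flip"

lemma up_apply [simp]:
  "up c (\<alpha>, j, j', \<beta>) = (\<alpha>, j + cross c j' + scale_albert \<alpha> (adj c), j' + scale_albert \<alpha> c,
     \<beta> + tform c j + tform (adj c) j' + \<alpha> * cubic_norm c)"
  by (simp add: up_def)

lemma flip_apply [simp]: "flip (\<alpha>, j, j', \<beta>) = (\<beta>, j', j, \<alpha>)"
  by (simp add: flip_def)

lemma down_apply [simp]:
  "down c (\<alpha>, j, j', \<beta>) = (\<alpha> + tform c j' + tform (adj c) j + \<beta> * cubic_norm c,
     j + scale_albert \<beta> c, j' + cross c j + scale_albert \<beta> (adj c), \<beta>)"
  by (simp add: down_def)

lemma up_linear:
  "up c (v + w) = up c v + up c w"
  "up c (scale_freud a v) = scale_freud a (up c v)"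
  by (cases v rule: freud_exhaust; cases w rule: freud_exhaust;
      simp add: scale_albert_add_left algebra_simps)+

lemma flip_linear:
  "flip (v + w) = flip v + flip w" "flip (scale_freud a v) = scale_freud a (flip v)"
  by (cases v rule: freud_exhaust; cases w rule: freud_exhaust; simp)+

lemma flip_flip [simp]: "flip (flip v) = v"
  by (cases v rule: freud_exhaust) simp

lemma up_0 [simp]: "up 0 v = v"
  by (cases v rule: freud_exhaust) simp

lemma up_up: "up c (up d v) = up (c + d) (v :: 'k::field freud)"
proof (cases v rule: freud_exhaust)
  case (1 \<alpha> j j' \<beta>)
  have "tform c (cross d j') = tform (cross c d) j'" by (simp add: tform_cross)
  then show ?thesis
    by (simp add: 1 adj_add cubic_norm_add tform_commute [of c "adj d"] scale_albert_add_left
        algebra_simps)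
qed

lemma up_bij: "bij (up c :: 'k::field freud \<Rightarrow> _)"
  by (rule o_bij [of "up (- c)"]) (simp_all add: fun_eq_iff up_up del: split_paired_All)

text \<open>The elements with \<open>adj c = 0\<close> span \<open>J\<close>; as \<open>up\<close> is additive, invariance of the forms need only
  be computed for them, where the terms of degree two and three in \<open>c\<close> vanish.\<close>

lemma rank_one_induct:
  fixes c :: "'k::field albert"
  assumes rank_one: "\<And>c. adj c = 0 \<Longrightarrow> P c" and add: "\<And>c d. P c \<Longrightarrow> P d \<Longrightarrow> P (c + d)"
  shows "P c"
proof -
  \<comment> \<open>An octonion supported on one row of its Zorn matrix has norm 0, so splitting
    each octonion into its two rows gives pieces with zero adjoint.\<close>
  have P: "P (x, 0, 0, 0, 0, 0)" "P (0, x, 0, 0, 0, 0)" "P (0, 0, x, 0, 0, 0)"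
    "P (0, 0, 0, (a, (u1, u2, u3), 0, 0), 0, 0)" "P (0, 0, 0, (0, 0, (u1, u2, u3), a), 0, 0)"
    "P (0, 0, 0, 0, (a, (u1, u2, u3), 0, 0), 0)" "P (0, 0, 0, 0, (0, 0, (u1, u2, u3), a), 0)"
    "P (0, 0, 0, 0, 0, (a, (u1, u2, u3), 0, 0))" "P (0, 0, 0, 0, 0, (0, 0, (u1, u2, u3), a))"
    for x a u1 u2 u3
    by (rule rank_one, simp add: zero_prod_def)+
  obtain x1 x2 x3 a1 p1 p2 p3 q1 q2 q3 b1 a2 r1 r2 r3 s1 s2 s3 b2 a3 t1 t2 t3 w1 w2 w3 b3
    where c: "c = (x1, x2, x3, (a1, (p1, p2, p3), (q1, q2, q3), b1),
     (a2, (r1, r2, r3), (s1, s2, s3), b2), (a3, (t1, t2, t3), (w1, w2, w3), b3))"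
    by (rule albert_exhaust)
  have "c = (x1, 0, 0, 0, 0, 0) + ((0, x2, 0, 0, 0, 0) + ((0, 0, x3, 0, 0, 0)
    + ((0, 0, 0, (a1, (p1, p2, p3), 0, 0), 0, 0) + ((0, 0, 0, (0, 0, (q1, q2, q3), b1), 0, 0)
    + ((0, 0, 0, 0, (a2, (r1, r2, r3), 0, 0), 0) + ((0, 0, 0, 0, (0, 0, (s1, s2, s3), b2), 0)
    + ((0, 0, 0, 0, 0, (a3, (t1, t2, t3), 0, 0)) + (0, 0, 0, 0, 0, (0, 0, (w1, w2, w3), b3)))))))))"
    by (simp add: c)
  then show ?thesis by (simp only:) (intro add P)
qed

context char_not_2_3
begin

text \<open>With \<open>adj c = 0\<close> the identity \<open>adj_cross\<close> loses all but one
  term; the two norms then follow from \<open>tform_adj_self\<close> after division by 3.\<close>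

lemma rank_one_cross:
  assumes c: "adj c = (0 :: 'k albert)"
  shows "cubic_norm c = 0" and "adj (cross c x) = scale_albert (tform c (adj x)) c"
    and "cubic_norm (cross c x) = 0" and "tform c (cross c x) = 0"
    and "tform (cross c x) x = 2 * tform c (adj x)"
proof -
  have "3 * cubic_norm c = 0" using tform_adj_self [of c] by (simp add: c)
  then show n: "cubic_norm c = 0" by simp
  show a: "adj (cross c x) = scale_albert (tform c (adj x)) c"
    using adj_cross [of c x] by (simp add: c)
  show t: "tform c (cross c x) = 0"
    by (simp add: tform_cross [symmetric] cross_self c)
  have "3 * cubic_norm (cross c x) = 0" using tform_adj_self [of "cross c x"] by (simp add: a t)
  then show "cubic_norm (cross c x) = 0" by simp
  show "tform (cross c x) x = 2 * tform c (adj x)"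
    by (simp add: tform_cross cross_self)
qed

text \<open>After naming \<open>u = cross c j'\<close> and \<open>s = tform c (adj j')\<close>,
  every term of the transformed form is a polynomial in a few scalars such as
  \<open>tform c j\<close>, \<open>tform (adj j) u\<close> and \<open>s\<close>. What remains is a
  commutative ring identity.\<close>

lemma up_rank_one_quartic:
  assumes c: "adj c = (0 :: 'k albert)"
  shows "quartic_form (up c v) = quartic_form v"
proof (cases v rule: freud_exhaust)
  case (1 \<alpha> j j' \<beta>)
  define u where "u = cross c j'"
  define s where "s = tform c (adj j')"
  note r = rank_one_cross(1) [OF c] rank_one_cross(2-5) [OF c, of j', folded u_def s_def]
  have 5: "cross u (adj j') = scale_albert (cubic_norm j') c + scale_albert s j'"
    using cross_adj_cross [of j' c]
    by (simp add: u_def s_def cross_commute [of _ "adj j'"] cross_commute [of j' c] tform_commute)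
  have 6: "adj (j' + scale_albert \<alpha> c) = adj j' + scale_albert \<alpha> u"
    by (simp add: adj_add c u_def cross_commute)
  have 7: "adj (j + u) = adj j + cross j u + scale_albert s c"
    by (simp add: adj_add r)
  have 8: "cubic_norm (j + u) = cubic_norm j + tform (adj j) u + s * tform c j"
    by (simp add: cubic_norm_add r tform_commute)
  have 9: "cubic_norm (j' + scale_albert \<alpha> c) = cubic_norm j' + \<alpha> * s"
    by (simp add: cubic_norm_add r c s_def tform_commute)
  have 10: "tform (cross j u) (adj j') = cubic_norm j' * tform c j + s * tform j j'"
    unfolding tform_cross 5 by (simp add: tform_commute)
  have 11: "tform (cross j u) u = 2 * (s * tform c j)"
    unfolding tform_cross cross_self by (simp add: r tform_commute)
  have 12: "tform (adj (j + u)) (adj (j' + scale_albert \<alpha> c)) = tform (adj j) (adj j')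
     + \<alpha> * tform (adj j) u + (cubic_norm j' * tform c j + s * tform j j')
     + \<alpha> * (2 * (s * tform c j)) + s * s"
    unfolding 6 7 by (simp add: 10 11 r s_def [symmetric] distrib_left)
  have 13: "tform (j + u) (j' + scale_albert \<alpha> c) = tform j j' + \<alpha> * tform c j + 2 * s"
    by (simp add: r tform_commute [of u c] tform_commute [of j c])
  have "up c v = (\<alpha>, j + u, j' + scale_albert \<alpha> c, \<beta> + tform c j)"
    by (simp add: 1 c u_def r)
  then have "quartic_form (up c v) = (\<alpha> * (\<beta> + tform c j) - (tform j j' + \<alpha> * tform c j + 2 * s))\<^sup>2
     + 4 * \<alpha> * (cubic_norm j + tform (adj j) u + s * tform c j)
     + 4 * (\<beta> + tform c j) * (cubic_norm j' + \<alpha> * s)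
     - 4 * (tform (adj j) (adj j')
     + \<alpha> * tform (adj j) u + (cubic_norm j' * tform c j + s * tform j j')
     + \<alpha> * (2 * (s * tform c j)) + s * s)"
    by (simp only: quartic_form_eq 8 9 12 13)
  also have "\<dots> = quartic_form v"
    unfolding 1 quartic_form_eq by algebra
  finally show ?thesis .
qed

lemma up_rank_one_alt:
  assumes c: "adj c = (0 :: 'k albert)"
  shows "alt_form (up c v) (up c w) = alt_form v w"
proof (cases v rule: freud_exhaust; cases w rule: freud_exhaust)
  fix \<alpha> j j' \<beta> \<gamma> k k' \<delta>
  assume v: "v = (\<alpha>, j, j', \<beta>)" and w: "w = (\<gamma>, k, k', \<delta>)"
  have "tform (cross c j') k' = tform j' (cross c k')"
    using tform_cross [of j' c k'] by (simp add: cross_commute)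
  then show ?thesis
    by (simp add: v w rank_one_cross [OF c] c tform_commute [of _ c] algebra_simps)
qed

lemma up_in_E7: "up c \<in> carrier (E7 :: ('k freud \<Rightarrow> _, 'k) gal_group)"
proof -
  have "(\<forall>v. quartic_form (up c v) = quartic_form v) \<and>
      (\<forall>v w. alt_form (up c v) (up c w) = alt_form v w)"
    by (induction c rule: rank_one_induct)
      (simp_all add: up_rank_one_quartic up_rank_one_alt up_up [symmetric])
  then show ?thesis unfolding E7_iff using up_linear up_bij by blast
qed

lemma down_in_E7: "down c \<in> carrier (E7 :: ('k freud \<Rightarrow> _, 'k) gal_group)"
proof -
  note d = E7D [OF up_in_E7]
  have "bij (flip :: 'k freud \<Rightarrow> _)"
    by (rule o_bij [of flip]) (simp_all add: fun_eq_iff)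
  then have "bij (down c :: 'k freud \<Rightarrow> _)"
    unfolding down_def by (intro bij_comp d)
  moreover have q: "quartic_form (flip v) = quartic_form v" for v :: "'k freud"
    by (cases v rule: freud_exhaust; simp add: tform_commute algebra_simps)
  \<comment> \<open>The sign cancels because \<open>flip\<close> occurs twice in
    \<open>down\<close>.\<close>
  moreover have a: "alt_form (flip v) (flip w) = - alt_form v w" for v w :: "'k freud"
    by (cases v rule: freud_exhaust; cases w rule: freud_exhaust; simp add: algebra_simps)
  ultimately show ?thesis
    unfolding E7_iff down_def comp_def by (simp add: flip_linear d)
qed

end

section \<open>Conjugacy of Galois-fixed vectors\<close>

lemma is_ring_homD:
  assumes "is_ring_hom \<sigma>"
  shows "\<sigma> (x + y) = \<sigma> x + \<sigma> y" "\<sigma> (x * y) = \<sigma> x * \<sigma> y" "\<sigma> 1 = 1" "\<sigma> 0 = 0"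
    "\<sigma> (- x) = - \<sigma> x" "\<sigma> (x - y) = \<sigma> x - \<sigma> y"
proof -
  show a: "\<sigma> (x + y) = \<sigma> x + \<sigma> y" for x y using assms by (simp add: is_ring_hom_def)
  show "\<sigma> (x * y) = \<sigma> x * \<sigma> y" "\<sigma> 1 = 1" using assms by (simp_all add: is_ring_hom_def)
  show z: "\<sigma> 0 = 0" using a [of 0 0] by simp
  show m: "\<sigma> (- x) = - \<sigma> x" for x using a [of x "- x"] by (simp add: z eq_neg_iff_add_eq_0 add.commute)
  show "\<sigma> (x - y) = \<sigma> x - \<sigma> y" using a [of x "- y"] by (simp add: m)
qed

lemma is_ring_hom_inverse:
  assumes "is_ring_hom (\<sigma> :: 'k::field \<Rightarrow> 'l::field)" shows "\<sigma> (inverse x) = inverse (\<sigma> x)"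
proof (cases "x = 0")
  case True then show ?thesis by (simp add: is_ring_homD [OF assms])
next
  case False
  then have "\<sigma> x * \<sigma> (inverse x) = 1"
    by (metis is_ring_homD(2,3) [OF assms] right_inverse)
  then show ?thesis by (metis inverse_unique)
qed

lemma map_albert_id [simp]: "map_albert id x = x"
  by (cases x rule: albert_exhaust; simp)

lemma map_albert_comp: "map_albert f (map_albert g x) = map_albert (f \<circ> g) x"
  by (cases x rule: albert_exhaust; simp)

lemma map_freud_comp: "map_freud f (map_freud g v) = map_freud (f \<circ> g) v"
  by (cases v rule: freud_exhaust; simp add: map_albert_comp)

lemma map_freud_id [simp]: "map_freud id v = v"
  by (cases v rule: freud_exhaust; simp)

lemma map_albert_hom:
  assumes "is_ring_hom (\<sigma> :: 'k::field \<Rightarrow> 'k)"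
  shows "map_albert \<sigma> (x + y) = map_albert \<sigma> x + map_albert \<sigma> y"
    "map_albert \<sigma> (x - y) = map_albert \<sigma> x - map_albert \<sigma> y"
    "map_albert \<sigma> (- x) = - map_albert \<sigma> x"
    "map_albert \<sigma> 0 = 0"
    "map_albert \<sigma> (scale_albert c x) = scale_albert (\<sigma> c) (map_albert \<sigma> x)"
    "map_albert \<sigma> (adj x) = adj (map_albert \<sigma> x)"
    "\<sigma> (cubic_norm x) = cubic_norm (map_albert \<sigma> x)"
    "\<sigma> (tform x y) = tform (map_albert \<sigma> x) (map_albert \<sigma> y)"
  by (cases x rule: albert_exhaust; cases y rule: albert_exhaust;
      simp add: zero_prod_def is_ring_homD [OF assms])+

lemma map_albert_cross:
  assumes "is_ring_hom (\<sigma> :: 'k::field \<Rightarrow> 'k)"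
  shows "map_albert \<sigma> (cross x y) = cross (map_albert \<sigma> x) (map_albert \<sigma> y)"
  by (simp add: cross_def map_albert_hom [OF assms])

lemma map_freud_hom:
  assumes "is_ring_hom (\<sigma> :: 'k::field \<Rightarrow> 'k)"
  shows "map_freud \<sigma> (v + w) = map_freud \<sigma> v + map_freud \<sigma> w"
    "map_freud \<sigma> (scale_freud c v) = scale_freud (\<sigma> c) (map_freud \<sigma> v)"
    "map_freud \<sigma> (flip v) = flip (map_freud \<sigma> v)"
    "map_freud \<sigma> (up e v) = up (map_albert \<sigma> e) (map_freud \<sigma> v)"
proof -
  note h = is_ring_homD [OF assms] map_albert_hom [OF assms] map_albert_cross [OF assms]
  show "map_freud \<sigma> (v + w) = map_freud \<sigma> v + map_freud \<sigma> w"
    by (cases v rule: freud_exhaust; cases w rule: freud_exhaust; simp add: h)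
  show "map_freud \<sigma> (scale_freud c v) = scale_freud (\<sigma> c) (map_freud \<sigma> v)"
    by (cases v rule: freud_exhaust; simp add: h)
  show "map_freud \<sigma> (flip v) = flip (map_freud \<sigma> v)"
    by (cases v rule: freud_exhaust; simp add: h)
  show "map_freud \<sigma> (up e v) = up (map_albert \<sigma> e) (map_freud \<sigma> v)"
    by (cases v rule: freud_exhaust; simp add: h)
qed

lemma map_freud_down:
  assumes "is_ring_hom (\<sigma> :: 'k::field \<Rightarrow> 'k)"
  shows "map_freud \<sigma> (down e v) = down (map_albert \<sigma> e) (map_freud \<sigma> v)"
  by (simp add: down_def map_freud_hom [OF assms])

context char_not_2_3
begin

lemma map_freud_forms:
  assumes "is_ring_hom (\<sigma> :: 'k::field \<Rightarrow> 'k)"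
  shows "quartic_form (map_freud \<sigma> v) = \<sigma> (quartic_form v)"
    "alt_form (map_freud \<sigma> v) (map_freud \<sigma> w) = \<sigma> (alt_form v w)"
proof -
  note h = is_ring_homD [OF assms]
  have "\<sigma> 2 = 2" using h(1) [of 1 1] h(3) by simp
  then have four: "\<sigma> 4 = 4" using h(1) [of 2 2] by simp
  show "quartic_form (map_freud \<sigma> v) = \<sigma> (quartic_form v)"
    by (cases v rule: freud_exhaust;
        simp add: h four power2_eq_square map_albert_hom [OF assms])
  show "alt_form (map_freud \<sigma> v) (map_freud \<sigma> w) = \<sigma> (alt_form v w)"
    by (cases v rule: freud_exhaust; cases w rule: freud_exhaust; simp add: h map_albert_hom [OF assms])
qed

end

section \<open>Rational points, with \<Gamma> in the role of the Galois group and fixed elements in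
  the role of F-points\<close>

locale galois_fixed = char_not_2_3 ty for ty :: "'k::field itself" +
  fixes \<Gamma> :: "('k \<Rightarrow> 'k) set"
  assumes hom: "\<sigma> \<in> \<Gamma> \<Longrightarrow> is_ring_hom \<sigma>" and bij: "\<sigma> \<in> \<Gamma> \<Longrightarrow> bij \<sigma>"
begin

definition fixed :: "'k \<Rightarrow> bool" where "fixed x \<longleftrightarrow> (\<forall>\<sigma>\<in>\<Gamma>. \<sigma> x = x)"
definition fixed_albert :: "'k albert \<Rightarrow> bool" where
  "fixed_albert x \<longleftrightarrow> (\<forall>\<sigma>\<in>\<Gamma>. map_albert \<sigma> x = x)"
definition fixed_freud :: "'k freud \<Rightarrow> bool" where
  "fixed_freud v \<longleftrightarrow> (\<forall>\<sigma>\<in>\<Gamma>. map_freud \<sigma> v = v)"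

text \<open>Conjugacy under the F-points of E7: commuting with \<Gamma> expresses that \<Phi> is
  defined over F.\<close>

definition E7_conj :: "'k freud \<Rightarrow> 'k freud \<Rightarrow> bool" where
  "E7_conj v w \<longleftrightarrow>
     (\<exists>\<Phi>\<in>carrier E7. (\<forall>\<sigma>\<in>\<Gamma>. \<forall>x. map_freud \<sigma> (\<Phi> x) = \<Phi> (map_freud \<sigma> x)) \<and> \<Phi> v = w)"

definition InvJ_conj :: "'k albert \<Rightarrow> 'k albert \<Rightarrow> bool" where
  "InvJ_conj x y \<longleftrightarrow>
     (\<exists>\<phi>\<in>InvJ. (\<forall>\<sigma>\<in>\<Gamma>. \<forall>z. map_albert \<sigma> (\<phi> z) = \<phi> (map_albert \<sigma> z)) \<and> \<phi> x = y)"

lemma fixed_simps [simp]: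
  "fixed 0" "fixed 1" "fixed x \<Longrightarrow> fixed y \<Longrightarrow> fixed (x + y)" "fixed x \<Longrightarrow> fixed y \<Longrightarrow> fixed (x - y)"
  "fixed x \<Longrightarrow> fixed y \<Longrightarrow> fixed (x * y)" "fixed x \<Longrightarrow> fixed (- x)" "fixed x \<Longrightarrow> fixed (inverse x)"
  "fixed x \<Longrightarrow> fixed y \<Longrightarrow> fixed (x / y)"
  by (simp_all add: fixed_def is_ring_homD [OF hom] is_ring_hom_inverse [OF hom] divide_inverse)
    metis+

lemma fixed_albert_simps [simp]:
  "fixed_albert 0" "fixed_albert x \<Longrightarrow> fixed_albert y \<Longrightarrow> fixed_albert (x + y)"
  "fixed_albert x \<Longrightarrow> fixed_albert y \<Longrightarrow> fixed_albert (x - y)"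
  "fixed_albert x \<Longrightarrow> fixed_albert (- x)"
  "fixed c \<Longrightarrow> fixed_albert x \<Longrightarrow> fixed_albert (scale_albert c x)"
  "fixed_albert x \<Longrightarrow> fixed_albert (adj x)"
  "fixed_albert x \<Longrightarrow> fixed_albert y \<Longrightarrow> fixed_albert (cross x y)"
  "fixed_albert x \<Longrightarrow> fixed (cubic_norm x)"
  "fixed_albert x \<Longrightarrow> fixed_albert y \<Longrightarrow> fixed (tform x y)"
  by (simp_all add: fixed_def fixed_albert_def map_albert_hom [OF hom] map_albert_cross [OF hom]) metis

lemma fixed_freud_iff [simp]:
  "fixed_freud (\<alpha>, j, j', \<beta>) \<longleftrightarrow> fixed \<alpha> \<and> fixed_albert j \<and> fixed_albert j' \<and> fixed \<beta>"
  unfolding fixed_def fixed_albert_def fixed_freud_def by (simp add: ball_conj_distrib)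

lemma E7_conjI:
  "\<Phi> \<in> carrier E7 \<Longrightarrow> (\<And>\<sigma> x. \<sigma> \<in> \<Gamma> \<Longrightarrow> map_freud \<sigma> (\<Phi> x) = \<Phi> (map_freud \<sigma> x)) \<Longrightarrow> E7_conj v (\<Phi> v)"
  unfolding E7_conj_def by blast

lemma E7_conjE:
  assumes "E7_conj v w"
  obtains \<Phi> where "\<Phi> \<in> carrier E7" "\<forall>\<sigma>\<in>\<Gamma>. \<forall>x. map_freud \<sigma> (\<Phi> x) = \<Phi> (map_freud \<sigma> x)" "w = \<Phi> v"
  using assms unfolding E7_conj_def by blast

lemma E7_conj_trans:
  assumes "E7_conj u v" "E7_conj v w" shows "E7_conj u w"
proof -
  obtain \<Phi> where \<Phi>: "\<Phi> \<in> carrier E7" "\<forall>\<sigma>\<in>\<Gamma>. \<forall>x. map_freud \<sigma> (\<Phi> x) = \<Phi> (map_freud \<sigma> x)" "v = \<Phi> u"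
    using assms(1) by (rule E7_conjE)
  obtain \<Psi> where \<Psi>: "\<Psi> \<in> carrier E7" "\<forall>\<sigma>\<in>\<Gamma>. \<forall>x. map_freud \<sigma> (\<Psi> x) = \<Psi> (map_freud \<sigma> x)" "w = \<Psi> v"
    using assms(2) by (rule E7_conjE)
  have "\<Psi> \<circ> \<Phi> \<in> carrier E7"
    using group.is_monoid [OF group_E7, THEN monoid.m_closed, OF \<Psi>(1) \<Phi>(1)] by simp
  then have "E7_conj u ((\<Psi> \<circ> \<Phi>) u)"
    by (rule E7_conjI) (simp add: \<Phi>(2) \<Psi>(2))
  then show ?thesis by (simp add: \<Phi>(3) \<Psi>(3))
qed

lemma E7_conj_sym:
  assumes "E7_conj v w" shows "E7_conj w v"
proof -
  obtain \<Phi> where \<Phi>: "\<Phi> \<in> carrier E7" "\<forall>\<sigma>\<in>\<Gamma>. \<forall>x. map_freud \<sigma> (\<Phi> x) = \<Phi> (map_freud \<sigma> x)" "w = \<Phi> v"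
    using assms by (rule E7_conjE)
  have b: "bij \<Phi>" using E7D(3) [OF \<Phi>(1)] .
  then have r: "\<Phi> (inv_into UNIV \<Phi> x) = x" and l: "inv_into UNIV \<Phi> (\<Phi> x) = x" for x
    by (simp_all add: bij_is_inj bij_is_surj surj_f_inv_f)
  have "map_freud \<sigma> (inv_into UNIV \<Phi> x) = inv_into UNIV \<Phi> (map_freud \<sigma> x)" if "\<sigma> \<in> \<Gamma>" for \<sigma> x
    using l [of "map_freud \<sigma> (inv_into UNIV \<Phi> x)"] unfolding \<Phi>(2) [rule_format, OF that, symmetric] r by (rule sym)
  then have "E7_conj w (inv_into UNIV \<Phi> w)"
    by (rule E7_conjI [OF E7_inv_into [OF \<Phi>(1)]])
  then show ?thesis by (simp add: \<Phi>(3) l)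
qed

lemma E7_conj_quartic: "E7_conj v w \<Longrightarrow> quartic_form w = quartic_form v"
  by (erule E7_conjE) (simp add: E7D(4))

lemma E7_conj_fixed: "E7_conj v w \<Longrightarrow> fixed_freud v \<Longrightarrow> fixed_freud w"
  by (erule E7_conjE) (simp add: fixed_freud_def)

lemma E7_conj_up: "fixed_albert c \<Longrightarrow> E7_conj v (up c v)"
  by (rule E7_conjI [OF up_in_E7]) (simp add: map_freud_hom [OF hom] fixed_albert_def)

lemma E7_conj_down: "fixed_albert c \<Longrightarrow> E7_conj v (down c v)"
  by (rule E7_conjI [OF down_in_E7]) (simp add: map_freud_down [OF hom] fixed_albert_def)

text \<open>The point is that \<open>dagger \<phi>\<close> inherits equivariance from \<phi>: it is
  determined by \<open>tform\<close>, which commutes with \<sigma>, and every test vector has the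
  form \<open>\<phi> (map_albert \<sigma> x0)\<close> as \<phi> and \<sigma> are bijective.\<close>

lemma InvJ_conj_imp_E7_conj:
  assumes "InvJ_conj x y" shows "E7_conj (\<alpha>, x, 0, \<beta>) (\<alpha>, y, 0, \<beta>)"
proof -
  obtain \<phi> where \<phi>: "\<phi> \<in> InvJ" "\<phi> x = y" and eq: "\<And>\<sigma> z. \<sigma> \<in> \<Gamma> \<Longrightarrow> map_albert \<sigma> (\<phi> z) = \<phi> (map_albert \<sigma> z)"
    using assms unfolding InvJ_conj_def by blast
  have "map_albert \<sigma> (dagger \<phi> y) = dagger \<phi> (map_albert \<sigma> y)" if \<sigma>: "\<sigma> \<in> \<Gamma>" for \<sigma> y
  proof (rule tform_eqI)
    fix z
    obtain x where x: "z = \<phi> x" using InvJD(4) [OF \<phi>(1)] by (metis bij_is_surj surjD)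
    define x0 where "x0 = map_albert (inv_into UNIV \<sigma>) x"
    have "\<sigma> \<circ> inv_into UNIV \<sigma> = id" using bij [OF \<sigma>] by (simp add: bij_is_surj fun_eq_iff surj_f_inv_f)
    then have z: "z = \<phi> (map_albert \<sigma> x0)" by (simp add: x x0_def map_albert_comp)
    have "tform z (map_albert \<sigma> (dagger \<phi> y)) = \<sigma> (tform (\<phi> x0) (dagger \<phi> y))"
      unfolding z eq [OF \<sigma>, symmetric] map_albert_hom(8) [OF hom [OF \<sigma>]] ..
    also have "\<dots> = tform z (dagger \<phi> (map_albert \<sigma> y))"
      unfolding z tform_dagger [OF \<phi>(1)] map_albert_hom(8) [OF hom [OF \<sigma>]] ..
    finally show "tform z (map_albert \<sigma> (dagger \<phi> y)) = tform z (dagger \<phi> (map_albert \<sigma> y))" .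
  qed
  moreover have "map_freud \<sigma> (E6_embed \<phi> v) = E6_embed \<phi> (map_freud \<sigma> v)" 
    if "\<And>y. map_albert \<sigma> (dagger \<phi> y) = dagger \<phi> (map_albert \<sigma> y)" "\<sigma> \<in> \<Gamma>" for \<sigma> v
    by (cases v rule: freud_exhaust) (simp add: E6_embed_def that eq)
  ultimately have "\<forall>\<sigma>\<in>\<Gamma>. \<forall>v. map_freud \<sigma> (E6_embed \<phi> v) = E6_embed \<phi> (map_freud \<sigma> v)"
    by blast
  moreover have "dagger \<phi> 0 = 0"
    using InvJD(1) [OF dagger_in_InvJ [OF \<phi>(1)], of 0 0] by simp
  then have "E6_embed \<phi> (\<alpha>, x, 0, \<beta>) = (\<alpha>, y, 0, \<beta>)" by (simp add: E6_embed_def \<phi>)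
  ultimately show ?thesis unfolding E7_conj_def using E6_embed_in_E7 [OF \<phi>(1)] by blast
qed

lemma rank_one_value:
  assumes "y \<noteq> 0" "fixed_albert y" "fixed s"
  shows "\<exists>c. adj c = 0 \<and> fixed_albert c \<and> tform c y = s"
proof -
  obtain e where e: "adj e = 0" "tform e y \<noteq> 0" "\<forall>\<sigma>. \<sigma> 0 = 0 \<and> \<sigma> 1 = 1 \<longrightarrow> map_albert \<sigma> e = e"
    using rank_one_dual_exists [OF assms(1)] by blast
  have fe: "fixed_albert e"
    unfolding fixed_albert_def using e(3) is_ring_homD(3,4) [OF hom] by blast
  then have "fixed_albert (scale_albert (s / tform e y) e)"
    using assms by simp
  moreover have "adj (scale_albert (s / tform e y) e) = 0" "tform (scale_albert (s / tform e y) e) y = s"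
    using e by simp_all
  ultimately show ?thesis by blast
qed

text \<open>The three diagonal units sum to \<open>one_albert\<close>, so they cannot all annihilate
  a nonzero \<open>y\<close>.\<close>

lemma rank_one_cross_nonzero:
  assumes "y \<noteq> 0"
  shows "\<exists>c. adj c = 0 \<and> fixed_albert c \<and> cross c y \<noteq> 0"
proof (rule ccontr)
  assume neg: "\<nexists>c. adj c = 0 \<and> fixed_albert c \<and> cross c y \<noteq> 0"
  have "cross e y = 0" if "e \<in> {(1, 0, 0, 0, 0, 0), (0, 1, 0, 0, 0, 0), (0, 0, 1, 0, 0, 0)}" for e
  proof -
    have "adj e = 0" using that by (force simp: zero_prod_def)
    moreover have "fixed_albert e" using that unfolding fixed_albert_def
      by (force simp: zero_prod_def is_ring_homD [OF hom])
    ultimately show ?thesis using neg by blast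
  qed
  then have "cross ((1, 0, 0, 0, 0, 0) + (0, 1, 0, 0, 0, 0) + (0, 0, 1, 0, 0, 0)) y = 0"
    unfolding cross_simps by simp
  then have "cross one_albert y = 0" by (simp add: one_albert_def)
  with assms show False using cross_one_eq_0 by blast
qed

end

section \<open>Diagonalizing Galois-fixed elements of the Albert algebra\<close>

text \<open>For a hermitian matrix \<open>X\<close>, this is \<open>E X E\<^sup>*\<close> with \<open>E = 1 + a E\<^sub>1\<^sub>2\<close>.\<close>

fun e12 :: "'k::field oct \<Rightarrow> 'k albert \<Rightarrow> 'k albert" where
  "e12 a (x1, x2, x3, c1, c2, c3) = (x1 + oct_inner a c3 + oct_norm a * x2, x2, x3,
     c1, c2 + oct_conj (oct_mult a c1), c3 + map_oct ((*) x2) a)"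

text \<open>Simultaneous exchange of two rows and the same two columns; the conjugations arise
  because the exchanged entries are read off at the fixed positions of the encoding.\<close>

fun swap12 :: "'k::field albert \<Rightarrow> 'k albert" where
  "swap12 (x1, x2, x3, c1, c2, c3) = (x2, x1, x3, oct_conj c2, oct_conj c1, oct_conj c3)"

fun swap23 :: "'k::field albert \<Rightarrow> 'k albert" where
  "swap23 (x1, x2, x3, c1, c2, c3) = (x1, x3, x2, oct_conj c1, oct_conj c3, oct_conj c2)"

fun swap13 :: "'k::field albert \<Rightarrow> 'k albert" where
  "swap13 (x1, x2, x3, c1, c2, c3) = (x3, x2, x1, oct_conj c3, oct_conj c2, oct_conj c1)"

lemma oct_conj_conj [simp]: "oct_conj (oct_conj c) = c"
  by (cases c rule: oct_exhaust) simp

lemma oct_conj_eq_0 [simp]: "oct_conj c = 0 \<longleftrightarrow> c = 0" and oct_conj_0 [simp]: "oct_conj 0 = (0 :: 'k::field oct)"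
  by (cases c rule: oct_exhaust; force simp: zero_prod_def)+

lemma oct_mult_0 [simp]: "oct_mult a 0 = (0 :: 'k::field oct)"
  by (cases a rule: oct_exhaust) (simp add: zero_prod_def)

lemma oct_trace_0 [simp]: "oct_trace 0 = (0 :: 'k::field)"
  by (simp add: zero_prod_def)

lemma oct_norm_0 [simp]: "oct_norm 0 = (0 :: 'k::field)"
  by (simp add: zero_prod_def)

lemma oct_norm_minus [simp]: "oct_norm (- a) = oct_norm a"
  by (cases a rule: oct_exhaust) simp

lemma oct_inner_0 [simp]: "oct_inner a 0 = (0 :: 'k::field)"
  by (cases a rule: oct_exhaust) (simp add: zero_prod_def)

lemma map_oct_0 [simp]: "map_oct ((*) x) 0 = (0 :: 'k::field oct)"
  by (simp add: zero_prod_def)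

lemma map_oct_1 [simp]: "map_oct ((*) 1) a = (a :: 'k::field oct)"
  by (cases a rule: oct_exhaust) simp

lemma map_oct_eq_0: "map_oct ((*) x) a = 0 \<longleftrightarrow> x = 0 \<or> a = (0 :: 'k::field oct)"
  by (cases a rule: oct_exhaust) (force simp: zero_prod_def)

lemma e12_in_InvJ: "e12 a \<in> InvJ"
proof -
  have l: "e12 a (x + y) = e12 a x + e12 a y" "e12 a (scale_albert c x) = scale_albert c (e12 a x)" for x y c
    by (cases a rule: oct_exhaust; cases x rule: albert_exhaust; cases y rule: albert_exhaust;
        simp add: algebra_simps)+
  have i: "e12 a (e12 (- a) x) = x" for a :: "'a oct" and x
    by (cases a rule: oct_exhaust; cases x rule: albert_exhaust; simp add: algebra_simps)
  have "e12 (- a) (e12 a x) = x" for x using i [of "- a"] by simp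
  with i have "bij (e12 a)" by (intro o_bij [of "e12 (- a)"]) (simp_all add: fun_eq_iff)
  moreover have "cubic_norm (e12 a x) = cubic_norm x" for x
    by (cases a rule: oct_exhaust; cases x rule: albert_exhaust; simp add: algebra_simps)
  ultimately show ?thesis unfolding InvJ_iff using l by blast
qed

lemma involution_in_InvJ:
  assumes "\<And>x y. f (x + y) = f x + f y" "\<And>c x. f (scale_albert c x) = scale_albert (c :: 'k::field) (f x)"
    "\<And>x. f (f x) = x" "\<And>x. cubic_norm (f x) = cubic_norm x"
  shows "f \<in> InvJ"
proof -
  have "bij f" using assms(3) by (intro o_bij [of f]) (simp_all add: fun_eq_iff)
  then show ?thesis unfolding InvJ_iff using assms by blast
qed

lemma swap12_in_InvJ: "swap12 \<in> (InvJ :: ('k::field albert \<Rightarrow> _) set)"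
proof (rule involution_in_InvJ)
  fix x y and c :: 'k
  show "swap12 (x + y) = swap12 x + swap12 y" "swap12 (scale_albert c x) = scale_albert c (swap12 x)"
    "swap12 (swap12 x) = x" "cubic_norm (swap12 x) = cubic_norm x"
    by (cases x rule: albert_exhaust; cases y rule: albert_exhaust; simp add: algebra_simps)+
qed

lemma swap23_in_InvJ: "swap23 \<in> (InvJ :: ('k::field albert \<Rightarrow> _) set)"
proof (rule involution_in_InvJ)
  fix x y and c :: 'k
  show "swap23 (x + y) = swap23 x + swap23 y" "swap23 (scale_albert c x) = scale_albert c (swap23 x)"
    "swap23 (swap23 x) = x" "cubic_norm (swap23 x) = cubic_norm x"
    by (cases x rule: albert_exhaust; cases y rule: albert_exhaust; simp add: algebra_simps)+
qed

lemma swap13_in_InvJ: "swap13 \<in> (InvJ :: ('k::field albert \<Rightarrow> _) set)"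
proof (rule involution_in_InvJ)
  fix x y and c :: 'k
  show "swap13 (x + y) = swap13 x + swap13 y" "swap13 (scale_albert c x) = scale_albert c (swap13 x)"
    "swap13 (swap13 x) = x" "cubic_norm (swap13 x) = cubic_norm x"
    by (cases x rule: albert_exhaust; cases y rule: albert_exhaust; simp add: algebra_simps)+
qed

lemma map_albert_e12:
  assumes "is_ring_hom (\<sigma> :: 'k::field \<Rightarrow> 'k)"
  shows "map_albert \<sigma> (e12 a x) = e12 (map_oct \<sigma> a) (map_albert \<sigma> x)"
  by (cases a rule: oct_exhaust; cases x rule: albert_exhaust; simp add: is_ring_homD [OF assms])

lemma map_albert_swap:
  assumes "is_ring_hom (\<sigma> :: 'k::field \<Rightarrow> 'k)"
  shows "map_albert \<sigma> (swap12 x) = swap12 (map_albert \<sigma> x)"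
    "map_albert \<sigma> (swap23 x) = swap23 (map_albert \<sigma> x)"
    "map_albert \<sigma> (swap13 x) = swap13 (map_albert \<sigma> x)"
  by (cases x rule: albert_exhaust; simp add: is_ring_homD [OF assms])+

context galois_fixed
begin

definition fixed_oct :: "'k oct \<Rightarrow> bool" where "fixed_oct a \<longleftrightarrow> (\<forall>\<sigma>\<in>\<Gamma>. map_oct \<sigma> a = a)"

lemma fixed_albert_iff:
  "fixed_albert (x1, x2, x3, c1, c2, c3) \<longleftrightarrow>
     fixed x1 \<and> fixed x2 \<and> fixed x3 \<and> fixed_oct c1 \<and> fixed_oct c2 \<and> fixed_oct c3"
  unfolding fixed_albert_def fixed_def fixed_oct_def by (simp add: ball_conj_distrib)

lemma InvJ_conjE:
  assumes "InvJ_conj x y"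
  obtains \<phi> where "\<phi> \<in> InvJ" "\<forall>\<sigma>\<in>\<Gamma>. \<forall>z. map_albert \<sigma> (\<phi> z) = \<phi> (map_albert \<sigma> z)" "y = \<phi> x"
  using assms unfolding InvJ_conj_def by blast

lemma InvJ_conjI:
  "\<phi> \<in> InvJ \<Longrightarrow> \<forall>\<sigma>\<in>\<Gamma>. \<forall>z. map_albert \<sigma> (\<phi> z) = \<phi> (map_albert \<sigma> z) \<Longrightarrow> InvJ_conj x (\<phi> x)"
  unfolding InvJ_conj_def by blast

lemma InvJ_conj_trans:
  assumes "InvJ_conj x y" "InvJ_conj y z" shows "InvJ_conj x z"
proof -
  obtain \<phi> where \<phi>: "\<phi> \<in> InvJ" "\<forall>\<sigma>\<in>\<Gamma>. \<forall>z. map_albert \<sigma> (\<phi> z) = \<phi> (map_albert \<sigma> z)" "y = \<phi> x"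
    using assms(1) by (rule InvJ_conjE)
  obtain \<psi> where \<psi>: "\<psi> \<in> InvJ" "\<forall>\<sigma>\<in>\<Gamma>. \<forall>z. map_albert \<sigma> (\<psi> z) = \<psi> (map_albert \<sigma> z)" "z = \<psi> y"
    using assms(2) by (rule InvJ_conjE)
  have "\<psi> \<circ> \<phi> \<in> InvJ"
    unfolding InvJ_iff using InvJD [OF \<phi>(1)] InvJD [OF \<psi>(1)] by (simp add: bij_comp)
  then have "InvJ_conj x ((\<psi> \<circ> \<phi>) x)"
    by (rule InvJ_conjI) (simp add: \<phi>(2) \<psi>(2))
  then show ?thesis by (simp add: \<phi>(3) \<psi>(3))
qed

lemma InvJ_conj_norm: "InvJ_conj x y \<Longrightarrow> cubic_norm y = cubic_norm x"
  by (erule InvJ_conjE) (simp add: InvJD)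

lemma InvJ_conj_fixed: "InvJ_conj x y \<Longrightarrow> fixed_albert x \<Longrightarrow> fixed_albert y"
  by (erule InvJ_conjE) (simp add: fixed_albert_def)

lemma InvJ_conj_e12: "fixed_oct a \<Longrightarrow> InvJ_conj x (e12 a x)"
  by (rule InvJ_conjI [OF e12_in_InvJ]) (simp add: map_albert_e12 [OF hom] fixed_oct_def)

lemma InvJ_conj_swap: "InvJ_conj x (swap12 x)" "InvJ_conj x (swap23 x)" "InvJ_conj x (swap13 x)"
  by (rule InvJ_conjI; simp add: swap12_in_InvJ swap13_in_InvJ swap23_in_InvJ map_albert_swap [OF hom])+

lemma isotropic_value:
  assumes "d \<noteq> 0" "fixed_oct d" "fixed s"
  shows "\<exists>a. oct_norm a = 0 \<and> fixed_oct a \<and> oct_inner a d = s"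
proof -
  obtain e where e: "oct_norm e = 0" "oct_inner e d \<noteq> 0" "\<forall>\<sigma>. \<sigma> 0 = 0 \<and> \<sigma> 1 = 1 \<longrightarrow> map_oct \<sigma> e = e"
    using oct_dual_exists [OF assms(1)] by blast
  have fe: "fixed_oct e"
    unfolding fixed_oct_def using e(3) is_ring_homD(3,4) [OF hom] by blast
  \<comment> \<open>Placing both octonions in one off-diagonal slot makes rationality of
    \<open>oct_inner\<close> an instance of that of \<open>tform\<close>.\<close>
  have o: "tform (0, 0, 0, e, 0, 0) (0, 0, 0, d, 0, 0) = oct_inner e d" by simp
  have "fixed_albert (0, 0, 0, e, 0, 0)" "fixed_albert (0, 0, 0, d, 0, 0)"
    using fe assms by (simp_all add: fixed_albert_iff) (simp_all add: fixed_oct_def zero_prod_def is_ring_homD [OF hom])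
  then have fi: "fixed (oct_inner e d)" using fixed_albert_simps(9) o by metis
  define t where "t = s / oct_inner e d"
  have ft: "fixed t" using fi assms by (simp add: t_def)
  have "fixed_oct (map_oct ((*) t) e)"
  proof -
    have "map_oct \<sigma> (map_oct ((*) t) e) = map_oct ((*) t) e" if "\<sigma> \<in> \<Gamma>" for \<sigma>
    proof -
      have "map_oct \<sigma> (map_oct ((*) t) e) = map_oct ((*) (\<sigma> t)) (map_oct \<sigma> e)"
        by (cases e rule: oct_exhaust) (simp add: is_ring_homD [OF hom [OF that]])
      moreover have "\<sigma> t = t" "map_oct \<sigma> e = e" using ft fe that by (simp_all add: fixed_def fixed_oct_def)
      ultimately show ?thesis by simp
    qed
    then show ?thesis by (simp add: fixed_oct_def)
  qed
  moreover have "oct_norm (map_oct ((*) t) e) = t * t * oct_norm e" 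
    by (cases e rule: oct_exhaust) (simp add: algebra_simps)
  moreover have "oct_inner (map_oct ((*) t) e) d = t * oct_inner e d"
    by (cases e rule: oct_exhaust; cases d rule: oct_exhaust; simp add: algebra_simps)
  ultimately show ?thesis using e by (intro exI [of _ "map_oct ((*) t) e"]) (simp add: t_def)
qed

text \<open>For isotropic \<open>a\<close> the change of \<open>x1\<close> under
  \<open>e12 a\<close> is the linear term \<open>oct_inner a c3\<close>, which can be given the
  value \<open>1 - x1\<close>. The clause about \<open>c2\<close> keeps an already decoupled third
  row decoupled.\<close>

lemma normalize_x1:
  assumes "c3 \<noteq> 0" "fixed_albert (x1, x2, x3, c1, c2, c3)"
  shows "\<exists>c2' c3'. InvJ_conj (x1, x2, x3, c1, c2, c3) (1, x2, x3, c1, c2', c3') \<and> (c1 = 0 \<longrightarrow> c2' = c2)"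
proof -
  obtain a where a: "oct_norm a = 0" "fixed_oct a" "oct_inner a c3 = 1 - x1"
    using isotropic_value [of c3 "1 - x1"] assms by (auto simp: fixed_albert_iff)
  have "InvJ_conj (x1, x2, x3, c1, c2, c3)
      (1, x2, x3, c1, c2 + oct_conj (oct_mult a c1), c3 + map_oct ((*) x2) a)"
    using InvJ_conj_e12 [OF a(2), of "(x1, x2, x3, c1, c2, c3)"] by (simp add: a)
  moreover have "c1 = 0 \<longrightarrow> c2 + oct_conj (oct_mult a c1) = c2" by (intro impI) simp
  ultimately show ?thesis by blast
qed

lemma fixed_oct_simps [simp]:
  "fixed_oct 0" "fixed_oct a \<Longrightarrow> fixed_oct (- a)" "fixed_oct a \<Longrightarrow> fixed_oct (oct_conj a)"
  "fixed_oct (1, 0, 0, 0)"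
  by (cases a rule: oct_exhaust; simp add: fixed_oct_def zero_prod_def is_ring_homD [OF hom])+

text \<open>Gaussian elimination with pivot \<open>x2 = 1\<close>, taking
  \<open>a = - c3\<close>.\<close>

lemma eliminate_c3:
  assumes "fixed_albert (x1, 1, x3, c1, c2, c3)"
  shows "\<exists>x1' c2'. InvJ_conj (x1, 1, x3, c1, c2, c3) (x1', 1, x3, c1, c2', 0) \<and> (c1 = 0 \<longrightarrow> c2' = c2)"
proof -
  have "fixed_oct (- c3)" using assms by (simp add: fixed_albert_iff)
  from InvJ_conj_e12 [OF this, of "(x1, 1, x3, c1, c2, c3)"]
  have "InvJ_conj (x1, 1, x3, c1, c2, c3)
      (x1 + oct_inner (- c3) c3 + oct_norm c3, 1, x3, c1, c2 + oct_conj (oct_mult (- c3) c1), 0)"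
    by simp
  moreover have "c1 = 0 \<longrightarrow> c2 + oct_conj (oct_mult (- c3) c1) = c2" by (intro impI) simp
  ultimately show ?thesis by blast
qed

text \<open>The octonion \<open>(1, 0, 0, 0)\<close> is nonzero and rational, so \<open>e12\<close>
  spreads a nonzero \<open>x2\<close> into the empty slot and makes \<open>normalize_x1\<close>
  applicable.\<close>

lemma create_c3:
  assumes "x2 \<noteq> 0"
  shows "\<exists>x1' c2' c3'. InvJ_conj (x1, x2, x3, c1, c2, 0) (x1', x2, x3, c1, c2', c3') \<and> c3' \<noteq> 0 \<and>
     (c1 = 0 \<longrightarrow> c2' = c2)"
proof -
  have "(1, 0, 0, 0) \<noteq> (0 :: 'k oct)" by (simp add: zero_prod_def)
  with assms have "map_oct ((*) x2) (1, 0, 0, 0) \<noteq> 0" unfolding map_oct_eq_0 by blast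
  then have "0 + map_oct ((*) x2) (1, 0, 0, 0) \<noteq> 0" by simp
  moreover have "c1 = 0 \<longrightarrow> c2 + oct_conj (oct_mult (1, 0, 0, 0) c1) = c2" by (intro impI) simp
  ultimately show ?thesis
    using InvJ_conj_e12 [OF fixed_oct_simps(4), of "(x1, x2, x3, c1, c2, 0)"]
    unfolding e12.simps by blast
qed

lemma InvJ_conj_x2_one:
  assumes "cubic_norm x \<noteq> 0" "fixed_albert x"
  shows "\<exists>x1 x3 c1 c2 c3. InvJ_conj x (x1, 1, x3, c1, c2, c3)"
proof -
  note tr = InvJ_conj_trans and sw = InvJ_conj_swap
  have *: "\<exists>x1 x3 c1 c2 c3. InvJ_conj x (x1, 1, x3, c1, c2, c3)"
    if c: "InvJ_conj x (x1, x2, x3, c1, c2, c3)" "c3 \<noteq> 0" for x1 x2 x3 c1 c2 c3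
  proof -
    obtain c2' c3' where "InvJ_conj (x1, x2, x3, c1, c2, c3) (1, x2, x3, c1, c2', c3')"
      using normalize_x1 [OF c(2) InvJ_conj_fixed [OF c(1) assms(2)]] by blast
    from tr [OF tr [OF c(1) this] sw(1)] show ?thesis unfolding swap12.simps by blast
  qed
  obtain x1 x2 x3 c1 c2 c3 where x: "x = (x1, x2, x3, c1, c2, c3)" by (cases x) metis
  have refl: "InvJ_conj x (x1, x2, x3, c1, c2, c3)"
    using tr [OF sw(1) [of x] sw(1)] by (simp add: x)
  consider "c3 \<noteq> 0" | "c2 \<noteq> 0" | "c3 = 0" "c2 = 0" by blast
  then show ?thesis
  proof cases
    case 1 show ?thesis by (rule * [OF refl 1])
  next
    case 2
    have "InvJ_conj x (x1, x3, x2, oct_conj c1, oct_conj c3, oct_conj c2)"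
      using InvJ_conj_swap(2) [of x] by (simp add: x)
    then show ?thesis by (rule *) (simp add: 2)
  next
    case 3
    \<comment> \<open>When \<open>c2\<close> and \<open>c3\<close> vanish, \<open>x1\<close> is a
      factor of the norm.\<close>
    then have "x1 \<noteq> 0" using assms(1) by (auto simp: x)
    then obtain y1 d2 d3 where d: "InvJ_conj (x2, x1, x3, oct_conj c2, oct_conj c1, 0)
        (y1, x1, x3, oct_conj c2, d2, d3)" "d3 \<noteq> 0"
      using create_c3 [of x1 x2 x3 "oct_conj c2" "oct_conj c1"] by blast
    have "InvJ_conj x (x2, x1, x3, oct_conj c2, oct_conj c1, 0)"
      using sw(1) [of x] by (simp add: x 3)
    from * [OF tr [OF this d(1)] d(2)] show ?thesis .
  qed
qed

text \<open>A pivot equal to 1 clears both off-diagonal entries in its row and leaves a block of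
  size two. Because the octonion norm is isotropic, a second pivot can also be made 1, so the norm
  is all that survives on the diagonal.\<close>

lemma InvJ_conj_diagonal:
  assumes "cubic_norm x \<noteq> 0" "fixed_albert x"
  shows "InvJ_conj x (cubic_norm x, 1, 1, 0, 0, 0)"
proof -
  note tr = InvJ_conj_trans and sw = InvJ_conj_swap
  obtain x1 x3 c1 c2 c3 where 1: "InvJ_conj x (x1, 1, x3, c1, c2, c3)"
    using InvJ_conj_x2_one [OF assms] by blast
  obtain y1 d2 where 2: "InvJ_conj x (y1, 1, x3, c1, d2, 0)"
    using eliminate_c3 [OF InvJ_conj_fixed [OF 1 assms(2)]] tr [OF 1] by metis
  have 3: "InvJ_conj x (x3, 1, y1, 0, oct_conj d2, oct_conj c1)"
    using tr [OF 2 sw(3)] by simp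
  obtain y3 where "InvJ_conj (x3, 1, y1, 0, oct_conj d2, oct_conj c1) (y3, 1, y1, 0, oct_conj d2, 0)"
    using eliminate_c3 [OF InvJ_conj_fixed [OF 3 assms(2)]] by blast
  \<comment> \<open>The pivot is split off in the third position; only the upper left block remains
    to be treated.\<close>
  from tr [OF tr [OF 3 this] sw(2)] have 4: "InvJ_conj x (y3, y1, 1, 0, 0, d2)" by simp
  obtain z1 d where 5: "InvJ_conj x (z1, y1, 1, 0, 0, d)" "d \<noteq> 0"
  proof (cases "d2 = 0")
    case True
    with InvJ_conj_norm [OF 4] assms have "y1 \<noteq> 0" by auto
    then obtain z1 c2' c3' where c: "InvJ_conj (y3, y1, 1, 0, 0, d2) (z1, y1, 1, 0, c2', c3')"
        "c3' \<noteq> 0" "c2' = 0"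
      using create_c3 [of y1 y3 1 0 0] True by blast
    then show thesis using that [OF tr [OF 4]] by metis
  next
    case False then show thesis using that 4 by blast
  qed
  obtain e where "InvJ_conj (z1, y1, 1, 0, 0, d) (1, y1, 1, 0, 0, e)"
    using normalize_x1 [OF 5(2) InvJ_conj_fixed [OF 5(1) assms(2)]] by blast
  from tr [OF tr [OF 5(1) this] sw(1)] have 6: "InvJ_conj x (y1, 1, 1, 0, 0, oct_conj e)" by simp
  obtain n where "InvJ_conj (y1, 1, 1, 0, 0, oct_conj e) (n, 1, 1, 0, 0, 0)"
    using eliminate_c3 [OF InvJ_conj_fixed [OF 6 assms(2)]] by blast
  from tr [OF 6 this] have 7: "InvJ_conj x (n, 1, 1, 0, 0, 0)" .
  have "cubic_norm x = n" using InvJ_conj_norm [OF 7] by (simp add: zero_prod_def)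
  with 7 show ?thesis by simp
qed

end

section \<open>Galois-fixed vectors with the same nonzero quartic invariant\<close>

context galois_fixed
begin

text \<open>For \<open>adj c = 0\<close>, \<open>down c\<close> changes \<alpha> by
  \<open>tform c j'\<close> alone, so \<alpha> = 1 is reachable once \<open>j'\<close> is nonzero.
  \<open>B\<close> makes \<open>j'\<close> nonzero from \<open>j\<close>, and the last case makes
  \<open>j\<close> nonzero from \<beta>.\<close>

lemma normalize_alpha:
  assumes "fixed_freud v" "quartic_form v \<noteq> 0"
  shows "\<exists>j j' \<beta>. E7_conj v (1, j, j', \<beta>)"
proof -
  have A: "\<exists>j j' \<beta>. E7_conj v (1, j, j', \<beta>)" if c: "E7_conj v (\<alpha>, j, j', \<beta>)" "j' \<noteq> 0" for \<alpha> j j' \<beta>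
  proof -
    have f: "fixed_albert j'" "fixed (1 - \<alpha>)" using E7_conj_fixed [OF c(1) assms(1)] by simp_all
    obtain c where "adj c = 0" "fixed_albert c" "tform c j' = 1 - \<alpha>"
      using rank_one_value [OF c(2) f] by blast
    then have "E7_conj (\<alpha>, j, j', \<beta>) (1, j + scale_albert \<beta> c, j' + cross c j, \<beta>)"
      using E7_conj_down [of c "(\<alpha>, j, j', \<beta>)"] by (simp add: rank_one_cross(1))
    from E7_conj_trans [OF c(1) this] show ?thesis by blast
  qed
  have B: "\<exists>j j' \<beta>. E7_conj v (1, j, j', \<beta>)" if c: "E7_conj v (\<alpha>, j, 0, \<beta>)" "j \<noteq> 0" for \<alpha> j \<beta>
  proof -
    obtain c where "adj c = 0" "fixed_albert c" and n: "cross c j \<noteq> 0"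
      using rank_one_cross_nonzero [OF c(2)] by blast
    then have "E7_conj (\<alpha>, j, 0, \<beta>) (\<alpha>, j + scale_albert \<beta> c, cross c j, \<beta>)"
      using E7_conj_down [of c "(\<alpha>, j, 0, \<beta>)"] by (simp add: rank_one_cross(1))
    from A [OF E7_conj_trans [OF c(1) this] n] show ?thesis .
  qed
  obtain \<alpha> j j' \<beta> where v: "v = (\<alpha>, j, j', \<beta>)" by (rule freud_exhaust)
  have refl: "E7_conj v (\<alpha>, j, j', \<beta>)" using E7_conj_up [of 0 v] by (simp add: v)
  consider "j' \<noteq> 0" | "j' = 0" "j \<noteq> 0" | "j' = 0" "j = 0" by blast
  then show ?thesis
  proof cases
    case 1 show ?thesis by (rule A [OF refl 1])
  next
    case 2 with refl B show ?thesis by simp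
  next
    case 3
    \<comment> \<open>Without middle components the quartic form is the square of
      \<open>\<alpha> * \<beta>\<close>.\<close>
    with assms have "\<beta> \<noteq> 0" by (auto simp: v)
    have "one_albert \<noteq> (0 :: 'k albert)" by (simp add: one_albert_def zero_prod_def)
    then obtain c where c: "adj c = 0" "fixed_albert c" "cross c one_albert \<noteq> 0"
      using rank_one_cross_nonzero by blast
    then have "c \<noteq> 0" by (metis cross_0(1))
    then have "tform z (scale_albert \<beta> c) \<noteq> 0" if "tform z c \<noteq> 0" for z
      using \<open>\<beta> \<noteq> 0\<close> that by simp
    with \<open>c \<noteq> 0\<close> have nz: "scale_albert \<beta> c \<noteq> 0"
      using tform_nondegenerate [of c] by (metis tform_simps_right(4))
    have "E7_conj v (\<alpha>, scale_albert \<beta> c, 0, \<beta>)"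
      using E7_conj_down [OF c(2), of v] by (simp add: v 3 rank_one_cross(1) [OF c(1)] c(1))
    from B [OF this nz] show ?thesis .
  qed
qed

lemma E7_conj_kill_j':
  assumes "fixed_freud (1, j, j', \<beta>)" shows "\<exists>k \<delta>. E7_conj (1, j, j', \<beta>) (1, k, 0, \<delta>)"
  using E7_conj_up [of "- j'" "(1, j, j', \<beta>)"] assms by simp blast

text \<open>The map is \<open>down c\<close> followed by the translation that makes the third coordinate zero again.\<close>

lemma E7_conj_move_beta:
  assumes c: "adj c = 0" "fixed_albert c" and "fixed_albert j"
  shows "E7_conj (1, j, 0, \<beta>)
    (1, j + scale_albert (\<beta> - tform c (adj j)) c, 0, \<beta> - 2 * tform c (adj j))"
proof -
  define u where "u = cross c j"
  note r = rank_one_cross(1) [OF c(1)] rank_one_cross(2-5) [OF c(1), of j, folded u_def]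
  have "E7_conj (1, j, 0, \<beta>) (1, j + scale_albert \<beta> c, u, \<beta>)"
    using E7_conj_down [OF c(2), of "(1, j, 0, \<beta>)"] by (simp add: c(1) r(1) u_def)
  moreover have "fixed_albert (- u)" using c assms by (simp add: u_def)
  from E7_conj_up [OF this, of "(1, j + scale_albert \<beta> c, u, \<beta>)"]
  have "E7_conj (1, j + scale_albert \<beta> c, u, \<beta>)
    (1, j + scale_albert (\<beta> - tform c (adj j)) c, 0, \<beta> - 2 * tform c (adj j))"
  proof -
    \<comment> \<open>The translation by \<open>- u\<close> contributes
      \<open>cross (- u) u + adj u\<close>, which is \<open>- adj u\<close>, and
      \<open>adj u\<close> is a multiple of \<open>c\<close>.\<close>
    have "scale_albert (\<beta> - tform c (adj j)) c = scale_albert \<beta> c - adj u"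
      using scale_albert_add_left [of \<beta> "- tform c (adj j)" c] by (simp add: r)
    then have "j + scale_albert \<beta> c + cross (- u) u + scale_albert 1 (adj (- u))
        = j + scale_albert (\<beta> - tform c (adj j)) c"
      by (simp add: cross_self)
    moreover have "tform u c = 0" "tform (adj u) u = 0"
      using r(4) by (simp_all add: tform_commute [of u c] r(2))
    then have "\<beta> + tform (- u) (j + scale_albert \<beta> c) + tform (adj (- u)) u + 1 * cubic_norm (- u)
        = \<beta> - 2 * tform c (adj j)"
      by (simp add: r(3,5))
    moreover have "u + scale_albert 1 (- u) = 0" by simp
    ultimately show ?thesis
      using \<open>E7_conj (1, j + scale_albert \<beta> c, u, \<beta>) (up (- u) _)\<close> unfolding up_apply
      by (simp only:)
  qed
  ultimately show ?thesis by (rule E7_conj_trans)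
qed

text \<open>If \<open>adj j\<close> is nonzero, one move with
  \<open>tform c (adj j) = \<beta> / 2\<close> cancels \<beta>. Otherwise the rank of
  \<open>j\<close> is first raised with \<beta> unchanged: from 0 to
  \<open>scale_albert \<beta> c\<close>, and from zero adjoint to adjoint
  \<open>scale_albert \<beta> (cross c j)\<close>.\<close>

lemma E7_conj_beta_0:
  assumes f: "fixed_freud (1, j, 0, \<beta>)" and q: "quartic_form (1, j, 0, \<beta>) \<noteq> 0"
  shows "\<exists>k. E7_conj (1, j, 0, \<beta>) (1, k, 0, 0)"
proof -
  have A: "\<exists>k. E7_conj (1, j, 0, \<beta>) (1, k, 0, 0)" if j: "fixed_albert j" "fixed \<beta>" "adj j \<noteq> 0" for j \<beta>
  proof -
    have "fixed 2" using fixed_simps(3) [of 1 1] by simp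
    then have "fixed (\<beta> / 2)" using j by simp
    then obtain c where c: "adj c = 0" "fixed_albert c" "tform c (adj j) = \<beta> / 2"
      using rank_one_value [OF j(3) fixed_albert_simps(6) [OF j(1)]] by blast
    have "\<beta> - 2 * tform c (adj j) = 0" by (simp add: c(3))
    with E7_conj_move_beta [OF c(1,2) j(1), of \<beta>] show ?thesis by metis
  qed
  have B: "\<exists>k. E7_conj (1, j, 0, \<beta>) (1, k, 0, 0)"
    if j: "fixed_albert j" "fixed \<beta>" "j \<noteq> 0" "\<beta> \<noteq> 0" for j \<beta>
  proof (cases "adj j = 0")
    case False then show ?thesis using A j by blast
  next
    case True
    obtain c where c: "adj c = 0" "fixed_albert c" "cross c j \<noteq> 0"
      using rank_one_cross_nonzero [OF j(3)] by blast
    have *: "E7_conj (1, j, 0, \<beta>) (1, j + scale_albert \<beta> c, 0, \<beta>)"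
      using E7_conj_move_beta [OF c(1,2) j(1), of \<beta>] by (simp add: True)
    have "adj (j + scale_albert \<beta> c) = scale_albert \<beta> (cross c j)"
      by (simp add: adj_add True c(1) cross_commute)
    moreover have "scale_albert (inverse \<beta>) (scale_albert \<beta> (cross c j)) \<noteq> 0"
      using c(3) j(4) by simp
    then have "scale_albert \<beta> (cross c j) \<noteq> 0" by (metis scale_albert_simps(4))
    ultimately have "adj (j + scale_albert \<beta> c) \<noteq> 0" by simp
    moreover have "fixed_albert (j + scale_albert \<beta> c)" using c j by simp
    ultimately obtain k where "E7_conj (1, j + scale_albert \<beta> c, 0, \<beta>) (1, k, 0, 0)"
      using A j(2) by blast
    from E7_conj_trans [OF * this] show ?thesis by blast
  qed
  have fj: "fixed_albert j" "fixed \<beta>" using f by simp_all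
  show ?thesis
  proof (cases "adj j = 0")
    case False then show ?thesis using A fj by blast
  next
    case True
    \<comment> \<open>With \<open>cubic_norm j = 0\<close> the quartic value is the square of
      \<beta>.\<close>
    then have "3 * cubic_norm j = 0" using tform_adj_self [of j] by simp
    then have "\<beta> \<noteq> 0" using q by auto
    show ?thesis
    proof (cases "j = 0")
      case False then show ?thesis using B fj \<open>\<beta> \<noteq> 0\<close> by blast
    next
      case j0: True
      have "one_albert \<noteq> (0 :: 'k albert)" by (simp add: one_albert_def zero_prod_def)
      then obtain c where c: "adj c = 0" "fixed_albert c" "cross c one_albert \<noteq> 0"
        using rank_one_cross_nonzero by blast
      have *: "E7_conj (1, j, 0, \<beta>) (1, scale_albert \<beta> c, 0, \<beta>)"
        using E7_conj_move_beta [OF c(1,2) fj(1), of \<beta>] by (simp add: j0)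
      have "scale_albert (inverse \<beta>) (scale_albert \<beta> c) \<noteq> 0"
        using c(3) \<open>\<beta> \<noteq> 0\<close> by auto
      then have "scale_albert \<beta> c \<noteq> 0" by (metis scale_albert_simps(4))
      moreover have "fixed_albert (scale_albert \<beta> c)" using c fj by simp
      ultimately obtain k where "E7_conj (1, scale_albert \<beta> c, 0, \<beta>) (1, k, 0, 0)"
        using B fj \<open>\<beta> \<noteq> 0\<close> by blast
      from E7_conj_trans [OF * this] show ?thesis by blast
    qed
  qed
qed

text \<open>The value q/4 arises because the quartic form at \<open>(1, l, 0, 0)\<close> is
  \<open>4 * cubic_norm l\<close>.\<close>

lemma E7_conj_canonical:
  assumes "fixed_freud v" "quartic_form v \<noteq> 0"
  shows "E7_conj v (1, (quartic_form v / 4, 1, 1, 0, 0, 0), 0, 0)"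
proof -
  note tr = E7_conj_trans
  obtain j j' \<beta> where 1: "E7_conj v (1, j, j', \<beta>)"
    using normalize_alpha [OF assms] by blast
  obtain k \<delta> where "E7_conj (1, j, j', \<beta>) (1, k, 0, \<delta>)"
    using E7_conj_kill_j' [OF E7_conj_fixed [OF 1 assms(1)]] by blast
  note 2 = tr [OF 1 this]
  have "quartic_form (1, k, 0, \<delta>) \<noteq> 0" using E7_conj_quartic [OF 2] assms(2) by simp
  from E7_conj_beta_0 [OF E7_conj_fixed [OF 2 assms(1)] this]
  obtain l where "E7_conj (1, k, 0, \<delta>) (1, l, 0, 0)" by blast
  note 3 = tr [OF 2 this]
  have n: "quartic_form v = 4 * cubic_norm l" using E7_conj_quartic [OF 3] by simp
  have "InvJ_conj l (cubic_norm l, 1, 1, 0, 0, 0)"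
    using n assms(2) E7_conj_fixed [OF 3 assms(1)] by (intro InvJ_conj_diagonal) auto
  from tr [OF 3 InvJ_conj_imp_E7_conj [OF this]] show ?thesis by (simp add: n)
qed

theorem E7_conj_iff_quartic:
  assumes "fixed_freud v" "fixed_freud w" "quartic_form v = quartic_form w" "quartic_form v \<noteq> 0"
  shows "E7_conj v w"
proof (rule E7_conj_trans [OF E7_conj_canonical [OF assms(1,4)] E7_conj_sym])
  show "E7_conj w (1, (quartic_form v / 4, 1, 1, 0, 0, 0), 0, 0)"
    using E7_conj_canonical [OF assms(2)] assms(3,4) by (simp del: quartic_form_eq)
qed

end

section \<open>Coboundaries\<close>

locale galois_acted_group =
  group G for G :: "('g, 'k :: field) gal_group" (structure) +
  fixes \<iota> :: "'f::field \<Rightarrow> 'k"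
  assumes act: "\<sigma> \<in> Gal \<iota> \<Longrightarrow> gact G \<sigma> \<in> hom G G"
begin

lemma act_simps [simp]:
  assumes "\<sigma> \<in> Gal \<iota>" "x \<in> carrier G"
  shows "gact G \<sigma> x \<in> carrier G"
    and "y \<in> carrier G \<Longrightarrow> gact G \<sigma> (x \<otimes> y) = gact G \<sigma> x \<otimes> gact G \<sigma> y"
    and "gact G \<sigma> (inv x) = inv (gact G \<sigma> x)"
proof -
  interpret group_hom G G "gact G \<sigma>"
    using act [OF assms(1)] by unfold_locales
  show "gact G \<sigma> x \<in> carrier G" "gact G \<sigma> (inv x) = inv (gact G \<sigma> x)"
    "y \<in> carrier G \<Longrightarrow> gact G \<sigma> (x \<otimes> y) = gact G \<sigma> x \<otimes> gact G \<sigma> y"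
    using assms by simp_all
qed

lemma act_one [simp]: "\<sigma> \<in> Gal \<iota> \<Longrightarrow> gact G \<sigma> \<one> = \<one>"
  using hom_one [OF act is_group is_group] by blast

lemma trivial_in_Z1: "(\<lambda>\<sigma>\<in>Gal \<iota>. \<one>) \<in> Z1 \<iota> G"
proof -
  have "continuous_map (krull_topology \<iota>) (discrete_topology (carrier G)) (\<lambda>\<sigma>\<in>Gal \<iota>. \<one>)"
    by (rule continuous_map_eq [of _ _ "\<lambda>_. \<one>"]) (simp_all add: krull_topology_def)
  moreover have "\<sigma> \<circ> \<tau> \<in> Gal \<iota>" if "\<sigma> \<in> Gal \<iota>" "\<tau> \<in> Gal \<iota>" for \<sigma> \<tau>
    using that by (simp add: Gal_def is_ring_hom_def bij_comp)
  ultimately show ?thesis by (simp add: Z1_def)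
qed

lemma H1_trivial_iff:
  "a \<in> H1_trivial \<iota> G \<longleftrightarrow> a \<in> Z1 \<iota> G \<and> (\<exists>x\<in>carrier G. \<forall>\<sigma>\<in>Gal \<iota>. a \<sigma> = inv x \<otimes> gact G \<sigma> x)"
  by (auto simp: H1_trivial_def H1_class_def)

lemma trivial_in_H1_trivial: "(\<lambda>\<sigma>\<in>Gal \<iota>. \<one>) \<in> H1_trivial \<iota> G"
  unfolding H1_trivial_iff using trivial_in_Z1 by (auto intro!: bexI [of _ \<one>])

lemma H1_class_coboundary:
  assumes x: "x \<in> carrier G" and a: "\<And>\<sigma>. \<sigma> \<in> Gal \<iota> \<Longrightarrow> a \<sigma> = inv x \<otimes> gact G \<sigma> x"
  shows "H1_class \<iota> G a = H1_trivial \<iota> G"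
proof -
  have "(\<exists>y\<in>carrier G. \<forall>\<sigma>\<in>Gal \<iota>. a' \<sigma> = inv y \<otimes> a \<sigma> \<otimes> gact G \<sigma> y) \<longleftrightarrow>
      (\<exists>z\<in>carrier G. \<forall>\<sigma>\<in>Gal \<iota>. a' \<sigma> = inv z \<otimes> gact G \<sigma> z)" for a'
  proof
    assume "\<exists>y\<in>carrier G. \<forall>\<sigma>\<in>Gal \<iota>. a' \<sigma> = inv y \<otimes> a \<sigma> \<otimes> gact G \<sigma> y"
    then obtain y where y: "y \<in> carrier G" "\<forall>\<sigma>\<in>Gal \<iota>. a' \<sigma> = inv y \<otimes> a \<sigma> \<otimes> gact G \<sigma> y" ..
    have "\<forall>\<sigma>\<in>Gal \<iota>. a' \<sigma> = inv (x \<otimes> y) \<otimes> gact G \<sigma> (x \<otimes> y)"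
      using x y by (simp add: a inv_mult_group m_assoc)
    then show "\<exists>z\<in>carrier G. \<forall>\<sigma>\<in>Gal \<iota>. a' \<sigma> = inv z \<otimes> gact G \<sigma> z" using x y(1) by blast
  next
    assume "\<exists>z\<in>carrier G. \<forall>\<sigma>\<in>Gal \<iota>. a' \<sigma> = inv z \<otimes> gact G \<sigma> z"
    then obtain z where z: "z \<in> carrier G" "\<forall>\<sigma>\<in>Gal \<iota>. a' \<sigma> = inv z \<otimes> gact G \<sigma> z" ..
    have "u \<otimes> (inv u \<otimes> v) = v" if "u \<in> carrier G" "v \<in> carrier G" for u v
      using that by (simp add: m_assoc [symmetric])
    then have "\<forall>\<sigma>\<in>Gal \<iota>. a' \<sigma> = inv (inv x \<otimes> z) \<otimes> a \<sigma> \<otimes> gact G \<sigma> (inv x \<otimes> z)"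
      using x z by (simp add: a inv_mult_group m_assoc)
    then show "\<exists>y\<in>carrier G. \<forall>\<sigma>\<in>Gal \<iota>. a' \<sigma> = inv y \<otimes> a \<sigma> \<otimes> gact G \<sigma> y" using x z(1) by blast
  qed
  then show ?thesis by (auto simp: H1_trivial_iff) (auto simp: H1_class_def)
qed

text \<open>If \<open>z\<close> carries \<open>a\<close> to the coboundary of \<open>y\<close>, then
  \<open>a\<close> is the coboundary of \<open>y \<otimes> inv z\<close>.\<close>

lemma cohomologous_coboundary:
  assumes a': "a' \<in> H1_class \<iota> G a" and a: "a \<in> Gal \<iota> \<rightarrow> carrier G"
    and y: "y \<in> carrier G" "\<And>\<sigma>. \<sigma> \<in> Gal \<iota> \<Longrightarrow> a' \<sigma> = inv y \<otimes> gact G \<sigma> y"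
  shows "H1_class \<iota> G a = H1_trivial \<iota> G"
proof -
  obtain z where z: "z \<in> carrier G" "\<forall>\<sigma>\<in>Gal \<iota>. a' \<sigma> = inv z \<otimes> a \<sigma> \<otimes> gact G \<sigma> z"
    using a' by (auto simp: H1_class_def)
  have "a \<sigma> = inv (y \<otimes> inv z) \<otimes> gact G \<sigma> (y \<otimes> inv z)" if \<sigma>: "\<sigma> \<in> Gal \<iota>" for \<sigma>
  proof -
    have c: "a \<sigma> \<in> carrier G" using a \<sigma> by blast
    have "inv z \<otimes> a \<sigma> \<otimes> gact G \<sigma> z = inv y \<otimes> gact G \<sigma> y" using z(2) y(2) \<sigma> by metis
    then have "z \<otimes> (inv z \<otimes> a \<sigma> \<otimes> gact G \<sigma> z) \<otimes> inv (gact G \<sigma> z)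
      = z \<otimes> (inv y \<otimes> gact G \<sigma> y) \<otimes> inv (gact G \<sigma> z)" by simp
    moreover have "z \<otimes> (inv z \<otimes> v) = v" if "v \<in> carrier G" for v
      using that z(1) by (simp add: m_assoc [symmetric])
    ultimately show ?thesis using c \<sigma> z(1) y(1) by (simp add: inv_mult_group m_assoc)
  qed
  with y(1) z(1) show ?thesis by (intro H1_class_coboundary [of "y \<otimes> inv z"]) simp_all
qed

end

text \<open>Reduces the kernel to cocycles. As \<open>H1_map\<close> is a union over
  representatives, the trivial cocycle is met only through some representative \<open>a'\<close> of
  \<open>c\<close>; once \<open>a'\<close> is a coboundary, \<open>cohomologous_coboundary\<close>
  passes this on to the chosen \<open>a\<close>.\<close>

lemma H1_kernel_trivialI:
  assumes "galois_acted_group G \<iota>" "galois_acted_group H \<iota>"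
    and f: "\<And>x. x \<in> carrier G \<Longrightarrow> f x \<in> carrier H"
    and f_coboundary: "\<And>\<sigma> x. \<sigma> \<in> Gal \<iota> \<Longrightarrow> x \<in> carrier G \<Longrightarrow>
        f (inv\<^bsub>G\<^esub> x \<otimes>\<^bsub>G\<^esub> gact G \<sigma> x) = inv\<^bsub>H\<^esub> (f x) \<otimes>\<^bsub>H\<^esub> gact H \<sigma> (f x)"
    and key: "\<And>a x. a \<in> Gal \<iota> \<rightarrow> carrier G \<Longrightarrow> x \<in> carrier H \<Longrightarrow>
        (\<And>\<sigma>. \<sigma> \<in> Gal \<iota> \<Longrightarrow> \<one>\<^bsub>H\<^esub> = inv\<^bsub>H\<^esub> x \<otimes>\<^bsub>H\<^esub> f (a \<sigma>) \<otimes>\<^bsub>H\<^esub> gact H \<sigma> x) \<Longrightarrow>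
        \<exists>y\<in>carrier G. \<forall>\<sigma>\<in>Gal \<iota>. a \<sigma> = inv\<^bsub>G\<^esub> y \<otimes>\<^bsub>G\<^esub> gact G \<sigma> y"
  shows "H1_kernel \<iota> G H f = {H1_trivial \<iota> G}"
proof -
  interpret G: galois_acted_group G \<iota> by (rule assms(1))
  interpret H: galois_acted_group H \<iota> by (rule assms(2))
  have "H1_map \<iota> H f (H1_trivial \<iota> G) = H1_trivial \<iota> H"
  proof -
    have "H1_class \<iota> H (\<lambda>\<sigma>\<in>Gal \<iota>. f (a \<sigma>)) = H1_trivial \<iota> H" if t: "a \<in> H1_trivial \<iota> G" for a
    proof -
      obtain x where x: "x \<in> carrier G" "\<forall>\<sigma>\<in>Gal \<iota>. a \<sigma> = inv\<^bsub>G\<^esub> x \<otimes>\<^bsub>G\<^esub> gact G \<sigma> x"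
        using t unfolding G.H1_trivial_iff by blast
      show ?thesis
        using f [OF x(1)] by (rule H.H1_class_coboundary) (simp add: x f_coboundary)
    qed
    then show ?thesis
      unfolding H1_map_def using G.trivial_in_H1_trivial by blast
  qed
  moreover have "H1_trivial \<iota> G \<in> H1 \<iota> G"
    unfolding H1_def H1_trivial_def using G.trivial_in_Z1 by blast
  moreover have "c = H1_trivial \<iota> G" if c: "c \<in> H1 \<iota> G" "H1_map \<iota> H f c = H1_trivial \<iota> H" for c
  proof -
    obtain a where a: "a \<in> Z1 \<iota> G" "c = H1_class \<iota> G a" using c(1) unfolding H1_def by blast
    have "(\<lambda>\<sigma>\<in>Gal \<iota>. \<one>\<^bsub>H\<^esub>) \<in> H1_map \<iota> H f c"
      using H.trivial_in_H1_trivial by (simp only: c(2))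
    then obtain a' where a': "a' \<in> c" "(\<lambda>\<sigma>\<in>Gal \<iota>. \<one>\<^bsub>H\<^esub>) \<in> H1_class \<iota> H (\<lambda>\<sigma>\<in>Gal \<iota>. f (a' \<sigma>))"
      unfolding H1_map_def by blast
    then have "a' \<in> Gal \<iota> \<rightarrow> carrier G"
      unfolding a(2) H1_class_def Z1_def by auto
    moreover obtain x where "x \<in> carrier H"
      "\<And>\<sigma>. \<sigma> \<in> Gal \<iota> \<Longrightarrow> \<one>\<^bsub>H\<^esub> = inv\<^bsub>H\<^esub> x \<otimes>\<^bsub>H\<^esub> f (a' \<sigma>) \<otimes>\<^bsub>H\<^esub> gact H \<sigma> x"
      using a'(2) unfolding H1_class_def by auto
    ultimately obtain y where y: "y \<in> carrier G" "\<forall>\<sigma>\<in>Gal \<iota>. a' \<sigma> = inv\<^bsub>G\<^esub> y \<otimes>\<^bsub>G\<^esub> gact G \<sigma> y"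
      using key by blast
    have "a \<in> Gal \<iota> \<rightarrow> carrier G" using a(1) unfolding Z1_def by auto
    from G.cohomologous_coboundary [OF a'(1) [unfolded a(2)] this y(1) bspec [OF y(2)]]
    show ?thesis unfolding a(2) .
  qed
  ultimately show ?thesis unfolding H1_kernel_def by blast
qed

section \<open>The Galois action on \<open>E7\<close> and the twisting cocycle\<close>

lemma E7_inv_into_apply:
  assumes "x \<in> carrier E7" shows "inv_into UNIV x (x v) = v" "x (inv_into UNIV x v) = v"
  using E7D(3) [OF assms] by (simp_all add: bij_is_inj bij_is_surj surj_f_inv_f)

lemma map_freud_inv_into:
  assumes "bij \<sigma>"
  shows "map_freud \<sigma> (map_freud (inv_into UNIV \<sigma>) v) = v" "map_freud (inv_into UNIV \<sigma>) (map_freud \<sigma> v) = v"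
proof -
  have "\<sigma> \<circ> inv_into UNIV \<sigma> = id" "inv_into UNIV \<sigma> \<circ> \<sigma> = id"
    using assms by (simp_all add: fun_eq_iff bij_is_inj bij_is_surj surj_f_inv_f)
  then show "map_freud \<sigma> (map_freud (inv_into UNIV \<sigma>) v) = v" "map_freud (inv_into UNIV \<sigma>) (map_freud \<sigma> v) = v"
    by (simp_all add: map_freud_comp)
qed

lemma is_ring_hom_inv_into:
  assumes "is_ring_hom \<sigma>" "bij (\<sigma> :: 'k::field \<Rightarrow> 'k)" shows "is_ring_hom (inv_into UNIV \<sigma>)"
proof -
  have s: "\<sigma> (inv_into UNIV \<sigma> x) = x" and t: "inv_into UNIV \<sigma> (\<sigma> x) = x" for x
    using assms(2) by (simp_all add: bij_is_inj bij_is_surj surj_f_inv_f)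
  note h = is_ring_homD [OF assms(1)]
  show ?thesis
    unfolding is_ring_hom_def
    using t [of 1] t [of "inv_into UNIV \<sigma> _ + inv_into UNIV \<sigma> _"] t [of "inv_into UNIV \<sigma> _ * inv_into UNIV \<sigma> _"]
    by (simp add: h s)
qed

lemma galois_conj_apply: "galois_conj \<sigma> x v = map_freud \<sigma> (x (map_freud (inv_into UNIV \<sigma>) v))"
  by (simp add: galois_conj_def)

lemma omega_apply: "omega i v = scale_freud i (flip v)"
  by (cases v rule: freud_exhaust) (simp add: omega_def)

lemma omega_power:
  "omega i ^^ n = (\<lambda>v. scale_freud (i ^ n) (if even n then v else flip v))"
proof (induction n)
  case (Suc n)
  then show ?case by (simp add: fun_eq_iff omega_apply flip_linear)
qed (simp add: fun_eq_iff map_freud_id [unfolded id_def])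

lemma flip_base_vec: "flip base_vec = base_vec"
  by (simp add: base_vec_def)

context char_not_2_3
begin

text \<open>The description is definite because \<open>omega i ^^ n\<close> depends only on
  \<open>i ^ n\<close> and the parity of \<open>n\<close>, and the square of \<open>i ^ n\<close>
  determines the parity since -1 differs from 1.\<close>

lemma mu4_embed_base_vec:
  assumes i: "i ^ 2 = (-1 :: 'k)" and z: "z ^ 4 = 1"
  shows "mu4_embed i z base_vec = scale_freud z base_vec"
proof -
  have "1 \<noteq> (-1 :: 'k)"
  proof
    assume "1 = (-1 :: 'k)"
    then have "1 + 1 = (0 :: 'k)" by (metis add.right_inverse)
    then show False by simp
  qed
  then have e: "even n \<longleftrightarrow> (i ^ n) ^ 2 = 1" for n
    by (metis i minus_one_power_iff power_commutes power_mult mult.commute)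
  have "(z ^ 2 - 1) * (z ^ 2 + 1) = 0" using z by algebra
  then have "z ^ 2 = 1 \<or> z ^ 2 = i ^ 2" unfolding i by (auto simp: eq_neg_iff_add_eq_0)
  then have "z = 1 \<or> z = - 1 \<or> z = i \<or> z = - i" by (simp add: power2_eq_iff) (metis power2_eq_1_iff)
  then have "z = i ^ 0 \<or> z = i ^ 2 \<or> z = i ^ 1 \<or> z = i ^ 3"
    using i by (simp add: power3_eq_cube power2_eq_square)
  then obtain n where n: "z = i ^ n" by blast
  have "mu4_embed i z = omega i ^^ n"
    unfolding mu4_embed_def
  proof (rule the_equality)
    show "\<exists>m. z = i ^ m \<and> omega i ^^ n = omega i ^^ m" using n by blast
    fix \<Phi> assume "\<exists>m. z = i ^ m \<and> \<Phi> = omega i ^^ m"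
    then obtain m where m: "z = i ^ m" "\<Phi> = omega i ^^ m" by blast
    have "even m \<longleftrightarrow> even n" unfolding e using m n by simp
    then show "\<Phi> = omega i ^^ n" using m n unfolding omega_power by simp
  qed
  then show ?thesis by (simp add: omega_power n flip_base_vec)
qed

lemma E6_eq_stabilizer:
  "E6_embed ` InvJ = {\<Phi> \<in> carrier E7. \<Phi> base_vec = (base_vec :: 'k freud)}"
  using E6_embed_in_E7 E6_embed_base_vec stabilizer_base_vec by blast

lemma galois_conj_in_E7:
  assumes "is_ring_hom \<sigma>" "bij \<sigma>" "x \<in> carrier E7"
  shows "galois_conj \<sigma> x \<in> (carrier E7 :: ('k freud \<Rightarrow> _) set)"
proof -
  have s: "\<sigma> (inv_into UNIV \<sigma> c) = c" for c
    using assms(2) by (simp add: bij_is_surj surj_f_inv_f)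
  note i = is_ring_hom_inv_into [OF assms(1,2)]
  note d = E7D [OF assms(3)]
  have b: "bij (map_freud \<sigma>)" "bij (map_freud (inv_into UNIV \<sigma>))"
    by (rule o_bij [of "map_freud (inv_into UNIV \<sigma>)"] o_bij [of "map_freud \<sigma>"];
        simp add: fun_eq_iff map_freud_inv_into [OF assms(2)])+
  have "bij (galois_conj \<sigma> x)"
    unfolding galois_conj_def by (intro bij_comp b d)
  then show ?thesis
    unfolding E7_iff galois_conj_apply
    by (simp add: map_freud_hom [OF assms(1)] map_freud_hom [OF i] d s
        map_freud_forms [OF assms(1)] map_freud_forms [OF i] del: quartic_form_eq alt_form_eq)
qed

text \<open>A linear coordinate defined over F that does not vanish at \<open>v\<close>: one of the
  two scalars, or \<open>tform\<close> against an element with entries 0 and 1.\<close>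

lemma rational_functional:
  assumes "v \<noteq> (0 :: 'k freud)"
  shows "\<exists>L. (\<forall>c u. L (scale_freud c u) = c * L u) \<and> L v \<noteq> 0 \<and>
    (\<forall>\<sigma> u. is_ring_hom \<sigma> \<longrightarrow> L (map_freud \<sigma> u) = \<sigma> (L u))"
proof -
  have L: "fst (map_freud f u) = f (fst u)" "fst (snd (map_freud f u)) = map_albert f (fst (snd u))"
    "fst (snd (snd (map_freud f u))) = map_albert f (fst (snd (snd u)))"
    "snd (snd (snd (map_freud f u))) = f (snd (snd (snd u)))" for f and u :: "'k freud"
    by (cases u rule: freud_exhaust; simp)+
  have E: "\<exists>e. tform e x \<noteq> 0 \<and> (\<forall>\<sigma> y. is_ring_hom \<sigma> \<longrightarrow> tform e (map_albert \<sigma> y) = \<sigma> (tform e y))"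
    if x: "x \<noteq> 0" for x :: "'k albert"
  proof -
    obtain e where e: "tform e x \<noteq> 0" "\<forall>\<sigma>. \<sigma> 0 = 0 \<and> \<sigma> 1 = 1 \<longrightarrow> map_albert \<sigma> e = e"
      using rank_one_dual_exists [OF x] by blast
    have "tform e (map_albert \<sigma> y) = \<sigma> (tform e y)" if h: "is_ring_hom \<sigma>" for \<sigma> y
      using e(2) is_ring_homD(3,4) [OF h] by (simp add: map_albert_hom(8) [OF h])
    with e(1) show ?thesis by blast
  qed
  obtain \<alpha> j j' \<beta> where v: "v = (\<alpha>, j, j', \<beta>)" by (rule freud_exhaust)
  consider "\<alpha> \<noteq> 0" | "j \<noteq> 0" | "j' \<noteq> 0" | "\<beta> \<noteq> 0"
    using assms v by (metis zero_prod_def)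
  then show ?thesis
  proof cases
    case 1 then show ?thesis by (intro exI [of _ fst]) (simp add: v L)
  next
    case 2
    from E [OF this] obtain e where e: "tform e j \<noteq> 0"
      "\<forall>\<sigma> y. is_ring_hom \<sigma> \<longrightarrow> tform e (map_albert \<sigma> y) = \<sigma> (tform e y)" by blast
    then show ?thesis by (intro exI [of _ "\<lambda>u. tform e (fst (snd u))"]) (simp add: v L)
  next
    case 3
    from E [OF this] obtain e where e: "tform e j' \<noteq> 0"
      "\<forall>\<sigma> y. is_ring_hom \<sigma> \<longrightarrow> tform e (map_albert \<sigma> y) = \<sigma> (tform e y)" by blast
    then show ?thesis by (intro exI [of _ "\<lambda>u. tform e (fst (snd (snd u)))"]) (simp add: v L)
  next
    case 4 then show ?thesis by (intro exI [of _ "\<lambda>u. snd (snd (snd u))"]) (simp add: v L)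
  qed
qed

end

section \<open>Triviality of the kernel\<close>

lemma E7_comp: "x \<in> carrier E7 \<Longrightarrow> y \<in> carrier E7 \<Longrightarrow> x \<circ> y \<in> carrier E7"
  using monoid.m_closed [OF group.is_monoid [OF group_E7], of x y] by simp

context galois_fixed
begin

text \<open>With b = g^-1 \<sigma>(g), the conclusion is the twisted coboundary relation a = y^-1 b
  \<sigma>(y) b^-1 cleared of the inverses of \<open>y\<close> and b; the hypothesis
  \<open>eq\<close> is the untwisted one for \<open>x\<close> in E7.\<close>

lemma coboundary_in_E6:
  assumes g: "g \<in> carrier E7" and x: "x \<in> carrier E7"
    and base: "\<And>\<sigma>. \<sigma> \<in> \<Gamma> \<Longrightarrow> galois_conj \<sigma> g base_vec = g (scale_freud (z \<sigma>) base_vec)"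
    and z: "\<And>\<sigma>. \<sigma> \<in> \<Gamma> \<Longrightarrow> z \<sigma> \<noteq> 0"
    and a: "\<And>\<sigma>. \<sigma> \<in> \<Gamma> \<Longrightarrow> a \<sigma> \<in> E6_embed ` InvJ"
    and eq: "\<And>\<sigma> v. \<sigma> \<in> \<Gamma> \<Longrightarrow> v = inv_into UNIV x (g (a \<sigma> (inv_into UNIV g (galois_conj \<sigma> x v))))"
  shows "\<exists>y\<in>E6_embed ` InvJ. \<forall>\<sigma>\<in>\<Gamma>. \<forall>v. 
    galois_conj \<sigma> g (galois_conj \<sigma> y v) = g (y (a \<sigma> (inv_into UNIV g (galois_conj \<sigma> g v))))"
proof -
  define g' where "g' = inv_into UNIV g"
  define x' where "x' = inv_into UNIV x"
  have g'[simp]: "g' \<in> carrier E7" "\<And>v. g (g' v) = v" "\<And>v. g' (g v) = v"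
    using E7_inv_into [OF g] E7_inv_into_apply [OF g] by (simp_all add: g'_def)
  have x'[simp]: "x' \<in> carrier E7" "\<And>v. x (x' v) = v" "\<And>v. x' (x v) = v"
    using E7_inv_into [OF x] E7_inv_into_apply [OF x] by (simp_all add: x'_def)
  define S where "S \<sigma> = map_freud \<sigma>" for \<sigma> :: "'k \<Rightarrow> 'k"
  define S' where "S' \<sigma> = map_freud (inv_into UNIV \<sigma>)" for \<sigma> :: "'k \<Rightarrow> 'k"
  have SS [simp]: "S \<sigma> (S' \<sigma> v) = v" "S' \<sigma> (S \<sigma> v) = v" if "\<sigma> \<in> \<Gamma>" for \<sigma> v
    using map_freud_inv_into [OF bij [OF that]] by (simp_all add: S_def S'_def)
  have gc: "galois_conj \<sigma> \<Phi> v = S \<sigma> (\<Phi> (S' \<sigma> v))" for \<sigma> \<Phi> v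
    by (simp add: galois_conj_apply S_def S'_def)
  have S_scale: "S \<sigma> (scale_freud c v) = scale_freud (\<sigma> c) (S \<sigma> v)" if "\<sigma> \<in> \<Gamma>" for \<sigma> c v
    using map_freud_hom(2) [OF hom [OF that]] by (simp add: S_def)
  have S_base: "S \<sigma> base_vec = base_vec" "S' \<sigma> base_vec = base_vec" if "\<sigma> \<in> \<Gamma>" for \<sigma>
  proof -
    show "S \<sigma> base_vec = base_vec"
      using is_ring_homD(3,4) [OF hom [OF that]] map_albert_hom(4) [OF hom [OF that]] by (simp add: S_def base_vec_def)
    then show "S' \<sigma> base_vec = base_vec" using SS(2) [OF that, of base_vec] by simp
  qed
  define u where "u = g base_vec"
  have Su: "S \<sigma> u = scale_freud (z \<sigma>) u" if "\<sigma> \<in> \<Gamma>" for \<sigma>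
    using base [OF that] by (simp add: gc S_base that u_def E7D(2) [OF g])
  have "quartic_form u = 1"
    unfolding u_def E7D(4) [OF g] by (simp add: base_vec_def)
  moreover have "quartic_form (0, 0, 0, 0 :: 'k) = 0" by simp
  then have "quartic_form (0 :: 'k freud) = 0" by (simp only: zero_prod_def)
  ultimately have "u \<noteq> 0" by (metis zero_neq_one)
  then obtain L where L: "\<And>c v. L (scale_freud c v) = c * L v" "L u \<noteq> 0"
    "\<And>\<sigma> v. is_ring_hom \<sigma> \<Longrightarrow> L (map_freud \<sigma> v) = \<sigma> (L v)"
    using rational_functional [of u] by blast
  \<comment> \<open>The scalar \<open>t\<close> is multiplied by \<open>z \<sigma>\<close> just as
    \<open>u\<close> is, so the quotient \<open>w\<close> is fixed.\<close>
  define t where "t = L u"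
  have t: "\<sigma> t = z \<sigma> * t" if "\<sigma> \<in> \<Gamma>" for \<sigma>
    using L(3) [OF hom [OF that], of u] Su [OF that] by (simp add: S_def L(1) t_def)
  define w where "w = scale_freud (inverse t) u"
  have tw: "scale_freud t w = u" using L(2) by (simp add: w_def t_def)
  have Sw: "S \<sigma> w = w" if "\<sigma> \<in> \<Gamma>" for \<sigma>
  proof -
    have "inverse (z \<sigma> * t) * z \<sigma> = inverse t" using z [OF that] by simp
    then show ?thesis
      by (simp only: w_def S_scale [OF that] Su [OF that] is_ring_hom_inverse [OF hom [OF that]] t [OF that]
          scale_freud_simps)
  qed
  have S'w: "S' \<sigma> w = w" if "\<sigma> \<in> \<Gamma>" for \<sigma>
    using SS(2) [OF that, of w] Sw [OF that] by simp
  have "quartic_form (scale_freud t w) = t ^ 4 * quartic_form w"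
    by (cases w rule: freud_exhaust)
      (simp add: power2_eq_square power3_eq_cube power4_eq_xxxx algebra_simps)
  with tw \<open>quartic_form u = 1\<close> have qw: "quartic_form w \<noteq> 0" by auto
  have aE: "a \<sigma> \<in> carrier E7" "a \<sigma> base_vec = base_vec" if "\<sigma> \<in> \<Gamma>" for \<sigma>
    using a [OF that] unfolding E6_eq_stabilizer by simp_all
  have aw: "g (a \<sigma> (g' w)) = w" if "\<sigma> \<in> \<Gamma>" for \<sigma>
  proof -
    have "g' w = scale_freud (inverse t) base_vec"
      unfolding w_def E7D(2) [OF g'(1)] by (simp add: u_def)
    then have "g (a \<sigma> (g' w)) = scale_freud (inverse t) (g base_vec)"
      by (simp only: E7D(2) [OF aE(1) [OF that]] E7D(2) [OF g] aE(2) [OF that])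
    then show ?thesis by (simp only: w_def u_def)
  qed
  \<comment> \<open>The hypothesis solved for the Galois conjugate of the inverse of
    \<open>x\<close>; the element h of the overview is \<open>x'\<close>.\<close>
  have eq': "S \<sigma> (x' (S' \<sigma> v)) = x' (g (a \<sigma> (g' v)))" if "\<sigma> \<in> \<Gamma>" for \<sigma> v
    using eq [OF that, of "S \<sigma> (x' (S' \<sigma> v))"] that by (simp add: gc flip: x'_def g'_def)
  have fw: "fixed_freud w" using Sw by (simp add: fixed_freud_def S_def)
  have "S \<sigma> (x' w) = x' w" if "\<sigma> \<in> \<Gamma>" for \<sigma>
    using eq' [OF that, of w] by (simp add: S'w aw that)
  then have "fixed_freud (x' w)" by (simp add: fixed_freud_def S_def)
  moreover have "quartic_form w = quartic_form (x' w)" by (rule E7D(4) [OF x'(1), symmetric])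
  ultimately have "E7_conj w (x' w)" using E7_conj_iff_quartic [OF fw] qw by blast
  then obtain r where r: "r \<in> carrier E7" "\<forall>\<sigma>\<in>\<Gamma>. \<forall>x. map_freud \<sigma> (r x) = r (map_freud \<sigma> x)" "x' w = r w"
    by (rule E7_conjE)
  define r' where "r' = inv_into UNIV r"
  have r'[simp]: "r' \<in> carrier E7" "\<And>v. r (r' v) = v" "\<And>v. r' (r v) = v"
    using E7_inv_into [OF r(1)] E7_inv_into_apply [OF r(1)] by (simp_all add: r'_def)
  have Sr': "S \<sigma> (r' v) = r' (S \<sigma> v)" if "\<sigma> \<in> \<Gamma>" for \<sigma> v
  proof -
    have "r (S \<sigma> (r' v)) = S \<sigma> v" using r(2) that r'(2) by (metis S_def)
    then show ?thesis by (metis r'(3))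
  qed
  \<comment> \<open>\<open>r' \<circ> x'\<close> fixes \<open>w\<close>, hence also
    \<open>u\<close>, and conjugation by \<open>g\<close> turns the stabilizer of \<open>u\<close>
    into that of \<open>base_vec\<close>. As \<open>r'\<close> commutes with the Galois action,
    inserting it leaves the coboundary relation intact.\<close>
  define y where "y = g' \<circ> r' \<circ> x' \<circ> g"
  have "y \<in> carrier E7"
    unfolding y_def by (intro E7_comp g'(1) r'(1) x'(1) g)
  moreover have "y base_vec = base_vec"
  proof -
    have "x' u = scale_freud t (r w)" by (simp only: tw [symmetric] E7D(2) [OF x'(1)] r(3))
    then have "r' (x' u) = u" by (simp only: E7D(2) [OF r'(1)] r'(3) tw)
    then show ?thesis by (simp add: y_def flip: u_def) (simp add: u_def)
  qed
  ultimately have "y \<in> E6_embed ` InvJ" unfolding E6_eq_stabilizer by blast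
  moreover have "galois_conj \<sigma> g (galois_conj \<sigma> y v) = g (y (a \<sigma> (inv_into UNIV g (galois_conj \<sigma> g v))))"
    if "\<sigma> \<in> \<Gamma>" for \<sigma> v
    using eq' [OF that, of "S \<sigma> (g (S' \<sigma> v))"] that by (simp add: gc y_def Sr' flip: g'_def)
  ultimately show ?thesis by blast
qed

end

lemma galois_acted_group_E7:
  fixes \<iota> :: "'f::field \<Rightarrow> 'k::field"
  assumes "galois_fixed (Gal \<iota>)"
  shows "galois_acted_group (E7 :: ('k freud \<Rightarrow> _, 'k) gal_group) \<iota>"
proof -
  interpret galois_fixed "TYPE('k)" "Gal \<iota>" by (rule assms)
  interpret group "E7 :: ('k freud \<Rightarrow> _, 'k) gal_group" by (rule group_E7)
  show ?thesis
  proof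
    fix \<sigma> assume \<sigma>: "\<sigma> \<in> Gal \<iota>"
    show "gact E7 \<sigma> \<in> hom E7 (E7 :: ('k freud \<Rightarrow> _, 'k) gal_group)"
      using galois_conj_in_E7 [OF hom [OF \<sigma>] bij [OF \<sigma>]]
      by (intro homI) (simp_all add: fun_eq_iff galois_conj_apply map_freud_inv_into [OF bij [OF \<sigma>]])
  qed
qed

theorem mainTheorem3:
  fixes \<iota> :: "'f::field \<Rightarrow> 'k::field"
    and \<kappa> :: "'f \<Rightarrow> 'c::comm_ring_1"
    and i :: 'k
    and b :: "('k \<Rightarrow> 'k) \<Rightarrow> 'k"
    and g :: "'k freud \<Rightarrow> 'k freud"
  assumes "CHAR('f) \<noteq> 2" and "CHAR('f) \<noteq> 3"
    and "separable_closure \<iota>"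
    and "quadratic_etale \<kappa>"
    and "i ^ 2 = -1"
    and "b \<in> Z1 \<iota> (mu 4)"
    and "\<exists>d\<in>quadratic_class \<kappa>.
           H1_map \<iota> (mu 2) (\<lambda>z. z ^ 2) (H1_class \<iota> (mu 4) b) = kummer_class \<iota> d"
    and "g \<in> carrier E7"
    and "\<forall>\<sigma>\<in>Gal \<iota>. mu4_embed i (b \<sigma>) = inv\<^bsub>E7\<^esub> g \<otimes>\<^bsub>E7\<^esub> gact E7 \<sigma> g"
  shows "H1_kernel \<iota> (E6K i b) E7 (\<lambda>x. g \<otimes>\<^bsub>E7\<^esub> x \<otimes>\<^bsub>E7\<^esub> inv\<^bsub>E7\<^esub> g) = {H1_trivial \<iota> (E6K i b)}"
proof -
  have \<iota>: "is_ring_hom \<iota>" using assms(3) by (simp add: separable_closure_def)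
  have numeral_nz: "\<iota> (of_nat n) = of_nat n" for n
    by (induction n) (simp_all add: is_ring_homD [OF \<iota>])
  have \<iota>_nz: "\<iota> x \<noteq> 0" if "x \<noteq> 0" for x
    using that is_ring_homD(2,3) [OF \<iota>] by (metis right_inverse mult_zero_left zero_neq_one)
  \<comment> \<open>A prime different from the characteristic of F is not divisible by it, since
    characteristic 1 is impossible, and \<iota> is injective.\<close>
  have prime_nz: "(of_nat p :: 'k) \<noteq> 0" if "prime p" "CHAR('f) \<noteq> p" for p
  proof -
    have "\<not> CHAR('f) dvd p"
    proof
      assume "CHAR('f) dvd p"
      with that have "CHAR('f) = 1" by (auto simp: prime_nat_iff)
      then show False using of_nat_CHAR [where 'a = 'f] by simp
    qed
    then have "\<iota> (of_nat p) \<noteq> 0" by (intro \<iota>_nz) (simp add: of_nat_eq_0_iff_char_dvd)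
    then show ?thesis by (simp add: numeral_nz)
  qed
  have char: "(2 :: 'k) \<noteq> 0" "(3 :: 'k) \<noteq> 0"
    using prime_nz [of 2] prime_nz [of 3] assms(1,2) by simp_all
  interpret galois_fixed "TYPE('k)" "Gal \<iota>"
    by unfold_locales (auto simp: char Gal_def)
  let ?E7 = "E7 :: ('k freud \<Rightarrow> _, 'k) gal_group"
  note GE7 = galois_acted_group_E7 [OF galois_fixed_axioms]
  interpret E7: galois_acted_group ?E7 \<iota> by (rule GE7)
  let ?G = "E6K i b"
  define \<beta> where "\<beta> \<sigma> = mu4_embed i (b \<sigma>)" for \<sigma>
  define g' where "g' = inv_into UNIV g"
  note g = \<open>g \<in> carrier E7\<close>
  have g' [simp]: "g' \<in> carrier E7" "g (g' v) = v" "g' (g v) = v" for v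
    using E7_inv_into [OF g] E7_inv_into_apply [OF g] by (simp_all add: g'_def)
  have \<beta>: "\<beta> \<sigma> \<in> carrier E7" "\<beta> \<sigma> v = g' (galois_conj \<sigma> g v)" if "\<sigma> \<in> Gal \<iota>" for \<sigma> v
  proof -
    have "\<beta> \<sigma> = inv\<^bsub>E7\<^esub> g \<otimes>\<^bsub>E7\<^esub> gact E7 \<sigma> g"
      using assms(9) that by (simp add: \<beta>_def)
    moreover have "inv\<^bsub>E7\<^esub> g \<otimes>\<^bsub>E7\<^esub> gact E7 \<sigma> g \<in> carrier E7"
      using g that by (intro E7.m_closed E7.inv_closed E7.act_simps)
    ultimately show "\<beta> \<sigma> \<in> carrier E7" "\<beta> \<sigma> v = g' (galois_conj \<sigma> g v)"
      by (simp_all add: inv_E7 [OF g] g'_def)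
  qed
  define \<beta>' where "\<beta>' \<sigma> = inv_into UNIV (\<beta> \<sigma>)" for \<sigma>
  have \<beta>' [simp]: "\<beta>' \<sigma> \<in> carrier E7" "\<beta> \<sigma> (\<beta>' \<sigma> v) = v" "\<beta>' \<sigma> (\<beta> \<sigma> v) = v" if "\<sigma> \<in> Gal \<iota>" for \<sigma> v
    using E7_inv_into [OF \<beta>(1) [OF that]] E7_inv_into_apply [OF \<beta>(1) [OF that]]
    by (simp_all add: \<beta>'_def)
  have b4: "(b \<sigma>) ^ 4 = 1" if "\<sigma> \<in> Gal \<iota>" for \<sigma>
    using assms(6) that unfolding Z1_def mu_def by auto
  have b_nz: "b \<sigma> \<noteq> 0" if "\<sigma> \<in> Gal \<iota>" for \<sigma>
    using b4 [OF that] by auto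
  have \<beta>_base: "\<beta> \<sigma> base_vec = scale_freud (b \<sigma>) base_vec" if "\<sigma> \<in> Gal \<iota>" for \<sigma>
    unfolding \<beta>_def by (rule mu4_embed_base_vec [OF assms(5) b4 [OF that]])
  define E6 where "E6 = E6_embed ` (InvJ :: ('k albert \<Rightarrow> _) set)"
  have E6: "x \<in> E6 \<longleftrightarrow> x \<in> carrier E7 \<and> x base_vec = base_vec" for x
    unfolding E6_def E6_eq_stabilizer by blast
  have G: "carrier ?G = E6" "mult ?G = (\<circ>)" "one ?G = id"
    by (simp_all add: E6K_def E6_def)
  have G_act: "gact ?G \<sigma> x v = \<beta> \<sigma> (galois_conj \<sigma> x (\<beta>' \<sigma> v))" if "\<sigma> \<in> Gal \<iota>" for \<sigma> x v
    using \<beta>(1) [OF that] by (simp add: E6K_def inv_E7 \<beta>'_def flip: \<beta>_def)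
  have E6_inv: "inv_into UNIV x \<in> E6" if "x \<in> E6" for x
    using that E7_inv_into [of x] E7_inv_into_apply [of x base_vec] unfolding E6 by metis
  have group_G: "group ?G"
  proof (rule groupI)
    fix x assume "x \<in> carrier ?G"
    then have x: "x \<in> E6" by (simp add: G)
    then have "inv_into UNIV x \<otimes>\<^bsub>?G\<^esub> x = \<one>\<^bsub>?G\<^esub>"
      unfolding E6 by (simp add: G fun_eq_iff E7_inv_into_apply)
    then show "\<exists>y\<in>carrier ?G. y \<otimes>\<^bsub>?G\<^esub> x = \<one>\<^bsub>?G\<^esub>"
      using E6_inv [OF x] unfolding G(1) by blast
  next
    fix x y assume "x \<in> carrier ?G" "y \<in> carrier ?G"
    then show "x \<otimes>\<^bsub>?G\<^esub> y \<in> carrier ?G"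
      using E7.m_closed [of x y] by (simp add: G E6)
  next
    show "\<one>\<^bsub>?G\<^esub> \<in> carrier ?G" using E7.one_closed by (simp add: G E6)
  qed (simp_all add: G o_assoc)
  have inv_G: "inv\<^bsub>?G\<^esub> x = inv_into UNIV x" if "x \<in> E6" for x
    using that E6_inv [OF that]
    by (intro group.inv_equality [OF group_G]) (simp_all add: G E6 fun_eq_iff E7_inv_into_apply)
  \<comment> \<open>On \<open>base_vec\<close> the two outer factors act by
    \<open>inverse (b \<sigma>)\<close> and \<open>b \<sigma>\<close>, and the conjugate of
    \<open>x\<close> fixes this vector with rational coordinates; so the twisted action preserves
    the stabilizer.\<close>
  have act_closed: "gact ?G \<sigma> x \<in> E6" if \<sigma>: "\<sigma> \<in> Gal \<iota>" and x: "x \<in> E6" for \<sigma> x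
  proof -
    have x': "galois_conj \<sigma> x \<in> carrier E7" "x base_vec = base_vec"
      using x galois_conj_in_E7 [OF hom [OF \<sigma>] bij [OF \<sigma>]] unfolding E6 by blast+
    have "gact ?G \<sigma> x = \<beta> \<sigma> \<circ> galois_conj \<sigma> x \<circ> \<beta>' \<sigma>"
      using \<sigma> by (simp add: fun_eq_iff G_act)
    then have "gact ?G \<sigma> x \<in> carrier E7"
      using E7.m_closed [OF E7.m_closed [OF \<beta>(1) [OF \<sigma>] x'(1)] \<beta>'(1) [OF \<sigma>]] by simp
    moreover have "gact ?G \<sigma> x base_vec = base_vec"
    proof -
      have "\<beta>' \<sigma> base_vec = scale_freud (inverse (b \<sigma>)) base_vec"
      proof -
        have "\<beta> \<sigma> (scale_freud (inverse (b \<sigma>)) base_vec) = base_vec"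
          unfolding E7D(2) [OF \<beta>(1) [OF \<sigma>]] \<beta>_base [OF \<sigma>] using b_nz [OF \<sigma>] by simp
        then show ?thesis by (metis \<beta>'(3) [OF \<sigma>])
      qed
      moreover have "galois_conj \<sigma> x base_vec = base_vec"
      proof -
        have "map_freud \<sigma> base_vec = base_vec"
          using is_ring_homD(3,4) [OF hom [OF \<sigma>]] map_albert_hom(4) [OF hom [OF \<sigma>]]
          by (simp add: base_vec_def)
        then show ?thesis
          unfolding galois_conj_apply by (metis map_freud_inv_into(2) [OF bij [OF \<sigma>]] x'(2))
      qed
      ultimately have "gact ?G \<sigma> x base_vec = scale_freud (inverse (b \<sigma>)) (scale_freud (b \<sigma>) base_vec)"
        by (simp only: G_act [OF \<sigma>] E7D(2) [OF x'(1)] E7D(2) [OF \<beta>(1) [OF \<sigma>]] \<beta>_base [OF \<sigma>])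
      then show ?thesis using b_nz [OF \<sigma>] by simp
    qed
    ultimately show ?thesis unfolding E6 by blast
  qed
  have GG: "galois_acted_group ?G \<iota>"
  proof -
    have "gact ?G \<sigma> \<in> hom ?G ?G" if \<sigma>: "\<sigma> \<in> Gal \<iota>" for \<sigma>
    proof (rule homI)
      show "gact ?G \<sigma> x \<in> carrier ?G" if "x \<in> carrier ?G" for x
        using act_closed [OF \<sigma>] that by (simp add: G)
      show "gact ?G \<sigma> (x \<otimes>\<^bsub>?G\<^esub> y) = gact ?G \<sigma> x \<otimes>\<^bsub>?G\<^esub> gact ?G \<sigma> y" for x y
        using \<sigma> by (simp add: G fun_eq_iff G_act galois_conj_apply map_freud_inv_into [OF bij [OF \<sigma>]])
    qed
    then show ?thesis
      using group_G by (simp add: galois_acted_group_def galois_acted_group_axioms_def)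
  qed
  show ?thesis
  proof (rule H1_kernel_trivialI [OF GG GE7])
    fix x assume "x \<in> carrier ?G"
    then have x: "x \<in> carrier E7" unfolding G E6 by blast
    then show "g \<otimes>\<^bsub>?E7\<^esub> x \<otimes>\<^bsub>?E7\<^esub> inv\<^bsub>?E7\<^esub> g \<in> carrier ?E7"
      using g by (intro E7.m_closed E7.inv_closed)
  next
    fix \<sigma> x assume \<sigma>: "\<sigma> \<in> Gal \<iota>" and "x \<in> carrier ?G"
    then have xE: "x \<in> E6" by (simp add: G)
    then have x: "x \<in> carrier E7" unfolding E6 by blast
    note [simp] = E7_inv_into_apply [OF x] map_freud_inv_into [OF bij [OF \<sigma>]]
    define x' where "x' = inv_into UNIV x"
    have h: "g \<circ> x \<circ> g' \<in> carrier E7" and h': "g \<circ> x' \<circ> g' \<in> carrier E7"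
      using E7.m_closed [OF E7.m_closed [OF g x] g'(1)]
        E7.m_closed [OF E7.m_closed [OF g E7_inv_into [OF x]] g'(1)] by (simp_all add: x'_def)
    have inv_h: "inv\<^bsub>?E7\<^esub> (g \<circ> x \<circ> g') = g \<circ> x' \<circ> g'"
      using h h' by (intro E7.inv_equality) (simp_all add: fun_eq_iff x'_def)
    \<comment> \<open>Inverse of b = g^-1 \<sigma>(g), with \<sigma> acting on g^-1. It makes
      conjugation by \<open>g\<close> carry the twisted action to the usual one.\<close>
    have \<beta>'_eq: "\<beta>' \<sigma> v = galois_conj \<sigma> g' (g v)" for v
    proof -
      have "\<beta> \<sigma> (galois_conj \<sigma> g' (g v)) = v"
        by (simp add: \<beta>(2) [OF \<sigma>] galois_conj_apply)
      then show ?thesis by (metis \<beta>'(3) [OF \<sigma>])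
    qed
    have "inv\<^bsub>?E7\<^esub> (g \<circ> x \<circ> g') \<circ> galois_conj \<sigma> (g \<circ> x \<circ> g')
      = g \<circ> (inv\<^bsub>?G\<^esub> x \<circ> gact ?G \<sigma> x) \<circ> g'"
      unfolding inv_h inv_G [OF xE]
      by (simp add: fun_eq_iff G_act [OF \<sigma>] \<beta>(2) [OF \<sigma>] \<beta>'_eq galois_conj_apply x'_def)
    then show "g \<otimes>\<^bsub>?E7\<^esub> (inv\<^bsub>?G\<^esub> x \<otimes>\<^bsub>?G\<^esub> gact ?G \<sigma> x) \<otimes>\<^bsub>?E7\<^esub> inv\<^bsub>?E7\<^esub> g
      = inv\<^bsub>?E7\<^esub> (g \<otimes>\<^bsub>?E7\<^esub> x \<otimes>\<^bsub>?E7\<^esub> inv\<^bsub>?E7\<^esub> g) \<otimes>\<^bsub>?E7\<^esub> gact ?E7 \<sigma> (g \<otimes>\<^bsub>?E7\<^esub> x \<otimes>\<^bsub>?E7\<^esub> inv\<^bsub>?E7\<^esub> g)"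
      unfolding E7_simps G(2) inv_E7 [OF g, folded g'_def] by (rule sym)
  next
    fix a x assume a: "a \<in> Gal \<iota> \<rightarrow> carrier ?G" and x: "x \<in> carrier ?E7"
      and eq: "\<And>\<sigma>. \<sigma> \<in> Gal \<iota> \<Longrightarrow> \<one>\<^bsub>?E7\<^esub> =
        inv\<^bsub>?E7\<^esub> x \<otimes>\<^bsub>?E7\<^esub> (g \<otimes>\<^bsub>?E7\<^esub> a \<sigma> \<otimes>\<^bsub>?E7\<^esub> inv\<^bsub>?E7\<^esub> g) \<otimes>\<^bsub>?E7\<^esub> gact ?E7 \<sigma> x"
    have "\<exists>y\<in>E6_embed ` InvJ. \<forall>\<sigma>\<in>Gal \<iota>. \<forall>v.
        galois_conj \<sigma> g (galois_conj \<sigma> y v) = g (y (a \<sigma> (inv_into UNIV g (galois_conj \<sigma> g v))))"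
    proof (rule coboundary_in_E6 [OF g x])
      fix \<sigma> assume \<sigma>: "\<sigma> \<in> Gal \<iota>"
      show "galois_conj \<sigma> g base_vec = g (scale_freud (b \<sigma>) base_vec)"
        using \<beta>(2) [OF \<sigma>, of base_vec] unfolding \<beta>_base [OF \<sigma>] by simp
      show "b \<sigma> \<noteq> 0" by (rule b_nz [OF \<sigma>])
      show "a \<sigma> \<in> E6_embed ` InvJ" using a \<sigma> unfolding G E6_def by blast
      show "v = inv_into UNIV x (g (a \<sigma> (inv_into UNIV g (galois_conj \<sigma> x v))))" for v
        using fun_cong [OF eq [OF \<sigma>], of v] by (simp add: inv_E7 [OF g] inv_E7 [OF x])
    qed
    then obtain y where y: "y \<in> E6" and yeq: "\<And>\<sigma> v. \<sigma> \<in> Gal \<iota> \<Longrightarrow>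
        galois_conj \<sigma> g (galois_conj \<sigma> y v) = g (y (a \<sigma> (g' (galois_conj \<sigma> g v))))"
      unfolding E6_def g'_def by blast
    have yE: "y \<in> carrier E7" using y unfolding E6 by blast
    \<comment> \<open>Evaluating \<open>yeq\<close> at \<open>\<beta>' \<sigma> v\<close> restores
      the inverse of the twisting element that the lemma had cleared.\<close>
    have "a \<sigma> v = inv_into UNIV y (gact ?G \<sigma> y v)" if \<sigma>: "\<sigma> \<in> Gal \<iota>" for \<sigma> v
    proof -
      have "gact ?G \<sigma> y v = g' (galois_conj \<sigma> g (galois_conj \<sigma> y (\<beta>' \<sigma> v)))"
        unfolding G_act [OF \<sigma>] \<beta>(2) [OF \<sigma>] ..
      also have "\<dots> = y (a \<sigma> (\<beta> \<sigma> (\<beta>' \<sigma> v)))"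
        unfolding yeq [OF \<sigma>] \<beta>(2) [OF \<sigma>] by simp
      finally show ?thesis using \<sigma> by (simp add: E7_inv_into_apply [OF yE])
    qed
    then have "\<forall>\<sigma>\<in>Gal \<iota>. a \<sigma> = inv\<^bsub>?G\<^esub> y \<otimes>\<^bsub>?G\<^esub> gact ?G \<sigma> y"
      unfolding inv_G [OF y] G(2) by (simp add: fun_eq_iff)
    then show "\<exists>y\<in>carrier ?G. \<forall>\<sigma>\<in>Gal \<iota>. a \<sigma> = inv\<^bsub>?G\<^esub> y \<otimes>\<^bsub>?G\<^esub> gact ?G \<sigma> y"
      using y unfolding G(1) by blast
  qed
qed

end
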